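(* Let $n$ be a natural number, let $X$ be a connected CW-complex of dimension $2n$, and let $F$ be a field with $\operatorname{char}(F)=0$ or $\operatorname{char}(F)>2n$. Assume that there exists an atoroidal cohomology class $u\in H^2(X;F)$ such that $u^n\neq 0\in H^{2n}(X;F)$. Then $\operatorname{TC}(X)=2\dim(X)$.
   Context: $H^*(-;F)$ is singular cohomology and $u^n$ is the $n$-fold cup power. A class $u\in H^k(X;F)$ is called atoroidal if $f^*u=0$ for every continuous map $f\colon T^k\to X$, where $T^k$ is the $k$-dimensional torus. Topological complexity (reduced convention): for a path-connected space $X$ let $PX=C([0,1],X)$ with the compact-open topology and $\pi\colon PX\to X\times X$, $\pi(\gamma)=(\gamma(0),\gamma(1))$. Then $\operatorname{TC}(X)$ is the minimal $k\ge 0$ such that there is an open cover $U_0,\dots,U_k$ of $X\times X$ (that is, $k+1$ open sets) and continuous maps $s_j\colon U_j\to PX$ with $\pi\circ s_j$ equal to the inclusion $U_j\hookrightarrow X\times X$ for each $j$; $\operatorname{TC}(X)=\infty$ if no such $k$ exists. *)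

theory Defs
  imports
    "HOL-Homology.Homology"
    "HOL-Library.Extended_Nat"
begin

section \<open>Singular cohomology with coefficients in a commutative ring\<close>

text \<open>A \<open>p\<close>-cochain is an arbitrary function on the singular \<open>p\<close>-simplices of \<open>X\<close>, i.e.\ a
  homomorphism from the free abelian group of singular \<open>p\<close>-chains to the coefficients; it is
  forced to be \<open>0\<close> outside its intended domain.\<close>

type_synonym ('a, 'f) cochain = "((nat \<Rightarrow> real) \<Rightarrow> 'a) \<Rightarrow> 'f"

definition singular_cochain :: "nat \<Rightarrow> 'a topology \<Rightarrow> ('a, 'f::comm_ring_1) cochain \<Rightarrow> bool"
  where "singular_cochain p X \<phi> \<longleftrightarrow> (\<forall>\<sigma>. \<not> singular_simplex p X \<sigma> \<longrightarrow> \<phi> \<sigma> = 0)"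

definition coboundary :: "nat \<Rightarrow> 'a topology \<Rightarrow> ('a, 'f::comm_ring_1) cochain \<Rightarrow> ('a, 'f) cochain"
  where "coboundary p X \<phi> =
    (\<lambda>\<sigma>. if singular_simplex (Suc p) X \<sigma>
         then \<Sum>k\<le>Suc p. (-1) ^ k * \<phi> (singular_face (Suc p) k \<sigma>) else 0)"

definition singular_cocycle :: "nat \<Rightarrow> 'a topology \<Rightarrow> ('a, 'f::comm_ring_1) cochain \<Rightarrow> bool"
  where "singular_cocycle p X \<phi> \<longleftrightarrow> singular_cochain p X \<phi> \<and> coboundary p X \<phi> = (\<lambda>_. 0)"

definition singular_coboundary :: "nat \<Rightarrow> 'a topology \<Rightarrow> ('a, 'f::comm_ring_1) cochain \<Rightarrow> bool"
  where "singular_coboundary p X \<phi> \<longleftrightarrow>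
    (case p of 0 \<Rightarrow> \<phi> = (\<lambda>_. 0)
     | Suc r \<Rightarrow> (\<exists>\<beta>. singular_cochain r X \<beta> \<and> \<phi> = coboundary r X \<beta>))"

definition cochain_group :: "nat \<Rightarrow> 'a topology \<Rightarrow> ('a, 'f::comm_ring_1) cochain monoid"
  where "cochain_group p X =
    \<lparr>carrier = Collect (singular_cochain p X),
     monoid.mult = (\<lambda>\<phi> \<psi> \<sigma>. \<phi> \<sigma> + \<psi> \<sigma>), one = (\<lambda>_. 0)\<rparr>"

definition cocycle_group :: "nat \<Rightarrow> 'a topology \<Rightarrow> ('a, 'f::comm_ring_1) cochain monoid"
  where "cocycle_group p X =
    subgroup_generated (cochain_group p X) (Collect (singular_cocycle p X))"

definition cohomology_group :: "nat \<Rightarrow> 'a topology \<Rightarrow> ('a, 'f::comm_ring_1) cochain set monoid"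
  where "cohomology_group p X = cocycle_group p X Mod Collect (singular_coboundary p X)"

definition cohomology_class ::
    "nat \<Rightarrow> 'a topology \<Rightarrow> ('a, 'f::comm_ring_1) cochain \<Rightarrow> ('a, 'f) cochain set"
  where "cohomology_class p X \<phi> =
    Collect (singular_coboundary p X) #>\<^bsub>cocycle_group p X\<^esub> \<phi>"

subsection \<open>Induced maps\<close>

definition cochain_pullback ::
    "nat \<Rightarrow> 'b topology \<Rightarrow> ('b \<Rightarrow> 'a) \<Rightarrow> ('a, 'f::comm_ring_1) cochain \<Rightarrow> ('b, 'f) cochain"
  where "cochain_pullback p Y f \<phi> =
    (\<lambda>\<sigma>. if singular_simplex p Y \<sigma> then \<phi> (simplex_map p f \<sigma>) else 0)"

text \<open>Operations on classes are defined by taking the union of the resulting classes over all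
  representatives. All of these coincide, see \<open>cohomology_pullback_class\<close> and
  \<open>cohomology_cup_class\<close> below.\<close>

definition cohomology_pullback ::
    "nat \<Rightarrow> 'b topology \<Rightarrow> ('b \<Rightarrow> 'a) \<Rightarrow> ('a, 'f::comm_ring_1) cochain set \<Rightarrow> ('b, 'f) cochain set"
  where "cohomology_pullback p Y f u =
    (\<Union>\<phi>\<in>u. cohomology_class p Y (cochain_pullback p Y f \<phi>))"

subsection \<open>Cup products\<close>

definition front_face :: "nat \<Rightarrow> ((nat \<Rightarrow> real) \<Rightarrow> 'a) \<Rightarrow> (nat \<Rightarrow> real) \<Rightarrow> 'a"
  where "front_face p \<sigma> = restrict \<sigma> (standard_simplex p)"

definition back_face :: "nat \<Rightarrow> nat \<Rightarrow> ((nat \<Rightarrow> real) \<Rightarrow> 'a) \<Rightarrow> (nat \<Rightarrow> real) \<Rightarrow> 'a"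
  where "back_face p q \<sigma> =
    restrict (\<lambda>x. \<sigma> (\<lambda>i. if i < p then 0 else x (i - p))) (standard_simplex q)"

definition cochain_cup ::
    "nat \<Rightarrow> nat \<Rightarrow> 'a topology \<Rightarrow> ('a, 'f::comm_ring_1) cochain \<Rightarrow> ('a, 'f) cochain \<Rightarrow> ('a, 'f) cochain"
  where "cochain_cup p q X \<phi> \<psi> =
    (\<lambda>\<sigma>. if singular_simplex (p + q) X \<sigma> then \<phi> (front_face p \<sigma>) * \<psi> (back_face p q \<sigma>) else 0)"

definition cohomology_cup ::
    "nat \<Rightarrow> nat \<Rightarrow> 'a topology \<Rightarrow> ('a, 'f::comm_ring_1) cochain set \<Rightarrow> ('a, 'f) cochain set
      \<Rightarrow> ('a, 'f) cochain set"
  where "cohomology_cup p q X u v =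
    (\<Union>\<phi>\<in>u. \<Union>\<psi>\<in>v. cohomology_class (p + q) X (cochain_cup p q X \<phi> \<psi>))"

definition unit_cochain :: "'a topology \<Rightarrow> ('a, 'f::comm_ring_1) cochain"
  where "unit_cochain X = (\<lambda>\<sigma>. if singular_simplex 0 X \<sigma> then 1 else 0)"

primrec cup_power ::
    "nat \<Rightarrow> 'a topology \<Rightarrow> ('a, 'f::comm_ring_1) cochain set \<Rightarrow> nat \<Rightarrow> ('a, 'f) cochain set"
  where
    "cup_power k X u 0 = cohomology_class 0 X (unit_cochain X)"
  | "cup_power k X u (Suc n) = cohomology_cup (k * n) k X (cup_power k X u n) u"

subsection \<open>Well-definedness of the operations on classes\<close>

lemma singular_coboundary_0: "singular_coboundary 0 X \<phi> \<longleftrightarrow> \<phi> = (\<lambda>_. 0)"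
  by (simp add: singular_coboundary_def)

lemma singular_coboundary_Suc:
  "singular_coboundary (Suc p) X \<phi> \<longleftrightarrow> (\<exists>\<beta>. singular_cochain p X \<beta> \<and> \<phi> = coboundary p X \<beta>)"
  by (simp add: singular_coboundary_def)

lemma coboundary_add:
  "coboundary p X (\<lambda>\<sigma>. \<phi> \<sigma> + \<psi> \<sigma>) = (\<lambda>\<sigma>. coboundary p X \<phi> \<sigma> + coboundary p X \<psi> \<sigma>)"
  by (rule ext) (simp only: coboundary_def sum.distrib distrib_left split: if_split, simp)

lemma coboundary_cmul:
  "coboundary p X (\<lambda>\<sigma>. c * \<phi> \<sigma>) = (\<lambda>\<sigma>. c * coboundary p X \<phi> \<sigma>)"
  by (rule ext) (simp only: coboundary_def sum_distrib_left mult.left_commute split: if_split, simp)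

lemma coboundary_zero [simp]: "coboundary p X (\<lambda>_. 0) = (\<lambda>_. 0)"
  by (rule ext) (simp add: coboundary_def)

lemma singular_cochain_zero [simp]: "singular_cochain p X (\<lambda>_. 0)"
  by (simp add: singular_cochain_def)

lemma singular_cochain_add:
  "singular_cochain p X \<phi> \<Longrightarrow> singular_cochain p X \<psi> \<Longrightarrow> singular_cochain p X (\<lambda>\<sigma>. \<phi> \<sigma> + \<psi> \<sigma>)"
  by (simp add: singular_cochain_def)

lemma singular_cochain_cmul:
  "singular_cochain p X \<phi> \<Longrightarrow> singular_cochain p X (\<lambda>\<sigma>. c * \<phi> \<sigma>)"
  by (simp add: singular_cochain_def)

lemma singular_cochain_coboundary: "singular_cochain (Suc p) X (coboundary p X \<phi>)"
  by (simp add: singular_cochain_def coboundary_def)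

lemma singular_cocycle_add:
  "singular_cocycle p X \<phi> \<Longrightarrow> singular_cocycle p X \<psi> \<Longrightarrow> singular_cocycle p X (\<lambda>\<sigma>. \<phi> \<sigma> + \<psi> \<sigma>)"
  by (simp add: singular_cocycle_def coboundary_add singular_cochain_add)

lemma singular_cocycle_cmul:
  "singular_cocycle p X \<phi> \<Longrightarrow> singular_cocycle p X (\<lambda>\<sigma>. c * \<phi> \<sigma>)"
  by (simp add: singular_cocycle_def coboundary_cmul singular_cochain_cmul)

lemma singular_coboundary_zero: "singular_coboundary p X (\<lambda>_. 0)"
  by (cases p) (auto simp: singular_coboundary_0 singular_coboundary_Suc intro!: exI[of _ "\<lambda>_. 0"])

lemma singular_coboundary_add:
  assumes "singular_coboundary p X \<phi>" "singular_coboundary p X \<psi>"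
  shows "singular_coboundary p X (\<lambda>\<sigma>. \<phi> \<sigma> + \<psi> \<sigma>)"
proof (cases p)
  case 0
  then show ?thesis using assms by (simp add: singular_coboundary_0)
next
  case (Suc r)
  then obtain \<beta> \<gamma> where "singular_cochain r X \<beta>" "\<phi> = coboundary r X \<beta>"
      "singular_cochain r X \<gamma>" "\<psi> = coboundary r X \<gamma>"
    using assms by (auto simp: singular_coboundary_Suc)
  then show ?thesis
    unfolding Suc singular_coboundary_Suc
    by (intro exI[of _ "\<lambda>\<sigma>. \<beta> \<sigma> + \<gamma> \<sigma>"]) (simp add: coboundary_add singular_cochain_add)
qed

lemma singular_coboundary_cmul:
  assumes "singular_coboundary p X \<phi>"
  shows "singular_coboundary p X (\<lambda>\<sigma>. c * \<phi> \<sigma>)"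
proof (cases p)
  case 0
  then show ?thesis using assms by (simp add: singular_coboundary_0)
next
  case (Suc r)
  then obtain \<beta> where "singular_cochain r X \<beta>" "\<phi> = coboundary r X \<beta>"
    using assms by (auto simp: singular_coboundary_Suc)
  then show ?thesis
    unfolding Suc singular_coboundary_Suc
    by (intro exI[of _ "\<lambda>\<sigma>. c * \<beta> \<sigma>"]) (simp add: coboundary_cmul singular_cochain_cmul)
qed

text \<open>The coboundary is dual to \<^const>\<open>chain_boundary\<close> under the evaluation pairing.\<close>

definition cochain_eval :: "('a, 'f::comm_ring_1) cochain \<Rightarrow> 'a chain \<Rightarrow> 'f"
  where "cochain_eval \<phi> c = (\<Sum>\<sigma>\<in>Poly_Mapping.keys c. of_int (Poly_Mapping.lookup c \<sigma>) * \<phi> \<sigma>)"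

lemma cochain_eval_superset:
  assumes "finite S" "Poly_Mapping.keys c \<subseteq> S"
  shows "cochain_eval \<phi> c = (\<Sum>\<sigma>\<in>S. of_int (Poly_Mapping.lookup c \<sigma>) * \<phi> \<sigma>)"
  unfolding cochain_eval_def
  by (rule sum.mono_neutral_left) (use assms in \<open>auto simp: in_keys_iff\<close>)

lemma cochain_eval_add: "cochain_eval \<phi> (a + b) = cochain_eval \<phi> a + cochain_eval \<phi> b"
proof -
  let ?S = "Poly_Mapping.keys a \<union> Poly_Mapping.keys b"
  have "Poly_Mapping.keys (a + b) \<subseteq> ?S" by (rule keys_add)
  then show ?thesis
    by (simp add: cochain_eval_superset[of ?S] lookup_add sum.distrib distrib_right)
qed

lemma cochain_eval_0 [simp]: "cochain_eval \<phi> 0 = 0"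
  by (simp add: cochain_eval_def)

lemma cochain_eval_of [simp]: "cochain_eval \<phi> (frag_of \<sigma>) = \<phi> \<sigma>"
  by (simp add: cochain_eval_def)

lemma cochain_eval_cmul: "cochain_eval \<phi> (frag_cmul k c) = of_int k * cochain_eval \<phi> c"
proof -
  have "Poly_Mapping.keys (frag_cmul k c) \<subseteq> Poly_Mapping.keys c" by (rule keys_cmul)
  then have "cochain_eval \<phi> (frag_cmul k c) =
      (\<Sum>\<sigma>\<in>Poly_Mapping.keys c. of_int (Poly_Mapping.lookup (frag_cmul k c) \<sigma>) * \<phi> \<sigma>)"
    by (intro cochain_eval_superset) simp_all
  then show ?thesis
    by (simp add: cochain_eval_def sum_distrib_left mult.assoc)
qed

lemma cochain_eval_sum: "cochain_eval \<phi> (\<Sum>i\<in>I. c i) = (\<Sum>i\<in>I. cochain_eval \<phi> (c i))"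
  by (induction I rule: infinite_finite_induct) (simp_all add: cochain_eval_add)

lemma coboundary_eq_eval:
  assumes "singular_simplex (Suc p) X \<sigma>"
  shows "coboundary p X \<phi> \<sigma> = cochain_eval \<phi> (chain_boundary (Suc p) (frag_of \<sigma>))"
  using assms
  by (simp add: coboundary_def chain_boundary_of cochain_eval_sum cochain_eval_cmul cochain_eval_add
      del: sum.atMost_Suc)

lemma cochain_eval_boundary:
  assumes "singular_chain (Suc p) X c"
  shows "cochain_eval (coboundary p X \<phi>) c = cochain_eval \<phi> (chain_boundary (Suc p) c)"
  using assms unfolding singular_chain_def
proof (induction rule: frag_induction)
  case (one \<sigma>)
  then show ?case by (simp add: coboundary_eq_eval)
next
  case (diff a b)
  have *: "cochain_eval \<psi> (x - y) = cochain_eval \<psi> x - cochain_eval \<psi> y"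
    for \<psi> :: "('a, 'b) cochain" and x y
    using cochain_eval_add[of \<psi> "x - y" y] by simp
  show ?case using diff by (simp add: * chain_boundary_diff)
qed simp

lemma coboundary_coboundary: "coboundary (Suc p) X (coboundary p X \<phi>) = (\<lambda>_. 0)"
proof
  fix \<sigma>
  show "coboundary (Suc p) X (coboundary p X \<phi>) \<sigma> = 0"
  proof (cases "singular_simplex (Suc (Suc p)) X \<sigma>")
    case True
    then have c: "singular_chain (Suc (Suc p)) X (frag_of \<sigma>)"
      by (simp add: singular_chain_of)
    show ?thesis
      by (simp add: coboundary_eq_eval[OF True] cochain_eval_boundary[OF singular_chain_boundary_alt[OF c]]
          chain_boundary_boundary_alt[OF c])
  qed (simp add: coboundary_def)
qed

lemma singular_coboundary_imp_cocycle: "singular_coboundary p X \<phi> \<Longrightarrow> singular_cocycle p X \<phi>"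
  by (cases p) (auto simp: singular_coboundary_0 singular_coboundary_Suc singular_cocycle_def
      coboundary_coboundary singular_cochain_coboundary)

lemma comm_group_cochain_group: "comm_group (cochain_group p X)"
proof (rule comm_groupI)
  fix \<phi> assume "\<phi> \<in> carrier (cochain_group p X)"
  then show "\<exists>\<psi>\<in>carrier (cochain_group p X). \<psi> \<otimes>\<^bsub>cochain_group p X\<^esub> \<phi> = \<one>\<^bsub>cochain_group p X\<^esub>"
    using singular_cochain_cmul[of p X \<phi> "-1"]
    by (intro bexI[of _ "\<lambda>\<sigma>. -1 * \<phi> \<sigma>"]) (auto simp: cochain_group_def)
qed (auto simp: cochain_group_def singular_cochain_add add.assoc add.commute)

lemma inv_cochain_group:
  assumes "singular_cochain p X \<phi>"
  shows "inv\<^bsub>cochain_group p X\<^esub> \<phi> = (\<lambda>\<sigma>. -1 * \<phi> \<sigma>)"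
proof -
  interpret comm_group "cochain_group p X :: (('a, 'b) cochain) monoid"
    by (rule comm_group_cochain_group)
  show ?thesis
    by (rule inv_equality)
      (use assms singular_cochain_cmul[OF assms, of "-1"] in \<open>auto simp: cochain_group_def\<close>)
qed

lemma subgroup_cocycle: "subgroup (Collect (singular_cocycle p X)) (cochain_group p X)"
proof
  show "Collect (singular_cocycle p X) \<subseteq> carrier (cochain_group p X)"
    by (auto simp: cochain_group_def singular_cocycle_def)
  show "\<phi> \<otimes>\<^bsub>cochain_group p X\<^esub> \<psi> \<in> Collect (singular_cocycle p X)"
    if "\<phi> \<in> Collect (singular_cocycle p X)" "\<psi> \<in> Collect (singular_cocycle p X)" for \<phi> \<psi>
    using that by (simp add: cochain_group_def singular_cocycle_add)
  show "\<one>\<^bsub>cochain_group p X\<^esub> \<in> Collect (singular_cocycle p X)"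
    by (simp add: cochain_group_def singular_cocycle_def)
  show "inv\<^bsub>cochain_group p X\<^esub> \<phi> \<in> Collect (singular_cocycle p X)"
    if "\<phi> \<in> Collect (singular_cocycle p X)" for \<phi>
    using that singular_cocycle_cmul[of p X \<phi> "-1"]
    by (subst inv_cochain_group) (auto simp: singular_cocycle_def)
qed

lemma carrier_cocycle_group [simp]:
  "carrier (cocycle_group p X) = Collect (singular_cocycle p X)"
proof -
  interpret comm_group "cochain_group p X :: (('a, 'b) cochain) monoid"
    by (rule comm_group_cochain_group)
  show ?thesis
    unfolding cocycle_group_def
    by (rule subgroup.carrier_subgroup_generated_subgroup[OF subgroup_cocycle])
qed

lemma mult_cocycle_group [simp]:
  "\<phi> \<otimes>\<^bsub>cocycle_group p X\<^esub> \<psi> = (\<lambda>\<sigma>. \<phi> \<sigma> + \<psi> \<sigma>)"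
  by (simp add: cocycle_group_def cochain_group_def)

lemma one_cocycle_group [simp]: "\<one>\<^bsub>cocycle_group p X\<^esub> = (\<lambda>_. 0)"
  by (simp add: cocycle_group_def cochain_group_def)

lemma comm_group_cocycle_group: "comm_group (cocycle_group p X)"
  unfolding cocycle_group_def
  by (intro group.abelian_subgroup_generated comm_group.axioms(2) comm_group_cochain_group)

lemma normal_coboundary: "Collect (singular_coboundary p X) \<lhd> cocycle_group p X"
proof -
  interpret comm_group "cocycle_group p X :: (('a, 'b) cochain) monoid"
    by (rule comm_group_cocycle_group)
  have "subgroup (Collect (singular_coboundary p X)) (cocycle_group p X :: (('a, 'b) cochain) monoid)"
  proof (rule subgroupI)
    show "inv\<^bsub>cocycle_group p X\<^esub> \<phi> \<in> Collect (singular_coboundary p X)"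
      if "\<phi> \<in> Collect (singular_coboundary p X)" for \<phi> :: "('a, 'b) cochain"
    proof -
      have "inv\<^bsub>cocycle_group p X\<^esub> \<phi> = (\<lambda>\<sigma>. -1 * \<phi> \<sigma>)"
        by (rule inv_equality)
          (use that singular_coboundary_imp_cocycle singular_cocycle_cmul[of p X \<phi> "-1"] in auto)
      then show ?thesis using that singular_coboundary_cmul[of p X \<phi> "-1"] by simp
    qed
  qed (auto intro: singular_coboundary_imp_cocycle singular_coboundary_add singular_coboundary_zero)
  then show ?thesis by (rule subgroup_imp_normal)
qed

lemma comm_group_cohomology_group: "comm_group (cohomology_group p X)"
  unfolding cohomology_group_def
  by (intro comm_group.abelian_FactGroup comm_group_cocycle_group
      normal_imp_subgroup normal_coboundary)

lemma carrier_cohomology_group: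
  "carrier (cohomology_group p X) = cohomology_class p X ` Collect (singular_cocycle p X)"
  by (auto simp: cohomology_group_def cohomology_class_def FactGroup_def RCOSETS_def)

lemma one_cohomology_group:
  "\<one>\<^bsub>cohomology_group p X\<^esub> = Collect (singular_coboundary p X)"
  by (simp add: cohomology_group_def FactGroup_def)

lemma mem_cohomology_class:
  "\<psi> \<in> cohomology_class p X \<phi> \<longleftrightarrow> (\<exists>\<beta>. singular_coboundary p X \<beta> \<and> \<psi> = (\<lambda>\<sigma>. \<beta> \<sigma> + \<phi> \<sigma>))"
  by (auto simp: cohomology_class_def r_coset_def)

lemma cohomology_class_shift:
  assumes "singular_coboundary p X \<beta>"
  shows "cohomology_class p X (\<lambda>\<sigma>. \<beta> \<sigma> + \<phi> \<sigma>) = cohomology_class p X \<phi>"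
proof (intro equalityI subsetI)
  fix \<psi>
  assume "\<psi> \<in> cohomology_class p X (\<lambda>\<sigma>. \<beta> \<sigma> + \<phi> \<sigma>)"
  then obtain \<gamma> where "singular_coboundary p X \<gamma>" "\<psi> = (\<lambda>\<sigma>. \<gamma> \<sigma> + (\<beta> \<sigma> + \<phi> \<sigma>))"
    by (auto simp: mem_cohomology_class)
  then show "\<psi> \<in> cohomology_class p X \<phi>"
    unfolding mem_cohomology_class
    using singular_coboundary_add[of p X \<gamma> \<beta>] assms
    by (intro exI[of _ "\<lambda>\<sigma>. \<gamma> \<sigma> + \<beta> \<sigma>"]) (auto simp: add.assoc)
next
  fix \<psi>
  assume "\<psi> \<in> cohomology_class p X \<phi>"
  then obtain \<gamma> where "singular_coboundary p X \<gamma>" "\<psi> = (\<lambda>\<sigma>. \<gamma> \<sigma> + \<phi> \<sigma>)"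
    by (auto simp: mem_cohomology_class)
  then show "\<psi> \<in> cohomology_class p X (\<lambda>\<sigma>. \<beta> \<sigma> + \<phi> \<sigma>)"
    unfolding mem_cohomology_class
    using singular_coboundary_add[of p X \<gamma> "\<lambda>\<sigma>. -1 * \<beta> \<sigma>"] singular_coboundary_cmul[OF assms, of "-1"]
    by (intro exI[of _ "\<lambda>\<sigma>. \<gamma> \<sigma> + -1 * \<beta> \<sigma>"]) auto
qed

lemma coboundary_pullback:
  assumes "continuous_map Y X f"
  shows "coboundary p Y (cochain_pullback p Y f \<phi>) = cochain_pullback (Suc p) Y f (coboundary p X \<phi>)"
proof
  fix \<sigma>
  have eq: "simplex_map p f (singular_face (Suc p) k \<sigma>) = singular_face (Suc p) k (simplex_map (Suc p) f \<sigma>)"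
    if "k \<le> Suc p" for k
    using that simplical_face_in_standard_simplex[of "Suc p" k]
    by (auto simp: simplex_map_def singular_face_def fun_eq_iff restrict_def)
  show "coboundary p Y (cochain_pullback p Y f \<phi>) \<sigma> = cochain_pullback (Suc p) Y f (coboundary p X \<phi>) \<sigma>"
  proof (cases "singular_simplex (Suc p) Y \<sigma>")
    case True
    then have "singular_simplex p Y (singular_face (Suc p) k \<sigma>)" if "k \<le> Suc p" for k
      using singular_simplex_singular_face[OF True, of k] that by simp
    with True assms show ?thesis
      unfolding coboundary_def cochain_pullback_def
      by (simp add: singular_simplex_simplex_map eq del: sum.atMost_Suc)
  qed (simp add: coboundary_def cochain_pullback_def)
qed

lemma singular_cochain_pullback: "singular_cochain p Y (cochain_pullback p Y f \<phi>)"
  by (simp add: singular_cochain_def cochain_pullback_def)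

lemma singular_cocycle_pullback:
  "continuous_map Y X f \<Longrightarrow> singular_cocycle p X \<phi> \<Longrightarrow> singular_cocycle p Y (cochain_pullback p Y f \<phi>)"
  by (simp add: singular_cocycle_def singular_cochain_pullback coboundary_pullback)
    (simp add: cochain_pullback_def fun_eq_iff)

lemma singular_coboundary_pullback:
  assumes "continuous_map Y X f" "singular_coboundary p X \<phi>"
  shows "singular_coboundary p Y (cochain_pullback p Y f \<phi>)"
proof (cases p)
  case 0
  then show ?thesis using assms by (simp add: singular_coboundary_0 cochain_pullback_def)
next
  case (Suc r)
  then obtain \<beta> where "\<phi> = coboundary r X \<beta>"
    using assms by (auto simp: singular_coboundary_Suc)
  then show ?thesis
    unfolding Suc singular_coboundary_Suc
    using coboundary_pullback[OF assms(1)] singular_cochain_pullback by metis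
qed

theorem cohomology_pullback_class:
  assumes f: "continuous_map Y X f"
  shows "cohomology_pullback p Y f (cohomology_class p X \<phi>) =
         cohomology_class p Y (cochain_pullback p Y f \<phi>)"
proof -
  have "cohomology_class p Y (cochain_pullback p Y f \<psi>) = cohomology_class p Y (cochain_pullback p Y f \<phi>)"
    if "\<psi> \<in> cohomology_class p X \<phi>" for \<psi>
  proof -
    obtain \<beta> where \<beta>: "singular_coboundary p X \<beta>" "\<psi> = (\<lambda>\<sigma>. \<beta> \<sigma> + \<phi> \<sigma>)"
      using \<open>\<psi> \<in> _\<close> by (auto simp: mem_cohomology_class)
    have "cochain_pullback p Y f \<psi> =
        (\<lambda>\<sigma>. cochain_pullback p Y f \<beta> \<sigma> + cochain_pullback p Y f \<phi> \<sigma>)"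
      by (auto simp: \<beta> cochain_pullback_def)
    then show ?thesis
      using cohomology_class_shift[OF singular_coboundary_pullback[OF f \<beta>(1)]] by simp
  qed
  moreover have "\<phi> \<in> cohomology_class p X \<phi>"
    by (auto simp: mem_cohomology_class intro!: exI[of _ "\<lambda>_. 0"] singular_coboundary_zero)
  ultimately show ?thesis
    unfolding cohomology_pullback_def by blast
qed

lemma front_face_simplex:
  assumes "singular_simplex (p + q) X \<sigma>"
  shows "singular_simplex p X (front_face p \<sigma>)"
proof -
  have "continuous_map (subtopology (powertop_real UNIV) (standard_simplex p)) X \<sigma>"
    using assms standard_simplex_mono[of p "p + q"]
    by (auto simp: singular_simplex_def intro: continuous_map_from_subtopology_mono)
  then show ?thesis
    by (auto simp: singular_simplex_def front_face_def intro: continuous_map_eq)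
qed

lemma shift_in_standard_simplex:
  assumes "x \<in> standard_simplex q"
  shows "(\<lambda>i. if i < p then 0 else x (i - p)) \<in> standard_simplex (p + q)"
proof -
  have "(\<Sum>i\<le>p + q. if i < p then 0 else x (i - p)) = (\<Sum>i\<in>{p..p + q}. x (i - p))"
    by (rule sum.mono_neutral_cong_right) auto
  also have "\<dots> = (\<Sum>i\<le>q. x i)"
    using sum.shift_bounds_cl_nat_ivl[of "\<lambda>i. x (i - p)" 0 p q]
    by (simp add: add.commute atMost_atLeast0)
  finally show ?thesis
    using assms by (auto simp: standard_simplex_def)
qed

lemma back_face_simplex:
  assumes "singular_simplex (p + q) X \<sigma>"
  shows "singular_simplex q X (back_face p q \<sigma>)"
proof -
  let ?s = "\<lambda>(x::nat \<Rightarrow> real) i. if i < p then 0 else x (i - p)"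
  have "continuous_map (powertop_real UNIV) euclideanreal (\<lambda>x. ?s x i)" for i
    by (cases "i < p") (auto intro: continuous_map_product_projection)
  then have "continuous_map (subtopology (powertop_real UNIV) (standard_simplex q))
      (subtopology (powertop_real UNIV) (standard_simplex (p + q))) ?s"
    using shift_in_standard_simplex
    by (auto simp: continuous_map_in_subtopology continuous_map_componentwise
        intro!: continuous_map_from_subtopology continuous_map_product_projection)
  from continuous_map_compose[OF this, of X \<sigma>] assms
  have "continuous_map (subtopology (powertop_real UNIV) (standard_simplex q)) X (\<sigma> \<circ> ?s)"
    by (simp add: singular_simplex_def)
  then show ?thesis
    by (auto simp: singular_simplex_def back_face_def o_def intro: continuous_map_eq)
qed

lemma simplical_face_above:
  assumes "x \<in> standard_simplex p" "p < k"
  shows "simplical_face k x = x"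
  using assms by (auto simp: simplical_face_def standard_simplex_def fun_eq_iff)

lemma front_face_low:
  assumes "k \<le> Suc p"
  shows "front_face p (singular_face (Suc (p + q)) k \<sigma>) =
         singular_face (Suc p) k (front_face (Suc p) \<sigma>)"
  using assms simplical_face_in_standard_simplex[of "Suc p" k] standard_simplex_mono[of p "p + q"]
  by (auto simp: front_face_def singular_face_def fun_eq_iff restrict_def)

lemma front_face_high:
  assumes "p < k"
  shows "front_face p (singular_face (Suc (p + q)) k \<sigma>) = front_face p \<sigma>"
  using assms standard_simplex_mono[of p "p + q"]
  by (auto simp: front_face_def singular_face_def fun_eq_iff restrict_def simplical_face_above)

lemma back_face_low:
  assumes "k \<le> p"
  shows "back_face p q (singular_face (Suc (p + q)) k \<sigma>) = back_face (Suc p) q \<sigma>"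
proof -
  have "simplical_face k (\<lambda>i. if i < p then 0 else x (i - p)) =
      (\<lambda>i. if i < Suc p then 0 else x (i - Suc p))" (is "?l x = ?r x") for x :: "nat \<Rightarrow> real"
    using assms by (auto simp: simplical_face_def fun_eq_iff)
  then have "\<sigma> (?l x) = \<sigma> (?r x)" for x
    by (rule arg_cong)
  then show ?thesis
    using shift_in_standard_simplex[of _ q p]
    by (intro ext) (simp add: back_face_def singular_face_def)
qed

lemma back_face_high:
  assumes "j \<le> Suc q"
  shows "back_face p q (singular_face (Suc (p + q)) (p + j) \<sigma>) =
         singular_face (Suc q) j (back_face p (Suc q) \<sigma>)"
proof -
  have "simplical_face (p + j) (\<lambda>i. if i < p then 0 else x (i - p)) =
      (\<lambda>i. if i < p then 0 else simplical_face j x (i - p))" (is "?l x = ?r x") for x :: "nat \<Rightarrow> real"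
    by (auto simp: simplical_face_def fun_eq_iff diff_right_commute)
  then have "\<sigma> (?l x) = \<sigma> (?r x)" for x
    by (rule arg_cong)
  then show ?thesis
    using shift_in_standard_simplex[of _ q p] simplical_face_in_standard_simplex[of "Suc q" j] assms
    by (intro ext) (simp add: back_face_def singular_face_def)
qed

lemma coboundary_cup:
  "coboundary (p + q) X (cochain_cup p q X \<phi> \<psi>) =
   (\<lambda>\<sigma>. cochain_cup (Suc p) q X (coboundary p X \<phi>) \<psi> \<sigma>
        + (-1) ^ p * cochain_cup p (Suc q) X \<phi> (coboundary q X \<psi>) \<sigma>)"
proof
  fix \<sigma>
  show "coboundary (p + q) X (cochain_cup p q X \<phi> \<psi>) \<sigma> =
     cochain_cup (Suc p) q X (coboundary p X \<phi>) \<psi> \<sigma>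
        + (-1) ^ p * cochain_cup p (Suc q) X \<phi> (coboundary q X \<psi>) \<sigma>"
  proof (cases "singular_simplex (Suc (p + q)) X \<sigma>")
    case True
    define F where "F = front_face p \<sigma>"
    define F' where "F' = front_face (Suc p) \<sigma>"
    define B where "B = back_face (Suc p) q \<sigma>"
    define B' where "B' = back_face p (Suc q) \<sigma>"
    have ss: "singular_simplex (Suc p) X F'" "singular_simplex (Suc q) X B'"
      using front_face_simplex[of "Suc p" q X \<sigma>] back_face_simplex[of p "Suc q" X \<sigma>] True
      by (simp_all add: F'_def B'_def)
    have face: "singular_simplex (p + q) X (singular_face (Suc (p + q)) k \<sigma>)" if "k \<le> Suc (p + q)" for k
      using singular_simplex_singular_face[OF True, of k] that by simp
    have F'F: "singular_face (Suc p) (Suc p) F' = F"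
      using front_face_low[of "Suc p" p q \<sigma>] front_face_high[of p "Suc p" q \<sigma>]
      by (simp add: F_def F'_def)
    have B'B: "singular_face (Suc q) 0 B' = B"
      using back_face_low[of p p q \<sigma>] back_face_high[of 0 q p \<sigma>]
      by (simp add: B_def B'_def)
    let ?t = "\<lambda>k. (-1) ^ k * (\<phi> (front_face p (singular_face (Suc (p + q)) k \<sigma>)) *
        \<psi> (back_face p q (singular_face (Suc (p + q)) k \<sigma>)))"
    let ?a = "\<lambda>k. (-1) ^ k * (\<phi> (singular_face (Suc p) k F') * \<psi> B)"
    let ?b = "\<lambda>j. (-1) ^ (p + j) * (\<phi> F * \<psi> (singular_face (Suc q) j B'))"
    have "{..Suc (p + q)} = {..p} \<union> {Suc p..Suc (p + q)}" by auto
    then have "coboundary (p + q) X (cochain_cup p q X \<phi> \<psi>) \<sigma> =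
        sum ?t {..p} + sum ?t {Suc p..Suc (p + q)}"
      using True face
      by (simp add: coboundary_def cochain_cup_def sum.union_disjoint del: sum.atMost_Suc)
    also have "sum ?t {..p} = sum ?a {..p}"
      by (rule sum.cong) (simp_all add: front_face_low back_face_low F'_def B_def)
    also have "sum ?t {Suc p..Suc (p + q)} = (\<Sum>j\<in>{1..Suc q}. ?t (p + j))"
      using sum.shift_bounds_cl_nat_ivl[of ?t 1 p "Suc q"] by (simp add: add.commute)
    also have "\<dots> = sum ?b {1..Suc q}"
      by (rule sum.cong) (simp_all add: front_face_high back_face_high F_def B'_def)
    also have "sum ?a {..p} = sum ?a {..Suc p} - ?a (Suc p)"
      by simp
    also have "sum ?b {1..Suc q} = sum ?b {..Suc q} - ?b 0"
      by (simp add: atMost_atLeast0 sum.atLeast_Suc_atMost del: sum.cl_ivl_Suc)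
    also have "?a (Suc p) = - ?b 0"
      by (simp add: F'F B'B)
    also have "sum ?a {..Suc p} = coboundary p X \<phi> F' * \<psi> B"
      using ss by (simp add: coboundary_def sum_distrib_right mult.assoc del: sum.atMost_Suc)
    also have "sum ?b {..Suc q} = (-1) ^ p * (\<phi> F * coboundary q X \<psi> B')"
      using ss by (simp add: coboundary_def sum_distrib_left power_add mult_ac del: sum.atMost_Suc)
    finally show ?thesis
      using True by (simp add: cochain_cup_def F_def F'_def B_def B'_def)
  qed (simp add: coboundary_def cochain_cup_def)
qed

lemma singular_cochain_cup: "singular_cochain (p + q) X (cochain_cup p q X \<phi> \<psi>)"
  by (simp add: singular_cochain_def cochain_cup_def)

lemma cochain_cup_zero [simp]:
  "cochain_cup p q X (\<lambda>_. 0) \<psi> = (\<lambda>_. 0)" "cochain_cup p q X \<phi> (\<lambda>_. 0) = (\<lambda>_. 0)"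
  by (auto simp: cochain_cup_def)

lemma singular_cocycle_cup:
  "singular_cocycle p X \<phi> \<Longrightarrow> singular_cocycle q X \<psi> \<Longrightarrow>
   singular_cocycle (p + q) X (cochain_cup p q X \<phi> \<psi>)"
  by (simp add: singular_cocycle_def singular_cochain_cup coboundary_cup)

lemma singular_coboundary_cup_left:
  assumes "singular_coboundary p X \<beta>" "singular_cocycle q X \<psi>"
  shows "singular_coboundary (p + q) X (cochain_cup p q X \<beta> \<psi>)"
proof (cases p)
  case 0
  then show ?thesis using assms by (simp add: singular_coboundary_0 singular_coboundary_zero)
next
  case (Suc r)
  then obtain \<alpha> where \<alpha>: "singular_cochain r X \<alpha>" "\<beta> = coboundary r X \<alpha>"
    using assms by (auto simp: singular_coboundary_Suc)
  have "cochain_cup p q X \<beta> \<psi> = coboundary (r + q) X (cochain_cup r q X \<alpha> \<psi>)"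
    using assms(2) by (simp add: coboundary_cup \<alpha> Suc singular_cocycle_def)
  then show ?thesis
    unfolding Suc add_Suc singular_coboundary_Suc using singular_cochain_cup by blast
qed

lemma singular_coboundary_cup_right:
  assumes "singular_cocycle p X \<phi>" "singular_coboundary q X \<beta>"
  shows "singular_coboundary (p + q) X (cochain_cup p q X \<phi> \<beta>)"
proof (cases q)
  case 0
  then show ?thesis using assms by (simp add: singular_coboundary_0 singular_coboundary_zero)
next
  case (Suc r)
  then obtain \<alpha> where \<alpha>: "singular_cochain r X \<alpha>" "\<beta> = coboundary r X \<alpha>"
    using assms by (auto simp: singular_coboundary_Suc)
  have "(\<lambda>\<sigma>. (-1) ^ p * cochain_cup p q X \<phi> \<beta> \<sigma>) = coboundary (p + r) X (cochain_cup p r X \<phi> \<alpha>)"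
    using assms(1) by (simp add: coboundary_cup \<alpha> Suc singular_cocycle_def)
  then have "singular_coboundary (p + q) X (\<lambda>\<sigma>. (-1) ^ p * cochain_cup p q X \<phi> \<beta> \<sigma>)"
    unfolding Suc add_Suc_right singular_coboundary_Suc using singular_cochain_cup by blast
  from singular_coboundary_cmul[OF this, of "(-1) ^ p"] show ?thesis
    by (simp flip: mult.assoc power_mult_distrib)
qed

theorem cohomology_cup_class:
  assumes \<phi>: "singular_cocycle p X \<phi>" and \<psi>: "singular_cocycle q X \<psi>"
  shows "cohomology_cup p q X (cohomology_class p X \<phi>) (cohomology_class q X \<psi>) =
         cohomology_class (p + q) X (cochain_cup p q X \<phi> \<psi>)"
proof -
  have "cohomology_class (p + q) X (cochain_cup p q X \<phi>' \<psi>') =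
      cohomology_class (p + q) X (cochain_cup p q X \<phi> \<psi>)"
    if mem: "\<phi>' \<in> cohomology_class p X \<phi>" "\<psi>' \<in> cohomology_class q X \<psi>" for \<phi>' \<psi>'
  proof -
    obtain \<beta> \<gamma> where \<beta>: "singular_coboundary p X \<beta>" "\<phi>' = (\<lambda>\<sigma>. \<beta> \<sigma> + \<phi> \<sigma>)"
      and \<gamma>: "singular_coboundary q X \<gamma>" "\<psi>' = (\<lambda>\<sigma>. \<gamma> \<sigma> + \<psi> \<sigma>)"
      using mem by (auto simp: mem_cohomology_class)
    have \<psi>': "singular_cocycle q X \<psi>'"
      unfolding \<gamma>(2) by (intro singular_cocycle_add singular_coboundary_imp_cocycle \<gamma> \<psi>)
    have "cochain_cup p q X \<phi>' \<psi>' =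
        (\<lambda>\<sigma>. cochain_cup p q X \<beta> \<psi>' \<sigma> +
          (cochain_cup p q X \<phi> \<gamma> \<sigma> + cochain_cup p q X \<phi> \<psi> \<sigma>))"
      by (auto simp: \<beta>(2) \<gamma>(2) cochain_cup_def algebra_simps)
    then show ?thesis
      using singular_coboundary_cup_left[OF \<beta>(1) \<psi>'] singular_coboundary_cup_right[OF \<phi> \<gamma>(1)]
      by (simp add: cohomology_class_shift)
  qed
  moreover have "\<phi> \<in> cohomology_class p X \<phi>" "\<psi> \<in> cohomology_class q X \<psi>"
    by (auto simp: mem_cohomology_class intro!: exI[of _ "\<lambda>_. 0"] singular_coboundary_zero)
  ultimately show ?thesis
    unfolding cohomology_cup_def by blast
qed

lemma singular_cocycle_unit: "singular_cocycle 0 X (unit_cochain X)"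
  using singular_simplex_singular_face[of "Suc 0" X]
  by (auto simp: singular_cocycle_def singular_cochain_def coboundary_def unit_cochain_def fun_eq_iff)

lemma cup_power_in_cohomology_group:
  assumes "u \<in> carrier (cohomology_group k X)"
  shows "cup_power k X u n \<in> carrier (cohomology_group (k * n) X)"
proof (induction n)
  case 0
  then show ?case by (simp add: carrier_cohomology_group singular_cocycle_unit)
next
  case (Suc n)
  then show ?case
    using assms
    by (auto simp: carrier_cohomology_group cohomology_cup_class add.commute[of k]
        intro!: imageI singular_cocycle_cup)
qed

subsection \<open>Atoroidal classes\<close>

definition torus :: "nat \<Rightarrow> (nat \<Rightarrow> nat \<Rightarrow> real) topology"
  where "torus k = product_topology (\<lambda>_. nsphere 1) {..<k}"

definition atoroidal :: "nat \<Rightarrow> 'a topology \<Rightarrow> ('a, 'f::comm_ring_1) cochain set \<Rightarrow> bool"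
  where "atoroidal k X u \<longleftrightarrow>
    (\<forall>f. continuous_map (torus k) X f
       \<longrightarrow> cohomology_pullback k (torus k) f u = \<one>\<^bsub>cohomology_group k (torus k)\<^esub>)"


section \<open>CW-complexes\<close>

definition closed_disc :: "nat \<Rightarrow> (nat \<Rightarrow> real) topology"
  where "closed_disc m = subtopology (Euclidean_space m) {x. (\<Sum>i<m. x i ^ 2) \<le> 1}"

definition open_disc :: "nat \<Rightarrow> (nat \<Rightarrow> real) set"
  where "open_disc m = {x \<in> topspace (closed_disc m). (\<Sum>i<m. x i ^ 2) < 1}"

definition disc_boundary :: "nat \<Rightarrow> (nat \<Rightarrow> real) set"
  where "disc_boundary m = {x \<in> topspace (closed_disc m). (\<Sum>i<m. x i ^ 2) = 1}"

text \<open>A CW structure on the space \<open>X\<close>, in Whitehead's formulation, is given by a set of pairs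
  \<open>(m, \<Phi>)\<close>, where \<open>\<Phi>\<close> is the characteristic map of an \<open>m\<close>-cell. Indexing the cells by their
  characteristic maps is no restriction, since the (nonempty) open cells are pairwise disjoint.\<close>

type_synonym 'a cells = "(nat \<times> ((nat \<Rightarrow> real) \<Rightarrow> 'a)) set"

definition open_cell :: "nat \<times> ((nat \<Rightarrow> real) \<Rightarrow> 'a) \<Rightarrow> 'a set"
  where "open_cell c = snd c ` open_disc (fst c)"

definition cw_complex :: "'a topology \<Rightarrow> 'a cells \<Rightarrow> bool"
  where "cw_complex X \<C> \<longleftrightarrow>
    Hausdorff_space X \<and>
    (\<forall>(m, \<Phi>) \<in> \<C>.
       continuous_map (closed_disc m) X \<Phi> \<and>
       homeomorphic_map (subtopology (closed_disc m) (open_disc m))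
         (subtopology X (open_cell (m, \<Phi>))) \<Phi>) \<and>
    (\<Union>c\<in>\<C>. open_cell c) = topspace X \<and>
    pairwise (\<lambda>c d. disjnt (open_cell c) (open_cell d)) \<C> \<and>
    (\<forall>(m, \<Phi>) \<in> \<C>. \<exists>\<F>. finite \<F> \<and> \<F> \<subseteq> \<C> \<and> (\<forall>d\<in>\<F>. fst d < m) \<and>
       \<Phi> ` disc_boundary m \<subseteq> (\<Union>d\<in>\<F>. open_cell d)) \<and>
    (\<forall>A \<subseteq> topspace X. closedin X A \<longleftrightarrow>
       (\<forall>(m, \<Phi>) \<in> \<C>. closedin (closed_disc m) {x \<in> topspace (closed_disc m). \<Phi> x \<in> A}))"

definition cw_dimension :: "'a cells \<Rightarrow> enat"
  where "cw_dimension \<C> = (SUP c\<in>\<C>. enat (fst c))"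


section \<open>Topological complexity\<close>

text \<open>Taking \<open>K = {}\<close> shows that the subbasic sets cover the whole function space.\<close>

definition compact_open_topology :: "'a topology \<Rightarrow> 'b topology \<Rightarrow> ('a \<Rightarrow> 'b) topology"
  where "compact_open_topology X Y =
    topology_generated_by
      {{f. continuous_map X Y f \<and> f \<in> extensional (topspace X) \<and> f ` K \<subseteq> U} | K U.
        compactin X K \<and> openin Y U}"

lemma topspace_compact_open_topology:
  "topspace (compact_open_topology X Y) = {f. continuous_map X Y f \<and> f \<in> extensional (topspace X)}"
  unfolding compact_open_topology_def topology_generated_by_topspace
  by (blast intro: compactin_empty openin_empty)

definition path_space :: "'a topology \<Rightarrow> (real \<Rightarrow> 'a) topology"
  where "path_space X = compact_open_topology (top_of_set {0..1}) X"

definition path_endpoints :: "(real \<Rightarrow> 'a) \<Rightarrow> 'a \<times> 'a"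
  where "path_endpoints \<gamma> = (\<gamma> 0, \<gamma> 1)"

definition local_motion_planner ::
    "'a topology \<Rightarrow> ('a \<times> 'a) set \<Rightarrow> ('a \<times> 'a \<Rightarrow> real \<Rightarrow> 'a) \<Rightarrow> bool"
  where "local_motion_planner X U s \<longleftrightarrow>
    continuous_map (subtopology (prod_topology X X) U) (path_space X) s \<and>
    (\<forall>z\<in>U. path_endpoints (s z) = z)"

text \<open>Reduced convention; the infimum of the empty set in \<^typ>\<open>enat\<close> is \<open>\<infinity>\<close>.\<close>

definition topological_complexity :: "'a topology \<Rightarrow> enat"
  where "topological_complexity X =
    Inf {enat k | k. \<exists>U. (\<forall>j\<le>k. openin (prod_topology X X) (U j) \<and>
                              (\<exists>s. local_motion_planner X (U j) s)) \<and>
                         (\<Union>j\<le>k. U j) = topspace (prod_topology X X)}"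

end

theory Submission
  imports Defs "HOL-Analysis.Analysis"
begin

text \<open>
  Lower bound: let \<open>v\<close> be the difference of the pullbacks of \<open>u\<close> along the two projections of \<open>X \<times> X\<close>.
  A motion planner on an open set \<open>A\<close> is a homotopy between the projections and makes \<open>v\<close> a
  coboundary on \<open>A\<close>. On the intersection of two such sets the two primitives differ by a 1-cocycle whose
  value on a loop is the value of \<open>u\<close> on a torus, hence zero; so the primitives can be matched, and \<open>v\<close>
  can be made zero on both sets at once. If fewer than \<open>4 n + 1\<close> sets sufficed, the \<open>2 n\<close>-th power of
  \<open>v\<close> would therefore be cohomologous to a cocycle vanishing on small simplices. But if \<open>z\<close> is a cycle
  with \<open>\<langle>u\<^sup>n, z\<rangle> \<noteq> 0\<close>, then \<open>\<langle>v\<^sup>2\<^sup>n, z \<times> z\<rangle> = (-1)\<^sup>n (2 n choose n) \<langle>u\<^sup>n, z\<rangle>\<^sup>2\<close> by counting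
  shuffles.

  Upper bound: functions \<open>f\<^sub>0, \<dots>, f\<^sub>d\<close> on a \<open>d\<close>-dimensional CW-complex, where the support of \<open>f\<^sub>i\<close> deforms to
  the union of the open \<open>i\<close>-cells, cover \<open>X\<close>. The sets of all \<open>(x, y)\<close> for which the products
  \<open>f\<^sub>i x * f\<^sub>j y\<close> with \<open>i + j = k\<close> have a unique largest member, \<open>k = 0, \<dots>, 2 d\<close>, cover \<open>X \<times> X\<close>.\<close>

section \<open>Motion planners and homotopies\<close>

text \<open>The number \<open>4 n\<close> arises from a count: \<open>u\<close> can be used
  \<open>n\<close> times in each coordinate, so \<open>v\<close> has a nonzero power with
  \<open>2 n\<close> factors, and atoroidality lets each factor deal with two open sets instead of
  one. Matching two primitives is a Mayer-Vietoris problem on an intersection. Its obstruction has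
  degree one, and such a class is trivial as soon as it vanishes on loops; a loop carried along one
  homotopy and back along the other sweeps out a torus.

  Two obstacles shape the rest. The product of the corrected factors vanishes only on simplices
  inside a single set of the cover, so chains have to be subdivided. And instead of a Kuenneth
  theorem a single product cycle is used, which needs no more than an explicit cross product and its
  Leibniz rule. The cross product obtained by coning contains degenerate simplices besides the
  shuffles; replacing \<open>u\<close> by a normalized representative removes their contribution.
  The characteristic of the field enters only through the central binomial coefficient.\<close>

lemma continuous_map_into_path_space:
  assumes h: "continuous_map (prod_topology (top_of_set {0..1}) Z) X h"
  shows "continuous_map Z (path_space X) (\<lambda>z. restrict (\<lambda>t. h (t, z)) {0..1})"
proof -
  have slice: "continuous_map (top_of_set {0..1}) X (restrict (\<lambda>t. h (t, z)) {0..1})"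
    if "z \<in> topspace Z" for z
  proof -
    have "continuous_map (top_of_set {0..1}) (prod_topology (top_of_set {0..1}) Z) (\<lambda>t. (t, z))"
      using that by (simp add: continuous_map_pairwise o_def)
    from continuous_map_compose[OF this h]
    show ?thesis by (rule continuous_map_eq) auto
  qed
  show ?thesis
    unfolding path_space_def compact_open_topology_def
  proof (rule continuous_on_generated_topo)
    fix V
    assume "V \<in> {{f. continuous_map (top_of_set {0..1}) X f \<and>
        f \<in> extensional (topspace (top_of_set {0..1})) \<and> f ` K \<subseteq> U} |K U.
          compactin (top_of_set {0..1::real}) K \<and> openin X U}"
    then obtain K U where K: "compactin (top_of_set {0..1::real}) K" and U: "openin X U"
      and V: "V = {f. continuous_map (top_of_set {0..1}) X f \<and>
        f \<in> extensional (topspace (top_of_set {0..1})) \<and> f ` K \<subseteq> U}"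
      by blast
    have K01: "K \<subseteq> {0..1}" using compactin_subset_topspace[OF K] by simp
    let ?W = "{p \<in> topspace (prod_topology (top_of_set {0..1}) Z). h p \<in> U}"
    have W: "openin (prod_topology (top_of_set {0..1}) Z) ?W"
      by (rule openin_continuous_map_preimage[OF h U])
    \<comment> \<open>Membership in a subbasic set says that the compact slice
      \<open>K \<times> {z}\<close> lies in the open set \<open>?W\<close>; the tube lemma then
      provides a whole neighbourhood of \<open>z\<close>.\<close>
    have eq: "(\<lambda>z. restrict (\<lambda>t. h (t, z)) {0..1}) -` V \<inter> topspace Z =
        {z \<in> topspace Z. K \<times> {z} \<subseteq> ?W}"
      using K01 slice by (auto simp: V image_subset_iff)
    show "openin Z ((\<lambda>z. restrict (\<lambda>t. h (t, z)) {0..1}) -` V \<inter> topspace Z)"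
      unfolding eq
    proof (subst openin_subopen, safe)
      fix z assume "z \<in> topspace Z" "K \<times> {z} \<subseteq> ?W"
      from tube_lemma_left[OF W K this] obtain A B where
        "openin Z B" "K \<subseteq> A" "z \<in> B" "A \<times> B \<subseteq> ?W" by blast
      then show "\<exists>T. openin Z T \<and> z \<in> T \<and> T \<subseteq> {z \<in> topspace Z. K \<times> {z} \<subseteq> ?W}"
        by (intro exI[of _ B]) (auto dest: openin_subset)
    qed
  next
    show "(\<lambda>z. restrict (\<lambda>t. h (t, z)) {0..1}) ` topspace Z \<subseteq>
        \<Union> {{f. continuous_map (top_of_set {0..1}) X f \<and>
        f \<in> extensional (topspace (top_of_set {0..1})) \<and> f ` K \<subseteq> U} |K U.
          compactin (top_of_set {0..1::real}) K \<and> openin X U}"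
    proof
      fix f assume "f \<in> (\<lambda>z. restrict (\<lambda>t. h (t, z)) {0..1}) ` topspace Z"
      then show "f \<in> \<Union> {{f. continuous_map (top_of_set {0..1}) X f \<and>
        f \<in> extensional (topspace (top_of_set {0..1})) \<and> f ` K \<subseteq> U} |K U.
          compactin (top_of_set {0..1::real}) K \<and> openin X U}"
        using slice
        by (intro UnionI[of "{f. continuous_map (top_of_set {0..1}) X f \<and>
        f \<in> extensional (topspace (top_of_set {0..1})) \<and> f ` {} \<subseteq> {}}"] CollectI exI[of _ "{}"])
          auto
    qed
  qed
qed

lemma path_space_continuous_map:
  assumes "\<gamma> \<in> topspace (path_space X)"
  shows "continuous_map (top_of_set {0..1}) X \<gamma>"
  using assms by (simp add: path_space_def topspace_compact_open_topology)

text \<open>The converse half of the exponential law. It rests on local compactness of the interval: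
  near \<open>t\<close> there is a compact neighbourhood \<open>K\<close> that \<open>s z\<close>
  maps into \<open>U\<close>, and the maps with this property form a subbasic open set.\<close>

lemma continuous_map_path_space_eval:
  assumes s: "continuous_map Z (path_space X) s"
  shows "continuous_map (prod_topology (top_of_set {0..1}) Z) X (\<lambda>(t, z). s z t)"
  unfolding continuous_map_def
proof (intro conjI allI impI)
  have c: "continuous_map (top_of_set {0..1}) X (s z)" if "z \<in> topspace Z" for z
    using continuous_map_image_subset_topspace[OF s] that by (auto intro: path_space_continuous_map)
  show "(\<lambda>(t, z). s z t) \<in> topspace (prod_topology (top_of_set {0..1}) Z) \<rightarrow> topspace X"
    using c by (fastforce simp: continuous_map_def)
  fix U assume U: "openin X U"
  let ?R = "{p \<in> topspace (prod_topology (top_of_set {0..1}) Z). (case p of (t, z) \<Rightarrow> s z t) \<in> U}"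
  show "openin (prod_topology (top_of_set {0..1}) Z) ?R"
    unfolding openin_prod_topology_alt
  proof (intro allI impI)
    fix t z assume tz: "(t, z) \<in> ?R"
    then have z: "z \<in> topspace Z" and t: "t \<in> {0..1}" and st: "s z t \<in> U" by auto
    have "openin (top_of_set {0..1}) {r \<in> {0..1}. s z r \<in> U}"
      using openin_continuous_map_preimage[OF c[OF z] U] by simp
    then obtain e where e: "e > 0" "\<And>r. r \<in> {0..1} \<Longrightarrow> dist r t < e \<Longrightarrow> s z r \<in> U"
      using t st by (auto simp: openin_euclidean_subtopology_iff)
    \<comment> \<open>Half the radius keeps the closed ball inside the open ball of radius
      \<open>e\<close>.\<close>
    define K where "K = {0..1} \<inter> cball t (e/2)"
    have K: "compactin (top_of_set {0..1}) K"
      by (auto simp: K_def compactin_subtopology intro: closed_Int_compact)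
    let ?V = "{f. continuous_map (top_of_set {0..1}) X f \<and>
      f \<in> extensional (topspace (top_of_set {0..1})) \<and> f ` K \<subseteq> U}"
    have V: "openin (path_space X) ?V"
      unfolding path_space_def compact_open_topology_def
      by (rule topology_generated_by_Basis) (use K U in blast)
    let ?B = "{z \<in> topspace Z. s z \<in> ?V}"
    have B: "openin Z ?B" by (rule openin_continuous_map_preimage[OF s V])
    have "s z \<in> topspace (path_space X)" using s z by (auto simp: continuous_map_def)
    then have "z \<in> ?B"
      using z e by (auto simp: K_def path_space_def topspace_compact_open_topology dist_commute)
    moreover have "openin (top_of_set {0..1}) ({0..1} \<inter> ball t (e/2))"
      by (simp add: openin_open_Int)
    moreover have "({0..1} \<inter> ball t (e/2)) \<times> ?B \<subseteq> ?R"
      using B by (auto simp: K_def image_subset_iff)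
    ultimately show "\<exists>A B. openin (top_of_set {0..1}) A \<and> openin Z B \<and> t \<in> A \<and> z \<in> B \<and> A \<times> B \<subseteq> ?R"
      using B t e(1) by (intro exI[of _ "{0..1} \<inter> ball t (e/2)"] exI[of _ ?B]) auto
  qed
qed

lemma homotopic_withE:
  assumes "homotopic_with P X Y f g"
  obtains h where "continuous_map (prod_topology (top_of_set {0..1::real}) X) Y h"
    "\<And>x. h (0, x) = f x" "\<And>x. h (1, x) = g x"
proof -
  from assms show thesis
    unfolding homotopic_with_def
    by (elim exE conjE) (rule that, assumption, erule spec, erule spec)
qed

lemma homotopic_withI:
  assumes "continuous_map (prod_topology (top_of_set {0..1::real}) X) Y h"
    "\<And>x. x \<in> topspace X \<Longrightarrow> h (0, x) = f x" "\<And>x. x \<in> topspace X \<Longrightarrow> h (1, x) = g x"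
  shows "homotopic_with (\<lambda>_. True) X Y f g"
  by (subst homotopic_with, rule refl) (intro exI[of _ h] conjI ballI assms TrueI)

text \<open>A planner read as a function of time and of the pair of endpoints is a homotopy from
  \<open>fst\<close> to \<open>snd\<close>. From here on the compact-open topology matters only
  where a homotopy has to be built cell by cell.\<close>

lemma motion_planner_iff_homotopic:
  assumes "U \<subseteq> topspace (prod_topology X X)"
  shows "(\<exists>s. local_motion_planner X U s) \<longleftrightarrow>
    homotopic_with (\<lambda>_. True) (subtopology (prod_topology X X) U) X fst snd" (is "?l \<longleftrightarrow> ?r")
proof
  let ?Z = "subtopology (prod_topology X X) U"
  have top: "topspace ?Z = U" using assms by (auto simp: topspace_subtopology)
  {
    assume ?l
    then obtain s where s: "continuous_map ?Z (path_space X) s" "\<And>z. z \<in> U \<Longrightarrow> path_endpoints (s z) = z"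
      by (auto simp: local_motion_planner_def)
    show ?r
    proof (rule homotopic_withI)
      show "continuous_map (prod_topology (top_of_set {0..1}) ?Z) X (\<lambda>(t, z). s z t)"
        by (rule continuous_map_path_space_eval[OF s(1)])
      fix z assume "z \<in> topspace ?Z"
      then have "path_endpoints (s z) = z" using s(2) top by blast
      then show "(case (0, z) of (t, z) \<Rightarrow> s z t) = fst z" "(case (1, z) of (t, z) \<Rightarrow> s z t) = snd z"
        by (auto simp: path_endpoints_def prod_eq_iff)
    qed
  next
    assume ?r
    then obtain h where h: "continuous_map (prod_topology (top_of_set {0..1::real}) ?Z) X h"
      "\<And>x. h (0, x) = fst x" "\<And>x. h (1, x) = snd x"
      by (rule homotopic_withE) (rule that)
    show ?l
      unfolding local_motion_planner_def
    proof (intro exI conjI ballI)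
      show "continuous_map ?Z (path_space X) (\<lambda>z. restrict (\<lambda>t. h (t, z)) {0..1})"
        by (rule continuous_map_into_path_space[OF h(1)])
    qed (simp add: path_endpoints_def h(2,3))
  }
qed

text \<open>Homotopies on disjoint open pieces have no overlap on which they would have to agree, so
  they paste together.\<close>

lemma homotopic_with_disjoint_open_Union:
  assumes op: "\<And>i. i \<in> I \<Longrightarrow> openin Z (T i)"
    and disj: "\<And>i j. i \<in> I \<Longrightarrow> j \<in> I \<Longrightarrow> i \<noteq> j \<Longrightarrow> T i \<inter> T j = {}"
    and cov: "topspace Z \<subseteq> (\<Union>i\<in>I. T i)"
    and hom: "\<And>i. i \<in> I \<Longrightarrow> homotopic_with (\<lambda>_. True) (subtopology Z (T i)) X f g"
  shows "homotopic_with (\<lambda>_. True) Z X f g"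
proof -
  let ?I = "top_of_set {0..1::real}"
  have "\<exists>h. continuous_map (prod_topology ?I (subtopology Z (T i))) X h \<and>
        (\<forall>x. h (0, x) = f x) \<and> (\<forall>x. h (1, x) = g x)" if "i \<in> I" for i
    by (rule homotopic_withE[OF hom[OF that]]) (intro exI conjI allI)
  then obtain h where h: "\<And>i. i \<in> I \<Longrightarrow> continuous_map (prod_topology ?I (subtopology Z (T i))) X (h i)"
      "\<And>i x. i \<in> I \<Longrightarrow> h i (0, x) = f x" "\<And>i x. i \<in> I \<Longrightarrow> h i (1, x) = g x"
    by metis
  obtain k where k: "continuous_map (prod_topology ?I Z) X k"
    "\<And>x i. i \<in> I \<Longrightarrow> x \<in> topspace (prod_topology ?I Z) \<inter> ({0..1} \<times> T i) \<Longrightarrow> k x = h i x"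
  proof (rule pasting_lemma_exists[where X = "prod_topology ?I Z" and I = I and T = "\<lambda>i. {0..1} \<times> T i" and Y = X and f = h])
    show "topspace (prod_topology ?I Z) \<subseteq> (\<Union>i\<in>I. {0..1} \<times> T i)" using cov by auto
    show "openin (prod_topology ?I Z) ({0..1} \<times> T i)" if "i \<in> I" for i
      unfolding openin_prod_Times_iff using op[OF that] openin_topspace[of ?I] by simp
    show "continuous_map (subtopology (prod_topology ?I Z) ({0..1} \<times> T i)) X (h i)" if "i \<in> I" for i
    proof -
      have "subtopology (prod_topology ?I Z) ({0..1} \<times> T i) = prod_topology ?I (subtopology Z (T i))"
        by (simp add: subtopology_Times subtopology_subtopology)
      then show ?thesis using h(1)[OF that] by metis
    qed
    show "h i x = h j x"
      if "i \<in> I" "j \<in> I" "x \<in> topspace (prod_topology ?I Z) \<inter> ({0..1} \<times> T i) \<inter> ({0..1} \<times> T j)" for i j x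
      using that disj[of i j] by (cases "i = j") auto
  qed blast
  show ?thesis
  proof (rule homotopic_withI)
    show "continuous_map (prod_topology ?I Z) X k" by fact
    show "k (0, x) = f x" "k (1, x) = g x" if x: "x \<in> topspace Z" for x
    proof -
      obtain i where "i \<in> I" "x \<in> T i" using cov x by auto
      then show "k (0, x) = f x" "k (1, x) = g x" using k(2)[of i] h(2,3) x by auto
    qed
  qed
qed

text \<open>On \<open>W k (i, j)\<close> the two projections land in the supports of
  \<open>f i\<close> and \<open>f j\<close>, where the inclusion is homotopic to the constant
  \<open>b\<close>; hence both projections are homotopic to \<open>b\<close> and to each other. For
  fixed \<open>k\<close> these sets are disjoint and open, so one planner serves their
  union.\<close>

lemma topological_complexity_le:
  assumes f: "\<And>i. i \<le> d \<Longrightarrow> continuous_map X euclideanreal (f i)"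
    and pos: "\<And>x. x \<in> topspace X \<Longrightarrow> \<exists>i\<le>d. f i x > (0::real)"
    and hom: "\<And>i. i \<le> d \<Longrightarrow>
      homotopic_with (\<lambda>_. True) (subtopology X {x \<in> topspace X. f i x > 0}) X id (\<lambda>_. b)"
  shows "topological_complexity X \<le> enat (2 * d)"
proof -
  let ?XX = "prod_topology X X"
  define S where "S i = {x \<in> topspace X. f i x > 0}" for i
  define I where "I k = {(i, j). i \<le> d \<and> j \<le> d \<and> i + j = k}" for k
  \<comment> \<open>The truncation \<open>max 0\<close> prevents a product of two negative values
    from competing with the positive product at \<open>(i, j)\<close>.\<close>
  define W where "W k = (\<lambda>(i, j). {z \<in> topspace ?XX. f i (fst z) > 0 \<and> f j (snd z) > 0 \<and>
      (\<forall>p\<in>I k - {(i, j)}. f i (fst z) * f j (snd z) > max 0 (f (fst p) (fst z)) * max 0 (f (snd p) (snd z)))})"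
    for k
  have fin: "finite (I k)" for k
    by (rule finite_subset[of _ "{..d} \<times> {..d}"]) (auto simp: I_def)
  have f1: "continuous_map ?XX euclideanreal (\<lambda>z. f i (fst z))" if "i \<le> d" for i
    using continuous_map_compose[OF continuous_map_fst f[OF that]] by (simp add: o_def)
  have f2: "continuous_map ?XX euclideanreal (\<lambda>z. f i (snd z))" if "i \<le> d" for i
    using continuous_map_compose[OF continuous_map_snd f[OF that]] by (simp add: o_def)
  have opos: "openin ?XX {z \<in> topspace ?XX. g z > h z}"
    if "continuous_map ?XX euclideanreal g" "continuous_map ?XX euclideanreal h" for g h :: "_ \<Rightarrow> real"
    using openin_continuous_map_preimage[OF continuous_map_diff[OF that], of "{0<..}"] by simp
  have opW: "openin ?XX (W k p)" if pI: "p \<in> I k" for k p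
  proof -
    obtain i j where p: "p = (i, j)" "i \<le> d" "j \<le> d" using pI by (cases p) (auto simp: I_def)
    have "W k p = {z \<in> topspace ?XX. f i (fst z) > 0} \<inter> {z \<in> topspace ?XX. f j (snd z) > 0} \<inter>
        (topspace ?XX \<inter> (\<Inter>q\<in>I k - {p}. {z \<in> topspace ?XX. f i (fst z) * f j (snd z) >
           max 0 (f (fst q) (fst z)) * max 0 (f (snd q) (snd z))}))"
      by (auto simp: W_def p)
    moreover have "openin ?XX \<dots>"
    proof (rule openin_Int[OF openin_Int])
      show "openin ?XX {z \<in> topspace ?XX. f i (fst z) > 0}" "openin ?XX {z \<in> topspace ?XX. f j (snd z) > 0}"
        by (intro opos f1 f2 p continuous_map_const[THEN iffD2]; simp)+
      show "openin ?XX (topspace ?XX \<inter> (\<Inter>q\<in>I k - {p}. {z \<in> topspace ?XX. f i (fst z) * f j (snd z) >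
           max 0 (f (fst q) (fst z)) * max 0 (f (snd q) (snd z))}))"
      proof (cases "I k - {p} = {}")
        case True
        show ?thesis unfolding True by (simp flip: topspace_prod_topology)
      next
        case False
        then have "openin ?XX (\<Inter>q\<in>I k - {p}. {z \<in> topspace ?XX. f i (fst z) * f j (snd z) >
           max 0 (f (fst q) (fst z)) * max 0 (f (snd q) (snd z))})"
        proof (intro openin_INT2 finite_Diff fin opos)
          show "continuous_map ?XX euclideanreal (\<lambda>z. f i (fst z) * f j (snd z))"
            by (intro continuous_map_real_mult f1 f2 p)
          show "continuous_map ?XX euclideanreal (\<lambda>z. max 0 (f (fst q) (fst z)) * max 0 (f (snd q) (snd z)))"
            if "q \<in> I k - {p}" for q
            using that by (intro continuous_map_real_mult continuous_map_real_max f1 f2) (auto simp: I_def)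
        qed
        then show ?thesis by (rule openin_Int[OF openin_topspace])
      qed
    qed
    ultimately show ?thesis by simp
  qed
  have disj: "W k p \<inter> W k q = {}" if pq': "p \<in> I k" "q \<in> I k" "p \<noteq> q" for k p q
  proof (rule ccontr)
    assume "W k p \<inter> W k q \<noteq> {}"
    then obtain z where z: "z \<in> W k p" "z \<in> W k q" by blast
    obtain i j i' j' where pq: "p = (i, j)" "q = (i', j')" by force
    have A: "f i (fst z) > 0" "f j (snd z) > 0"
        "\<forall>p\<in>I k - {(i, j)}. f i (fst z) * f j (snd z) > max 0 (f (fst p) (fst z)) * max 0 (f (snd p) (snd z))"
      and B: "f i' (fst z) > 0" "f j' (snd z) > 0"
        "\<forall>p\<in>I k - {(i', j')}. f i' (fst z) * f j' (snd z) > max 0 (f (fst p) (fst z)) * max 0 (f (snd p) (snd z))"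
      using z by (auto simp: W_def pq)
    have "f i (fst z) * f j (snd z) > max 0 (f i' (fst z)) * max 0 (f j' (snd z))"
      using bspec[OF A(3), of "(i', j')"] pq' unfolding pq
      by (metis DiffI fst_conv insertE singletonD snd_conv)
    moreover have "f i' (fst z) * f j' (snd z) > max 0 (f i (fst z)) * max 0 (f j (snd z))"
      using bspec[OF B(3), of "(i, j)"] that by (simp add: pq)
    ultimately have "f i (fst z) * f j (snd z) > f i' (fst z) * f j' (snd z)"
      "f i' (fst z) * f j' (snd z) > f i (fst z) * f j (snd z)"
      using A(1,2) B(1,2) by simp_all
    then show False by simp
  qed
  define U where "U k = (\<Union>p\<in>I k. W k p)" for k
  have opU: "openin ?XX (U k)" for k
    unfolding U_def by (rule openin_Union) (use opW in auto)
  have planner: "\<exists>s. local_motion_planner X (U k) s" for k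
  proof (subst motion_planner_iff_homotopic)
    show "U k \<subseteq> topspace ?XX" using opU openin_subset by blast
    show "homotopic_with (\<lambda>_. True) (subtopology ?XX (U k)) X fst snd"
    proof (rule homotopic_with_disjoint_open_Union[where I = "I k" and T = "W k"])
      show "openin (subtopology ?XX (U k)) (W k p)" if "p \<in> I k" for p
        using opW[OF that] that by (auto simp: openin_subtopology U_def)
      show "topspace (subtopology ?XX (U k)) \<subseteq> (\<Union>i\<in>I k. W k i)"
        by (auto simp: U_def topspace_subtopology)
      show "homotopic_with (\<lambda>_. True) (subtopology (subtopology ?XX (U k)) (W k p)) X fst snd"
        if p: "p \<in> I k" for p
      proof -
        obtain i j where ij: "p = (i, j)" "i \<le> d" "j \<le> d" using p by (cases p) (auto simp: I_def)
        have eq: "subtopology (subtopology ?XX (U k)) (W k p) = subtopology ?XX (W k p)"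
        proof -
          have "U k \<inter> W k p = W k p" using p by (auto simp: U_def)
          then show ?thesis by (simp add: subtopology_subtopology)
        qed
        have "continuous_map (subtopology ?XX (W k p)) (subtopology X (S i)) fst"
          by (rule continuous_map_into_subtopology)
            (auto intro!: continuous_map_from_subtopology continuous_map_fst simp: S_def W_def ij)
        from homotopic_with_compose_continuous_map_right[OF hom[OF ij(2), folded S_def] this]
        have 1: "homotopic_with (\<lambda>_. True) (subtopology ?XX (W k p)) X fst (\<lambda>_. b)"
          by (simp add: o_def)
        have "continuous_map (subtopology ?XX (W k p)) (subtopology X (S j)) snd"
          by (rule continuous_map_into_subtopology)
            (auto intro!: continuous_map_from_subtopology continuous_map_snd simp: S_def W_def ij)
        from homotopic_with_compose_continuous_map_right[OF hom[OF ij(3), folded S_def] this]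
        have 2: "homotopic_with (\<lambda>_. True) (subtopology ?XX (W k p)) X snd (\<lambda>_. b)"
          by (simp add: o_def)
        show ?thesis
          unfolding eq by (rule homotopic_with_trans[OF 1 homotopic_with_symD[OF 2]])
      qed
    qed (use disj in auto)
  qed
  text \<open>Take the least indices at which \<open>f\<close> is maximal in either coordinate: any other pair
    of indices with the same sum is larger in one coordinate and smaller in the other.\<close>
  have cov: "\<exists>k\<le>2 * d. z \<in> U k" if z: "z \<in> topspace ?XX" for z
  proof -
    have least: "\<exists>i\<le>d. f i x > 0 \<and> (\<forall>i'\<le>d. f i' x \<le> f i x) \<and> (\<forall>i'<i. f i' x < f i x)"
      if x: "x \<in> topspace X" for x
    proof -
      define M where "M = Max ((\<lambda>i. f i x) ` {..d})"
      have M: "f i x \<le> M" if "i \<le> d" for i using that by (auto simp: M_def)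
      have "M \<in> (\<lambda>i. f i x) ` {..d}" unfolding M_def by (rule Max_in) auto
      then have "\<exists>i. i \<le> d \<and> f i x = M" by auto
      then obtain i where i: "i \<le> d" "f i x = M" "\<And>i'. i' < i \<Longrightarrow> \<not> (i' \<le> d \<and> f i' x = M)"
        using exists_least_iff[of "\<lambda>i. i \<le> d \<and> f i x = M"] by blast
      have "M > 0" using pos[OF x] M by force
      moreover have "f i' x < f i x" if "i' < i" for i'
        using i(1,2) i(3)[OF that] that M[of i'] by auto
      ultimately show ?thesis using i M by auto
    qed
    obtain i where i: "i \<le> d" "f i (fst z) > 0" "\<And>i'. i' \<le> d \<Longrightarrow> f i' (fst z) \<le> f i (fst z)"
      "\<And>i'. i' < i \<Longrightarrow> f i' (fst z) < f i (fst z)" using least[of "fst z"] z by auto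
    obtain j where j: "j \<le> d" "f j (snd z) > 0" "\<And>i'. i' \<le> d \<Longrightarrow> f i' (snd z) \<le> f j (snd z)"
      "\<And>i'. i' < j \<Longrightarrow> f i' (snd z) < f j (snd z)" using least[of "snd z"] z by auto
    have "f i (fst z) * f j (snd z) > max 0 (f i' (fst z)) * max 0 (f j' (snd z))"
      if ij': "i' \<le> d" "j' \<le> d" "i' + j' = i + j" "(i', j') \<noteq> (i, j)" for i' j'
    proof -
      consider "i' < i" | "j' < j" using ij' by force
      then show ?thesis
      proof cases
        case 1
        then have "max 0 (f i' (fst z)) < f i (fst z)" using i by auto
        then have "max 0 (f i' (fst z)) * f j (snd z) < f i (fst z) * f j (snd z)"
          using j(2) by (rule mult_strict_right_mono)
        moreover have "max 0 (f i' (fst z)) * max 0 (f j' (snd z)) \<le> max 0 (f i' (fst z)) * f j (snd z)"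
          using j ij' by (intro mult_left_mono) auto
        ultimately show ?thesis by simp
      next
        case 2
        then have "max 0 (f j' (snd z)) < f j (snd z)" using j by auto
        then have "f i (fst z) * max 0 (f j' (snd z)) < f i (fst z) * f j (snd z)"
          using i(2) by (rule mult_strict_left_mono)
        moreover have "max 0 (f i' (fst z)) * max 0 (f j' (snd z)) \<le> f i (fst z) * max 0 (f j' (snd z))"
          using i ij' by (intro mult_right_mono) auto
        ultimately show ?thesis by simp
      qed
    qed
    note less = this
    have "max 0 (f (fst p) (fst z)) * max 0 (f (snd p) (snd z)) < f i (fst z) * f j (snd z)"
      if p: "p \<in> I (i + j) - {(i, j)}" for p
      using less[of "fst p" "snd p"] p by (cases p) (auto simp: I_def)
    then have "z \<in> W (i + j) (i, j)"
      using z i(2) j(2) by (simp add: W_def)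
    then show ?thesis
      using i(1) j(1) by (intro exI[of _ "i + j"]) (auto simp: U_def I_def)
  qed
  show ?thesis
    unfolding topological_complexity_def
  proof (rule Inf_lower, intro CollectI exI[of _ "2 * d"] conjI refl exI[of _ U] allI impI)
    show "(\<Union>j\<le>2 * d. U j) = topspace ?XX"
    proof
      show "(\<Union>j\<le>2 * d. U j) \<subseteq> topspace ?XX" using opU openin_subset by blast
      show "topspace ?XX \<subseteq> (\<Union>j\<le>2 * d. U j)" using cov by blast
    qed
  qed (rule opU, rule planner)
qed

section \<open>Dimensional upper bound for CW-complexes\<close>

definition disc_norm :: "nat \<Rightarrow> (nat \<Rightarrow> real) \<Rightarrow> real"
  where "disc_norm m v = sqrt (\<Sum>i<m. v i ^ 2)"

lemma topspace_closed_disc: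
  "topspace (closed_disc m) = {v. (\<forall>i\<ge>m. v i = 0) \<and> disc_norm m v \<le> 1}"
  by (auto simp: closed_disc_def topspace_Euclidean_space disc_norm_def)

lemma open_disc_eq: "open_disc m = {v. (\<forall>i\<ge>m. v i = 0) \<and> disc_norm m v < 1}"
  by (auto simp: open_disc_def closed_disc_def topspace_Euclidean_space disc_norm_def)

lemma disc_boundary_eq: "disc_boundary m = {v. (\<forall>i\<ge>m. v i = 0) \<and> disc_norm m v = 1}"
  by (auto simp: disc_boundary_def closed_disc_def topspace_Euclidean_space disc_norm_def)

lemma disc_norm_ge_0 [simp]: "0 \<le> disc_norm m v"
  by (simp add: disc_norm_def sum_nonneg)

lemma disc_norm_0 [simp]: "disc_norm m (\<lambda>_. 0) = 0"
  by (simp add: disc_norm_def)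

lemma disc_norm_scale: "disc_norm m (\<lambda>i. c * v i) = \<bar>c\<bar> * disc_norm m v"
  by (simp add: disc_norm_def power_mult_distrib sum_distrib_left[symmetric] real_sqrt_mult)

lemma continuous_map_closed_disc:
  "continuous_map Z (closed_disc m) h \<longleftrightarrow>
    (\<forall>i. continuous_map Z euclideanreal (\<lambda>z. h z i)) \<and> h ` topspace Z \<subseteq> topspace (closed_disc m)"
proof -
  have "closed_disc m = subtopology (powertop_real UNIV) (topspace (closed_disc m))"
    by (simp add: closed_disc_def Euclidean_space_def subtopology_subtopology) 
  then have "continuous_map Z (closed_disc m) h \<longleftrightarrow>
      continuous_map Z (powertop_real UNIV) h \<and> h ` topspace Z \<subseteq> topspace (closed_disc m)"
    using continuous_map_in_subtopology by (metis image_subset_iff_funcset)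
  then show ?thesis
    by (simp add: continuous_map_componentwise_UNIV)
qed

lemma continuous_map_disc_coordinate: "continuous_map (closed_disc m) euclideanreal (\<lambda>v. v i)"
  using continuous_map_closed_disc[of "closed_disc m" m id] by simp

lemma continuous_map_disc_norm: "continuous_map (closed_disc m) euclideanreal (disc_norm m)"
proof -
  have "continuous_map (closed_disc m) euclideanreal (\<lambda>v. \<Sum>i<m. v i ^ 2)"
    by (intro continuous_intros continuous_map_disc_coordinate) auto
  from continuous_map_compose[OF this continuous_map_square_root] show ?thesis
    by (simp add: o_def disc_norm_def[abs_def])
qed

lemma continuous_map_scale_disc:
  assumes "continuous_map Z euclideanreal c" "continuous_map Z (closed_disc m) h"
    and "\<And>z. z \<in> topspace Z \<Longrightarrow> \<bar>c z\<bar> * disc_norm m (h z) \<le> 1"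
  shows "continuous_map Z (closed_disc m) (\<lambda>z i. c z * h z i)"
proof -
  have "\<And>i. continuous_map Z euclideanreal (\<lambda>z. h z i)" "h ` topspace Z \<subseteq> topspace (closed_disc m)"
    using assms(2) by (simp_all add: continuous_map_closed_disc)
  then show ?thesis
    unfolding continuous_map_closed_disc
    using assms(1,3) by (auto simp: topspace_closed_disc disc_norm_scale intro!: continuous_map_real_mult)
qed

text \<open>The disc is a closed subset of a product of compact sets, namely \<open>{-1..1}\<close>
  in the first \<open>m\<close> coordinates and \<open>{0}\<close> in all others.\<close>

lemma compact_space_closed_disc: "compact_space (closed_disc m)"
proof -
  let ?K = "PiE UNIV (\<lambda>i. if i < m then {-1..1::real} else {0})"
  let ?C = "{x \<in> topspace (powertop_real UNIV). (\<Sum>i<m. x i ^ 2) \<in> {..1::real}}"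
  have "x i \<in> {-1..1}" if "(\<Sum>i<m. x i ^ 2) \<le> 1" "i < m" for x :: "nat \<Rightarrow> real" and i
  proof -
    have "x i ^ 2 \<le> (\<Sum>i<m. x i ^ 2)" using that by (intro member_le_sum) auto
    then have "\<bar>x i\<bar> \<le> 1" using that(1) by (meson abs_square_le_1 order_trans)
    then show ?thesis by auto
  qed
  then have eq: "{x. \<forall>i\<ge>m. x i = 0} \<inter> {x. (\<Sum>i<m. x i ^ 2) \<le> 1} = ?C \<inter> ?K"
    by (auto simp: PiE_iff split: if_splits)
  have "compactin (powertop_real UNIV) ?K"
    by (simp add: compactin_PiE)
  moreover have "closedin (powertop_real UNIV) ?C"
  proof (rule closedin_continuous_map_preimage)
    show "continuous_map (powertop_real UNIV) euclideanreal (\<lambda>x. \<Sum>i<m. x i ^ 2)"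
      by (intro continuous_intros continuous_map_product_projection) auto
  qed simp
  ultimately have "compactin (powertop_real UNIV) ({x. \<forall>i\<ge>m. x i = 0} \<inter> {x. (\<Sum>i<m. x i ^ 2) \<le> 1})"
    unfolding eq by (rule closed_Int_compactin[rotated])
  then show ?thesis
    by (simp add: closed_disc_def Euclidean_space_def subtopology_subtopology compact_space_subtopology)
qed

section \<open>Cells, skeleta and the weak topology\<close>

locale cw =
  fixes X :: "'a topology" and \<C> :: "'a cells"
  assumes cw_complex: "cw_complex X \<C>"
begin

lemmas cw_axioms = cw_complex[unfolded cw_complex_def]

lemma Hausdorff: "Hausdorff_space X"
  and Union_open_cell: "(\<Union>c\<in>\<C>. open_cell c) = topspace X"
  using cw_complex by (simp_all add: cw_complex_def)

lemma continuous_char: "(m, \<Phi>) \<in> \<C> \<Longrightarrow> continuous_map (closed_disc m) X \<Phi>"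
  using bspec[OF conjunct1[OF conjunct2[OF cw_axioms]], of "(m, \<Phi>)"] by simp

lemma homeomorphic_char: "(m, \<Phi>) \<in> \<C> \<Longrightarrow>
     homeomorphic_map (subtopology (closed_disc m) (open_disc m)) (subtopology X (open_cell (m, \<Phi>))) \<Phi>"
  using bspec[OF conjunct1[OF conjunct2[OF cw_axioms]], of "(m, \<Phi>)"] by simp

lemma disjoint_cells: "c \<in> \<C> \<Longrightarrow> d \<in> \<C> \<Longrightarrow> c \<noteq> d \<Longrightarrow> open_cell c \<inter> open_cell d = {}"
  using pairwiseD[OF conjunct1[OF conjunct2[OF conjunct2[OF conjunct2[OF cw_axioms]]]]]
  by (simp add: disjnt_def)

lemma closure_finite: "(m, \<Phi>) \<in> \<C> \<Longrightarrow> \<exists>\<F>. finite \<F> \<and> \<F> \<subseteq> \<C> \<and> (\<forall>d\<in>\<F>. fst d < m) \<and>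
       \<Phi> ` disc_boundary m \<subseteq> (\<Union>d\<in>\<F>. open_cell d)"
  using bspec[OF conjunct1[OF conjunct2[OF conjunct2[OF conjunct2[OF conjunct2[OF cw_axioms]]]]], of "(m, \<Phi>)"] by simp

lemma weak_topology: "A \<subseteq> topspace X \<Longrightarrow> closedin X A \<longleftrightarrow>
       (\<forall>(m, \<Phi>) \<in> \<C>. closedin (closed_disc m) {x \<in> topspace (closed_disc m). \<Phi> x \<in> A})"
  using conjunct2[OF conjunct2[OF conjunct2[OF conjunct2[OF conjunct2[OF cw_axioms]]]]] by simp

lemma char_in_topspace: "(m, \<Phi>) \<in> \<C> \<Longrightarrow> v \<in> topspace (closed_disc m) \<Longrightarrow> \<Phi> v \<in> topspace X"
  using continuous_char by (auto simp: continuous_map_def)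

text \<open>Open cells are disjoint and characteristic maps are injective on open discs, so the
  choice is unique: \<open>locate\<close> returns the cell of a point and its coordinate
  there.\<close>

definition locate :: "'a \<Rightarrow> (nat \<times> ((nat \<Rightarrow> real) \<Rightarrow> 'a)) \<times> (nat \<Rightarrow> real)"
  where "locate x = (SOME (c, v). c \<in> \<C> \<and> v \<in> open_disc (fst c) \<and> snd c v = x)"

definition cell_dim :: "'a \<Rightarrow> nat" where "cell_dim x = fst (fst (locate x))"

definition skeleton :: "nat \<Rightarrow> 'a set" where "skeleton m = {x \<in> topspace X. cell_dim x \<le> m}"

lemma locate_char:
  assumes "(m, \<Phi>) \<in> \<C>" "v \<in> open_disc m"
  shows "locate (\<Phi> v) = ((m, \<Phi>), v)"
proof -
  let ?P = "\<lambda>(c, w). c \<in> \<C> \<and> w \<in> open_disc (fst c) \<and> snd c w = \<Phi> v"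
  have "?P (locate (\<Phi> v))"
    unfolding locate_def by (rule someI[of ?P "((m, \<Phi>), v)"]) (use assms in auto)
  then obtain c w where cw: "locate (\<Phi> v) = (c, w)" "c \<in> \<C>" "w \<in> open_disc (fst c)" "snd c w = \<Phi> v"
    by (cases "locate (\<Phi> v)") auto
  then have "\<Phi> v \<in> open_cell c" "\<Phi> v \<in> open_cell (m, \<Phi>)"
    using assms by (auto simp: open_cell_def image_iff, metis)
  then have c: "c = (m, \<Phi>)"
    using disjoint_cells cw assms by blast
  have "inj_on \<Phi> (open_disc m)"
    using homeomorphic_imp_injective_map[OF homeomorphic_char[OF assms(1)]]
    by (simp add: topspace_subtopology open_disc_def Int_absorb1 Collect_restrict inf.absorb2)
  then show ?thesis
    using cw c assms by (auto dest: inj_onD)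
qed

lemma locate_cases:
  assumes "x \<in> topspace X"
  obtains m \<Phi> v where "(m, \<Phi>) \<in> \<C>" "v \<in> open_disc m" "x = \<Phi> v" "locate x = ((m, \<Phi>), v)"
    "cell_dim x = m"
proof -
  obtain c where "c \<in> \<C>" "x \<in> open_cell c" using assms Union_open_cell by blast
  then obtain m \<Phi> v where "(m, \<Phi>) \<in> \<C>" "v \<in> open_disc m" "x = \<Phi> v"
    by (cases c) (auto simp: open_cell_def)
  then show thesis using that locate_char by (auto simp: cell_dim_def)
qed

lemma cell_dim_char: "(m, \<Phi>) \<in> \<C> \<Longrightarrow> v \<in> open_disc m \<Longrightarrow> cell_dim (\<Phi> v) = m"
  by (simp add: cell_dim_def locate_char)

lemma cell_dim_boundary:
  assumes "(m, \<Phi>) \<in> \<C>" "v \<in> disc_boundary m"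
  shows "cell_dim (\<Phi> v) < m"
proof -
  obtain \<F> where "\<F> \<subseteq> \<C>" "\<forall>d\<in>\<F>. fst d < m" "\<Phi> ` disc_boundary m \<subseteq> (\<Union>d\<in>\<F>. open_cell d)"
    using closure_finite[OF assms(1)] by blast
  then obtain d where "d \<in> \<C>" "fst d < m" "\<Phi> v \<in> open_cell d"
    using assms(2) by blast
  then show ?thesis
    using cell_dim_char[of "fst d" "snd d"] by (auto simp: open_cell_def)
qed

lemma closed_disc_cases:
  assumes "v \<in> topspace (closed_disc m)"
  obtains "v \<in> open_disc m" | "v \<in> disc_boundary m"
  using assms by (force simp: topspace_closed_disc open_disc_eq disc_boundary_eq)

lemma cell_dim_char_le:
  assumes "(m, \<Phi>) \<in> \<C>" "v \<in> topspace (closed_disc m)"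
  shows "cell_dim (\<Phi> v) \<le> m"
  using assms(2) cell_dim_char[OF assms(1), of v] cell_dim_boundary[OF assms(1), of v]
  by (cases rule: closed_disc_cases) auto

lemma char_in_skeleton:
  assumes "(m', \<Phi>) \<in> \<C>" "v \<in> topspace (closed_disc m')" "m' \<le> m"
  shows "\<Phi> v \<in> skeleton m"
  using cell_dim_char_le[OF assms(1,2)] char_in_topspace[OF assms(1,2)] assms(3)
  by (auto simp: skeleton_def)

text \<open>The weak topology tests a set on all cells; here cells of dimension at most
  \<open>m\<close> suffice. A higher cell can meet the relative complement \<open>B\<close> only
  along its boundary sphere, which meets finitely many open cells, and the trace of \<open>B\<close>
  on each closed cell of dimension at most \<open>m\<close> is compact, hence closed in the
  Hausdorff space.\<close>

lemma openin_skeleton: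
  assumes W: "W \<subseteq> skeleton m"
    and opn: "\<And>m' \<Phi>. (m', \<Phi>) \<in> \<C> \<Longrightarrow> m' \<le> m \<Longrightarrow>
      openin (closed_disc m') {v \<in> topspace (closed_disc m'). \<Phi> v \<in> W}"
  shows "openin (subtopology X (skeleton m)) W"
proof -
  define B where "B = skeleton m - W"
  have low: "closedin (closed_disc m') {v \<in> topspace (closed_disc m'). \<Phi> v \<in> B}"
    if "(m', \<Phi>) \<in> \<C>" "m' \<le> m" for m' \<Phi>
  proof -
    have "{v \<in> topspace (closed_disc m'). \<Phi> v \<in> B} =
        topspace (closed_disc m') - {v \<in> topspace (closed_disc m'). \<Phi> v \<in> W}"
      using char_in_skeleton[OF that(1) _ that(2)] by (auto simp: B_def)
    then show ?thesis using opn[OF that] by (simp only: openin_closedin_eq)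
  qed
  have cl: "closedin X (B \<inter> \<Phi> ` topspace (closed_disc m'))"
    if "(m', \<Phi>) \<in> \<C>" "m' \<le> m" for m' \<Phi>
  proof -
    have "compactin X (\<Phi> ` {v \<in> topspace (closed_disc m'). \<Phi> v \<in> B})"
      using closedin_compact_space[OF compact_space_closed_disc low[OF that]]
      by (rule image_compactin) (rule continuous_char[OF that(1)])
    moreover have "\<Phi> ` {v \<in> topspace (closed_disc m'). \<Phi> v \<in> B} = B \<inter> \<Phi> ` topspace (closed_disc m')"
      by auto
    ultimately show ?thesis using compactin_imp_closedin[OF Hausdorff] by simp
  qed
  have "closedin (closed_disc m') {v \<in> topspace (closed_disc m'). \<Phi> v \<in> B}"
    if c: "(m', \<Phi>) \<in> \<C>" for m' \<Phi>
  proof (cases "m' \<le> m")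
    case True
    then show ?thesis using low c by blast
  next
    case False
    obtain \<F> where \<F>: "finite \<F>" "\<F> \<subseteq> \<C>" "\<Phi> ` disc_boundary m' \<subseteq> (\<Union>d\<in>\<F>. open_cell d)"
      using closure_finite[OF c] by blast
    \<comment> \<open>A closed set with the same preimage as \<open>B\<close> in this cell,
      assembled from the finitely many lower cells that the boundary meets.\<close>
    define Q where "Q = (\<Union>d\<in>{d\<in>\<F>. fst d \<le> m}. B \<inter> snd d ` topspace (closed_disc (fst d)))"
    have "closedin X Q"
      unfolding Q_def
    proof (rule closedin_Union)
      show "closedin X T" if "T \<in> (\<lambda>d. B \<inter> snd d ` topspace (closed_disc (fst d))) ` {d \<in> \<F>. fst d \<le> m}" for T
        using that \<F>(2) cl by auto
    qed (use \<F>(1) in simp)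
    then have "closedin (closed_disc m') {v \<in> topspace (closed_disc m'). \<Phi> v \<in> Q}"
      by (rule closedin_continuous_map_preimage[OF continuous_char[OF c]])
    moreover have "{v \<in> topspace (closed_disc m'). \<Phi> v \<in> Q} = {v \<in> topspace (closed_disc m'). \<Phi> v \<in> B}"
    proof (intro equalityI subsetI)
      fix v assume "v \<in> {v \<in> topspace (closed_disc m'). \<Phi> v \<in> B}"
      then have v: "v \<in> topspace (closed_disc m')" "\<Phi> v \<in> B" by auto
      then have dm: "cell_dim (\<Phi> v) \<le> m" by (auto simp: B_def skeleton_def)
      then have "v \<in> disc_boundary m'"
        using cell_dim_char[OF c, of v] False by (cases rule: closed_disc_cases[OF v(1)]) auto
      then obtain d where d: "d \<in> \<F>" "\<Phi> v \<in> open_cell d" using \<F>(3) by blast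
      then obtain w where w: "w \<in> open_disc (fst d)" "\<Phi> v = snd d w" by (auto simp: open_cell_def)
      have "fst d \<le> m"
        using cell_dim_char[of "fst d" "snd d" w] w d \<F>(2) dm by auto
      moreover have "w \<in> topspace (closed_disc (fst d))" using w(1) by (auto simp: open_disc_def)
      ultimately show "v \<in> {v \<in> topspace (closed_disc m'). \<Phi> v \<in> Q}"
        using v d w(2) unfolding Q_def by blast
    qed (auto simp: Q_def)
    ultimately show ?thesis by simp
  qed
  then have "closedin X B"
    by (subst weak_topology) (auto simp: B_def skeleton_def)
  then have "openin X (topspace X - B)" by blast
  moreover have "W = (topspace X - B) \<inter> skeleton m"
    using W by (auto simp: B_def skeleton_def)
  ultimately show ?thesis by (auto simp: openin_subtopology)
qed

text \<open>The set \<open>S\<close> is itself open in the skeleton, so a subset of \<open>S\<close>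
  may be tested for openness in the skeleton instead of in \<open>S\<close>.\<close>

lemma continuous_map_skeleton:
  assumes S: "S \<subseteq> skeleton m"
    and opn: "\<And>m' \<Phi>. (m', \<Phi>) \<in> \<C> \<Longrightarrow> m' \<le> m \<Longrightarrow>
      openin (closed_disc m') {v \<in> topspace (closed_disc m'). \<Phi> v \<in> S}"
    and cont: "\<And>m' \<Phi>. (m', \<Phi>) \<in> \<C> \<Longrightarrow> m' \<le> m \<Longrightarrow>
      continuous_map (subtopology (closed_disc m') {v \<in> topspace (closed_disc m'). \<Phi> v \<in> S}) Z (g \<circ> \<Phi>)"
  shows "continuous_map (subtopology X S) Z g"
  unfolding continuous_map_def
proof (intro conjI allI impI)
  have top: "topspace (subtopology X S) = S" using S by (auto simp: skeleton_def)
  show "g \<in> topspace (subtopology X S) \<rightarrow> topspace Z"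
  proof
    fix x assume "x \<in> topspace (subtopology X S)"
    then have x: "x \<in> S" "x \<in> topspace X" by auto
    obtain m' \<Phi> v where v: "(m', \<Phi>) \<in> \<C>" "v \<in> open_disc m'" "x = \<Phi> v" "cell_dim x = m'"
      by (rule locate_cases[OF x(2)]) blast
    then have "m' \<le> m" using x S by (auto simp: skeleton_def)
    from continuous_map_image_subset_topspace[OF cont[OF v(1) this]] show "g x \<in> topspace Z"
      using v x by (auto simp: open_disc_def)
  qed
  fix V assume V: "openin Z V"
  let ?W = "{x \<in> topspace (subtopology X S). g x \<in> V}"
  have "openin (subtopology X (skeleton m)) ?W"
  proof (rule openin_skeleton)
    show "?W \<subseteq> skeleton m" using S by auto
    fix m' \<Phi> assume c: "(m', \<Phi>) \<in> \<C>" "m' \<le> m"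
    let ?P = "{v \<in> topspace (closed_disc m'). \<Phi> v \<in> S}"
    have "openin (subtopology (closed_disc m') ?P)
        {v \<in> topspace (subtopology (closed_disc m') ?P). (g \<circ> \<Phi>) v \<in> V}"
      by (rule openin_continuous_map_preimage[OF cont[OF c] V])
    then have "openin (closed_disc m') {v \<in> topspace (subtopology (closed_disc m') ?P). (g \<circ> \<Phi>) v \<in> V}"
      using opn[OF c] openin_trans_full by blast
    moreover have "{v \<in> topspace (subtopology (closed_disc m') ?P). (g \<circ> \<Phi>) v \<in> V} =
        {v \<in> topspace (closed_disc m'). \<Phi> v \<in> ?W}"
      unfolding top by auto
    ultimately show "openin (closed_disc m') {v \<in> topspace (closed_disc m'). \<Phi> v \<in> ?W}" by simp
  qed
  then obtain T where T: "openin X T" "?W = T \<inter> skeleton m"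
    unfolding openin_subtopology by blast
  moreover have "?W \<subseteq> S" unfolding top by blast
  ultimately have "?W = T \<inter> S" using S by blast
  then show "openin (subtopology X S) ?W"
    using T(1) unfolding openin_subtopology by blast
qed


text \<open>The restriction to the \<open>(i + k)\<close>-skeleton of a function supported near the open \<open>i\<close>-cells:
  it is extended over each higher cell by radial projection and a cutoff near the centre.\<close>

primrec bump :: "nat \<Rightarrow> nat \<Rightarrow> 'a \<Rightarrow> real"
  where
    "bump i 0 x = (if cell_dim x = i then 1 - disc_norm i (snd (locate x)) else 0)"
  | "bump i (Suc k) x = (if cell_dim x = i + Suc k
       then (let v = snd (locate x); r = disc_norm (i + Suc k) v in
             max 0 (2 * r - 1) * bump i k (snd (fst (locate x)) (\<lambda>j. 1 / r * v j)))
       else bump i k x)"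

lemma bump_mono: "cell_dim x \<le> i + k \<Longrightarrow> bump i (k + l) x = bump i k x"
  by (induction l) auto

text \<open>The formula defining the extension on the open cell remains right on the boundary
  sphere, where the cutoff is \<open>1\<close> and the radial projection is the identity. Continuity
  on the closed cell depends on this.\<close>

lemma bump_char_top:
  assumes c: "(m, \<Phi>) \<in> \<C>" "m = i + Suc k" and v: "v \<in> topspace (closed_disc m)"
  shows "bump i (Suc k) (\<Phi> v) =
    max 0 (2 * disc_norm m v - 1) * bump i k (\<Phi> (\<lambda>j. 1 / disc_norm m v * v j))"
  using v
proof (cases rule: closed_disc_cases)
  case 1
  show ?thesis
    using locate_char[OF c(1) 1] cell_dim_char[OF c(1) 1] c(2) by (simp add: Let_def)
next
  case 2
  then show ?thesis using cell_dim_boundary[OF c(1) 2] c(2) by (simp add: disc_boundary_eq)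
qed

lemma skeleton_preimage:
  assumes "(m', \<Phi>) \<in> \<C>" "m' \<le> m"
  shows "{v \<in> topspace (closed_disc m'). \<Phi> v \<in> skeleton m} = topspace (closed_disc m')"
  using char_in_skeleton[OF assms(1) _ assms(2)] by blast

lemma continuous_map_whole_skeleton:
  assumes "\<And>m' \<Phi>. (m', \<Phi>) \<in> \<C> \<Longrightarrow> m' \<le> m \<Longrightarrow> continuous_map (closed_disc m') Z (g \<circ> \<Phi>)"
  shows "continuous_map (subtopology X (skeleton m)) Z g"
  by (rule continuous_map_skeleton[of _ m]) (simp_all add: skeleton_preimage assms)

lemma continuous_map_char_boundary:
  assumes c: "(Suc m, \<Phi>) \<in> \<C>"
  shows "continuous_map (subtopology (closed_disc (Suc m)) (disc_boundary (Suc m))) (subtopology X (skeleton m)) \<Phi>"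
proof (rule continuous_map_into_subtopology)
  show "continuous_map (subtopology (closed_disc (Suc m)) (disc_boundary (Suc m))) X \<Phi>"
    by (rule continuous_map_from_subtopology[OF continuous_char[OF c]])
  show "\<Phi> \<in> topspace (subtopology (closed_disc (Suc m)) (disc_boundary (Suc m))) \<rightarrow> skeleton m"
    using cell_dim_boundary[OF c] char_in_topspace[OF c] by (fastforce simp: skeleton_def)
qed

lemma continuous_map_normalize:
  assumes "\<And>v. v \<in> S \<Longrightarrow> disc_norm m v > 0"
  shows "continuous_map (subtopology (closed_disc m) S) (subtopology (closed_disc m) (disc_boundary m))
    (\<lambda>v j. 1 / disc_norm m v * v j)"
proof (rule continuous_map_into_subtopology)
  let ?Z = "subtopology (closed_disc m) S"
  show "continuous_map ?Z (closed_disc m) (\<lambda>v j. 1 / disc_norm m v * v j)"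
  proof (rule continuous_map_scale_disc)
    show "continuous_map ?Z euclideanreal (\<lambda>v. 1 / disc_norm m v)"
      using assms by (intro continuous_map_real_divide continuous_map_from_subtopology[OF continuous_map_disc_norm])
        (auto simp: less_imp_neq[symmetric])
    show "continuous_map ?Z (closed_disc m) (\<lambda>v. v)"
      by (intro continuous_map_from_subtopology) simp
  qed (use assms in \<open>auto simp: divide_simps\<close>)
  show "(\<lambda>v j. 1 / disc_norm m v * v j) \<in> topspace ?Z \<rightarrow> disc_boundary m"
  proof
    fix v assume "v \<in> topspace ?Z"
    then have "v \<in> topspace (closed_disc m)" "disc_norm m v > 0" using assms by auto
    then show "(\<lambda>j. 1 / disc_norm m v * v j) \<in> disc_boundary m"
      unfolding disc_boundary_eq mem_Collect_eq disc_norm_scale by (auto simp: topspace_closed_disc)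
  qed
qed

lemma continuous_map_bump_char:
  "(m, \<Phi>) \<in> \<C> \<Longrightarrow> m \<le> i + k \<Longrightarrow> continuous_map (closed_disc m) euclideanreal (bump i k \<circ> \<Phi>)"
proof (induction k arbitrary: m \<Phi>)
  case 0
  \<comment> \<open>\<open>1 - disc_norm i\<close> vanishes on the boundary sphere and so fits the
    value \<open>0\<close> on all lower cells.\<close>
  have "(bump i 0 \<circ> \<Phi>) v = (if m = i then 1 - disc_norm m v else 0)" if "v \<in> topspace (closed_disc m)" for v
    using that
  proof (cases rule: closed_disc_cases)
    case 1
    then show ?thesis by (simp add: locate_char[OF 0(1) 1] cell_dim_char[OF 0(1) 1])
  next
    case 2
    then show ?thesis using cell_dim_boundary[OF 0(1) 2] 0 by (auto simp: disc_boundary_eq)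
  qed
  moreover have "continuous_map (closed_disc m) euclideanreal (\<lambda>v. if m = i then 1 - disc_norm m v else 0)"
    by (cases "m = i") (auto intro!: continuous_map_diff continuous_map_disc_norm)
  ultimately show ?case by (auto elim: continuous_map_eq)
next
  case (Suc k)
  show ?case
  proof (cases "m \<le> i + k")
    case True
    have "(bump i (Suc k) \<circ> \<Phi>) v = (bump i k \<circ> \<Phi>) v" if "v \<in> topspace (closed_disc m)" for v
      using cell_dim_char_le[OF Suc.prems(1) that] True by simp
    then show ?thesis
      using Suc.IH[OF Suc.prems(1) True] by (auto elim: continuous_map_eq)
  next
    case False
    then have m: "m = i + Suc k" using Suc.prems by simp
    \<comment> \<open>Radial projection breaks down at the centre. It is used only at norm at least
      \<open>1/2\<close>, and the cutoff vanishes at norm \<open>1/2\<close>, so that gluing with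
      \<open>0\<close> is continuous.\<close>
    let ?S = "{v. v \<in> topspace (closed_disc m) \<and> 1/2 \<le> disc_norm m v}"
    let ?n = "\<lambda>v j. 1 / disc_norm m v * v j"
    have skel: "continuous_map (subtopology X (skeleton (i + k))) euclideanreal (bump i k)"
      by (rule continuous_map_whole_skeleton[OF Suc.IH])
    have "continuous_map (subtopology (closed_disc m) ?S) euclideanreal (bump i k \<circ> (\<Phi> \<circ> ?n))"
      using continuous_map_compose[OF continuous_map_compose[OF continuous_map_normalize
            continuous_map_char_boundary] skel, of ?S \<Phi>] Suc.prems(1) m
      by force
    then have "continuous_map (subtopology (closed_disc m) ?S) euclideanreal
        (\<lambda>v. (2 * disc_norm m v - 1) * bump i k (\<Phi> (?n v)))"
      by (intro continuous_map_real_mult continuous_map_diff continuous_map_real_mult_left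
          continuous_map_from_subtopology[OF continuous_map_disc_norm]) (simp_all add: o_def)
    then have "continuous_map (closed_disc m) euclideanreal
      (\<lambda>v. if 1/2 \<le> disc_norm m v then (2 * disc_norm m v - 1) * bump i k (\<Phi> (?n v)) else 0)"
      by (intro continuous_map_cases_le continuous_map_disc_norm) auto
    then show ?thesis
    proof (rule continuous_map_eq)
      fix v assume "v \<in> topspace (closed_disc m)"
      then show "(if 1/2 \<le> disc_norm m v then (2 * disc_norm m v - 1) * bump i k (\<Phi> (?n v)) else 0) =
          (bump i (Suc k) \<circ> \<Phi>) v"
        by (simp add: bump_char_top[OF Suc.prems(1) m] del: bump.simps)
    qed
  qed
qed

definition bump_support :: "nat \<Rightarrow> nat \<Rightarrow> 'a set"
  where "bump_support i k = {x \<in> skeleton (i + k). bump i k x > 0}"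

lemma openin_bump_preimage:
  assumes "(m, \<Phi>) \<in> \<C>" "m \<le> i + k"
  shows "openin (closed_disc m) {v \<in> topspace (closed_disc m). \<Phi> v \<in> bump_support i k}"
proof -
  have "{v \<in> topspace (closed_disc m). \<Phi> v \<in> bump_support i k} =
      {v \<in> topspace (closed_disc m). (bump i k \<circ> \<Phi>) v \<in> {0<..}}"
    using char_in_skeleton[OF assms(1) _ assms(2)] by (auto simp: bump_support_def)
  then show ?thesis
    using openin_continuous_map_preimage[OF continuous_map_bump_char[OF assms], of "{0<..}"] by simp
qed

text \<open>The image of a closed disc is path connected along radii, so its preimage of a union of
  path components is empty or the whole disc. By the weak topology every such union is closed; a
  path component and its complement are therefore both closed.\<close>

lemma path_connected:
  assumes conn: "connected_space X" and "x \<in> topspace X" "y \<in> topspace X"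
  shows "path_component_of X x y"
proof -
  define P where "P = {z \<in> topspace X. path_component_of X x z}"
  have disc: "path_component_of X (\<Phi> v) (\<Phi> w)"
    if "(m, \<Phi>) \<in> \<C>" "v \<in> topspace (closed_disc m)" "w \<in> topspace (closed_disc m)" for m \<Phi> v w
  proof -
    have "path_component_of X (\<Phi> v) (\<Phi> (\<lambda>_. 0))" if v: "v \<in> topspace (closed_disc m)" for v
    proof -
      have "continuous_map (top_of_set {0..1}) (closed_disc m) (\<lambda>t j. (1 - t) * v j)"
      proof (rule continuous_map_scale_disc)
        fix t :: real assume "t \<in> topspace (top_of_set {0..1})"
        then show "\<bar>1 - t\<bar> * disc_norm m v \<le> 1"
          using v by (auto simp: topspace_closed_disc intro: mult_le_one)
      qed (use v in \<open>auto intro!: continuous_intros\<close>)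
      from continuous_map_compose[OF this continuous_char[OF \<open>(m, \<Phi>) \<in> \<C>\<close>]]
      show ?thesis
        unfolding path_component_of_def pathin_def by (intro exI conjI) (assumption, simp_all)
    qed
    then show ?thesis using that path_component_of_trans path_component_of_sym by metis
  qed
  have sat: "closedin X Q" if Q: "Q \<subseteq> topspace X"
      "\<And>z w. z \<in> Q \<Longrightarrow> path_component_of X z w \<Longrightarrow> w \<in> Q" for Q
    unfolding weak_topology[OF Q(1)]
  proof (intro ballI, clarify)
    fix m \<Phi> assume c: "(m, \<Phi>) \<in> \<C>"
    have "{v \<in> topspace (closed_disc m). \<Phi> v \<in> Q} = {} \<or>
        {v \<in> topspace (closed_disc m). \<Phi> v \<in> Q} = topspace (closed_disc m)"
    proof (cases "\<exists>v \<in> topspace (closed_disc m). \<Phi> v \<in> Q")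
      case True
      then obtain v where v: "v \<in> topspace (closed_disc m)" "\<Phi> v \<in> Q" by (elim bexE)
      have "\<Phi> w \<in> Q" if "w \<in> topspace (closed_disc m)" for w
        by (rule Q(2)[OF v(2) disc[OF c v(1) that]])
      then show ?thesis by auto
    qed auto
    then show "closedin (closed_disc m) {v \<in> topspace (closed_disc m). \<Phi> v \<in> Q}"
      by (elim disjE) (simp_all only: closedin_empty closedin_topspace)
  qed
  have "closedin X P"
  proof (rule sat)
    show "w \<in> P" if "z \<in> P" "path_component_of X z w" for z w
      using that path_component_in_topspace[OF that(2)] path_component_of_trans[of X x z w]
      by (auto simp: P_def)
  qed (auto simp: P_def)
  moreover have "closedin X (topspace X - P)"
  proof (rule sat)
    show "w \<in> topspace X - P" if "z \<in> topspace X - P" "path_component_of X z w" for z w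
      using that path_component_in_topspace[OF that(2)] path_component_of_trans[of X x w z]
        path_component_of_sym[of X z w] by (auto simp: P_def)
  qed auto
  then have "openin X P" by (metis (no_types, lifting) P_def mem_Collect_eq openin_closedin_eq subsetI)
  moreover have "x \<in> P" using assms by (simp add: P_def path_component_of_refl)
  ultimately have "P = topspace X" using conn unfolding connected_space_clopen_in by blast
  then show ?thesis using assms by (auto simp: P_def)
qed


text \<open>Radial contraction to the centre inside the cell, followed by a path from the centre to
  \<open>b\<close> that may leave the cell.\<close>

lemma open_cell_contract:
  assumes c: "(m, \<Phi>) \<in> \<C>" and b: "path_component_of X (\<Phi> (\<lambda>_. 0)) b"
  shows "homotopic_with (\<lambda>_. True) (subtopology X (open_cell (m, \<Phi>))) X id (\<lambda>_. b)"
proof -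
  let ?Z = "subtopology X (open_cell (m, \<Phi>))" and ?D = "subtopology (closed_disc m) (open_disc m)"
  obtain g where g: "homeomorphic_maps ?D ?Z \<Phi> g"
    using homeomorphic_char[OF c] by (auto simp: homeomorphic_map_maps)
  then have "continuous_map ?Z ?D g" "\<And>x. x \<in> topspace ?Z \<Longrightarrow> \<Phi> (g x) = x"
    by (auto simp: homeomorphic_maps_def)
  then have g': "continuous_map ?Z (closed_disc m) g" "\<And>x. x \<in> topspace ?Z \<Longrightarrow> \<Phi> (g x) = x"
    by (auto simp: continuous_map_in_subtopology)
  have "continuous_map (prod_topology (top_of_set {0..1}) ?Z) (closed_disc m) (\<lambda>z j. (1 - fst z) * g (snd z) j)"
  proof (rule continuous_map_scale_disc)
    show "continuous_map (prod_topology (top_of_set {0..1}) ?Z) (closed_disc m) (\<lambda>z. g (snd z))"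
      using continuous_map_compose[OF continuous_map_snd g'(1)] by (simp add: o_def)
    show "continuous_map (prod_topology (top_of_set {0..1}) ?Z) euclideanreal (\<lambda>z. 1 - fst z)"
      using continuous_map_fst[of "top_of_set {0..1}" ?Z]
      by (intro continuous_map_diff) (auto simp: continuous_map_in_subtopology)
    fix z :: "real \<times> 'a" assume z: "z \<in> topspace (prod_topology (top_of_set {0..1}) ?Z)"
    then have "g (snd z) \<in> topspace (closed_disc m)"
      using continuous_map_image_subset_topspace[OF g'(1)] by auto
    then show "\<bar>1 - fst z\<bar> * disc_norm m (g (snd z)) \<le> 1"
      using z by (auto simp: topspace_closed_disc intro!: mult_le_one)
  qed
  from continuous_map_compose[OF this continuous_char[OF c]]
  have h: "continuous_map (prod_topology (top_of_set {0..1}) ?Z) X (\<lambda>z. \<Phi> (\<lambda>j. (1 - fst z) * g (snd z) j))"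
    by (simp add: o_def)
  have "homotopic_with (\<lambda>_. True) ?Z X id (\<lambda>_. \<Phi> (\<lambda>_. 0))"
    by (rule homotopic_withI[OF h]) (simp_all add: g'(2))
  moreover have "homotopic_with (\<lambda>_. True) ?Z X (\<lambda>_. \<Phi> (\<lambda>_. 0)) (\<lambda>_. b)"
    using b by (simp add: homotopic_constant_maps)
  ultimately show ?thesis by (rule homotopic_with_trans)
qed

lemma bump_support_0: "bump_support i 0 = (\<Union>c\<in>{c\<in>\<C>. fst c = i}. open_cell c)"
proof (intro equalityI subsetI)
  fix x assume x: "x \<in> bump_support i 0"
  then have "x \<in> topspace X" by (simp add: bump_support_def skeleton_def)
  then obtain m \<Phi> v where "(m, \<Phi>) \<in> \<C>" "v \<in> open_disc m" "x = \<Phi> v" "cell_dim x = m"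
    by (rule locate_cases)
  then show "x \<in> (\<Union>c\<in>{c\<in>\<C>. fst c = i}. open_cell c)"
    using x by (auto simp: bump_support_def open_cell_def split: if_splits)
next
  fix x assume "x \<in> (\<Union>c\<in>{c\<in>\<C>. fst c = i}. open_cell c)"
  then obtain \<Phi> v where "(i, \<Phi>) \<in> \<C>" "v \<in> open_disc i" "x = \<Phi> v"
    by (auto simp: open_cell_def)
  moreover from this have "v \<in> topspace (closed_disc i)" by (simp add: open_disc_def)
  ultimately show "x \<in> bump_support i 0"
    using char_in_skeleton[of i \<Phi> v i]
    by (simp add: bump_support_def locate_char cell_dim_char) (simp add: open_disc_eq)
qed

text \<open>Inside a closed cell of dimension at most \<open>i\<close> an open \<open>i\<close>-cell
  pulls back either to the full open disc or to the empty set. This makes the base case of the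
  contraction a disjoint union of open pieces.\<close>

lemma openin_open_cell:
  assumes c: "c \<in> \<C>" "fst c = i"
  shows "openin (subtopology X (skeleton i)) (open_cell c)"
proof (rule openin_skeleton)
  have sub: "open_cell d \<subseteq> bump_support (fst d) 0" if "d \<in> \<C>" for d
    unfolding bump_support_0 using that by blast
  show "open_cell c \<subseteq> skeleton i"
    using sub[OF c(1)] c(2) by (auto simp: bump_support_def)
  fix m' \<Phi> assume c': "(m', \<Phi>) \<in> \<C>" "m' \<le> i"
  let ?V = "{v \<in> topspace (closed_disc m'). \<Phi> v \<in> open_cell c}"
  have dim: "cell_dim x = i" if "x \<in> open_cell c" for x
    using that cell_dim_char[of "fst c" "snd c"] c by (auto simp: open_cell_def)
  have "?V = (if c = (m', \<Phi>) then open_disc m' else {})"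
  proof (intro equalityI subsetI)
    fix v assume v: "v \<in> ?V"
    have "v \<in> open_disc m'"
      using v dim[of "\<Phi> v"] cell_dim_boundary[OF c'(1), of v] c'(2)
      by (auto elim: closed_disc_cases)
    moreover from this have "\<Phi> v \<in> open_cell (m', \<Phi>)" by (auto simp: open_cell_def)
    ultimately show "v \<in> (if c = (m', \<Phi>) then open_disc m' else {})"
      using disjoint_cells[OF c(1) c'(1)] v by auto
  qed (auto simp: open_disc_def open_cell_def split: if_splits)
  moreover have "open_disc m' = {v \<in> topspace (closed_disc m'). disc_norm m' v \<in> {..<1}}"
    by (auto simp: open_disc_eq topspace_closed_disc)
  moreover have "openin (closed_disc m') {v \<in> topspace (closed_disc m'). disc_norm m' v \<in> {..<1}}"
    by (rule openin_continuous_map_preimage[OF continuous_map_disc_norm]) simp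
  ultimately show "openin (closed_disc m') ?V" by simp
qed

text \<open>Moves a point of an open \<open>m\<close>-cell outwards along its radius: the scaling
  factor runs from \<open>1\<close> at time \<open>0\<close> to \<open>1 / disc_norm m v\<close> at
  time \<open>1\<close>, which is the radial projection to the boundary.\<close>

definition push :: "nat \<Rightarrow> real \<Rightarrow> 'a \<Rightarrow> 'a"
  where "push m t x = (if cell_dim x = m then
    (let v = snd (locate x) in snd (fst (locate x)) (\<lambda>j. (1 - t + t * (1 / disc_norm m v)) * v j)) else x)"

lemma push_char:
  assumes c: "(m, \<Phi>) \<in> \<C>" and v: "v \<in> topspace (closed_disc m)"
  shows "push m t (\<Phi> v) = \<Phi> (\<lambda>j. (1 - t + t * (1 / disc_norm m v)) * v j)"
  using v
proof (cases rule: closed_disc_cases)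
  case 1
  then show ?thesis by (simp add: push_def locate_char[OF c 1] cell_dim_char[OF c 1] Let_def)
next
  case 2
  then show ?thesis using cell_dim_boundary[OF c 2] by (simp add: push_def disc_boundary_eq)
qed

text \<open>A positive value forces the cutoff to be positive, which keeps the point away from the
  centre, and forces the previous bump to be positive at the radial projection. So pushing leads
  from one support into the previous one.\<close>

lemma bump_support_Suc_norm:
  assumes "(m, \<Phi>) \<in> \<C>" "m = i + Suc k" "v \<in> topspace (closed_disc m)" "\<Phi> v \<in> bump_support i (Suc k)"
  shows "1/2 < disc_norm m v" "bump i k (\<Phi> (\<lambda>j. 1 / disc_norm m v * v j)) > 0"
    "\<Phi> (\<lambda>j. 1 / disc_norm m v * v j) \<in> skeleton (i + k)"
proof -
  have pos: "max 0 (2 * disc_norm m v - 1) * bump i k (\<Phi> (\<lambda>j. 1 / disc_norm m v * v j)) > 0"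
    using assms(4) unfolding bump_support_def mem_Collect_eq bump_char_top[OF assms(1-3)] by simp
  then show 1: "1/2 < disc_norm m v" by (auto simp: zero_less_mult_iff max_def split: if_splits)
  then show "bump i k (\<Phi> (\<lambda>j. 1 / disc_norm m v * v j)) > 0"
    using pos by (auto simp: zero_less_mult_iff max_def)
  have "(\<lambda>j. 1 / disc_norm m v * v j) \<in> disc_boundary m"
    using 1 assms(3) unfolding disc_boundary_eq mem_Collect_eq disc_norm_scale
    by (auto simp: topspace_closed_disc)
  then show "\<Phi> (\<lambda>j. 1 / disc_norm m v * v j) \<in> skeleton (i + k)"
    using cell_dim_boundary[OF assms(1)] char_in_topspace[OF assms(1)] assms(2)
    by (force simp: skeleton_def disc_boundary_def)
qed

text \<open>Cellwise continuity is available for maps out of a subset of a skeleton, not for maps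
  out of its product with the interval. The homotopy is therefore treated as a map into the path
  space, checked on cells in that form, and converted back by evaluation.\<close>

lemma push_homotopy:
  "continuous_map (prod_topology (top_of_set {0..1}) (subtopology X (bump_support i (Suc k)))) X
     (\<lambda>(t, x). push (i + Suc k) t x)"
proof -
  let ?S = "bump_support i (Suc k)" and ?n = "i + Suc k" and ?I = "top_of_set {0..1::real}"
  have "continuous_map (subtopology X ?S) (path_space X) (\<lambda>x. restrict (\<lambda>t. push ?n t x) {0..1})"
  proof (rule continuous_map_skeleton[of _ ?n])
    show "?S \<subseteq> skeleton ?n" by (auto simp: bump_support_def)
    fix m \<Phi> assume c: "(m, \<Phi>) \<in> \<C>" "m \<le> ?n"
    show "openin (closed_disc m) {v \<in> topspace (closed_disc m). \<Phi> v \<in> ?S}"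
      by (rule openin_bump_preimage[OF c])
    let ?P = "{v \<in> topspace (closed_disc m). \<Phi> v \<in> ?S}"
    let ?Z = "prod_topology ?I (subtopology (closed_disc m) ?P)"
    have snd: "continuous_map ?Z (closed_disc m) snd"
      using continuous_map_snd[of ?I "subtopology (closed_disc m) ?P"]
      by (simp add: continuous_map_in_subtopology)
    have fst: "continuous_map ?Z euclideanreal fst"
      using continuous_map_fst[of ?I "subtopology (closed_disc m) ?P"]
      by (simp add: continuous_map_in_subtopology)
    have "continuous_map ?Z X (\<lambda>z. push ?n (fst z) (\<Phi> (snd z)))"
    proof (cases "m = ?n")
      case True
      let ?c = "\<lambda>z. 1 - fst z + fst z * (1 / disc_norm m (snd z))"
      have nrm: "1/2 < disc_norm m (snd z)" "disc_norm m (snd z) \<le> 1" "0 \<le> fst z" "fst z \<le> 1"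
        if "z \<in> topspace ?Z" for z
        using that bump_support_Suc_norm(1)[OF c(1) True] by (auto simp: topspace_closed_disc)
      have "continuous_map ?Z (closed_disc m) (\<lambda>z j. ?c z * snd z j)"
      proof (rule continuous_map_scale_disc)
        have "continuous_map ?Z euclideanreal (\<lambda>z. disc_norm m (snd z))"
          using continuous_map_compose[OF snd continuous_map_disc_norm] by (simp add: o_def)
        moreover have "disc_norm m (snd z) \<noteq> 0" if "z \<in> topspace ?Z" for z
          using nrm(1)[OF that] by linarith
        ultimately show "continuous_map ?Z euclideanreal ?c"
          by (intro continuous_map_add continuous_map_diff continuous_map_real_mult
              continuous_map_real_divide fst) auto
        fix z assume z: "z \<in> topspace ?Z"
        \<comment> \<open>The norm of the moved point is a convex combination of the old norm and
          \<open>1\<close>, so the point stays in the disc.\<close>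
        have "?c z * disc_norm m (snd z) = (1 - fst z) * disc_norm m (snd z) + fst z * 1"
          using nrm(1)[OF z] by (simp add: field_simps)
        also have "\<dots> \<le> (1 - fst z) * 1 + fst z * 1"
          using nrm[OF z] by (intro add_mono mult_left_mono) auto
        finally show "\<bar>?c z\<bar> * disc_norm m (snd z) \<le> 1"
          using nrm[OF z] by (simp add: abs_of_nonneg)
      qed (fact snd)
      from continuous_map_compose[OF this continuous_char[OF c(1)]]
      show ?thesis
      proof (rule continuous_map_eq)
        fix z assume "z \<in> topspace ?Z"
        then have "snd z \<in> topspace (closed_disc m)" by auto
        from push_char[OF c(1) this, of "fst z"] True
        show "(\<Phi> \<circ> (\<lambda>z j. ?c z * snd z j)) z = push ?n (fst z) (\<Phi> (snd z))" by simp
      qed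
    next
      case False
      have "continuous_map ?Z X (\<Phi> \<circ> snd)"
        by (rule continuous_map_compose[OF snd continuous_char[OF c(1)]])
      then show ?thesis
      proof (rule continuous_map_eq)
        fix z assume "z \<in> topspace ?Z"
        then have "snd z \<in> topspace (closed_disc m)" by auto
        from cell_dim_char_le[OF c(1) this] False c(2)
        show "(\<Phi> \<circ> snd) z = push ?n (fst z) (\<Phi> (snd z))" by (auto simp: push_def)
      qed
    qed
    from continuous_map_into_path_space[OF this]
    show "continuous_map (subtopology (closed_disc m) ?P) (path_space X)
        ((\<lambda>x. restrict (\<lambda>t. push ?n t x) {0..1}) \<circ> \<Phi>)"
      by (simp add: o_def)
  qed
  from continuous_map_path_space_eval[OF this] show ?thesis
    by (rule continuous_map_eq) auto
qed

text \<open>Induction on the number of dimensions above \<open>i\<close>: one push deforms the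
  support in the next skeleton into the present one. The base case is the union of the open
  \<open>i\<close>-cells.\<close>

lemma bump_support_contract:
  assumes conn: "connected_space X" and b: "b \<in> topspace X"
  shows "homotopic_with (\<lambda>_. True) (subtopology X (bump_support i k)) X id (\<lambda>_. b)"
proof (induction k)
  case 0
  let ?Z = "subtopology X (bump_support i 0)"
  have sub: "bump_support i 0 \<subseteq> skeleton i" by (auto simp: bump_support_def)
  show ?case
  proof (rule homotopic_with_disjoint_open_Union[where I = "{c\<in>\<C>. fst c = i}" and T = open_cell])
    show "topspace ?Z \<subseteq> (\<Union>c\<in>{c\<in>\<C>. fst c = i}. open_cell c)"
      using bump_support_0[of i] by auto
    fix c assume c: "c \<in> {c\<in>\<C>. fst c = i}"
    then have cs: "open_cell c \<subseteq> bump_support i 0" by (auto simp: bump_support_0)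
    show "openin ?Z (open_cell c)"
    proof -
      obtain T where T: "openin X T" "open_cell c = T \<inter> skeleton i"
        using openin_open_cell[of c i] c unfolding openin_subtopology by blast
      then have "open_cell c = T \<inter> bump_support i 0" using cs sub by blast
      then show ?thesis using T(1) unfolding openin_subtopology by blast
    qed
    obtain \<Phi> where \<Phi>: "c = (i, \<Phi>)" using c by (cases c) auto
    have "(\<lambda>_. 0) \<in> topspace (closed_disc i)" by (simp add: topspace_closed_disc)
    then have "homotopic_with (\<lambda>_. True) (subtopology X (open_cell (i, \<Phi>))) X id (\<lambda>_. b)"
      using c \<Phi> by (intro open_cell_contract path_connected[OF conn _ b] char_in_topspace) auto
    moreover have "subtopology ?Z (open_cell c) = subtopology X (open_cell c)"
      using cs by (simp add: subtopology_subtopology inf.absorb2)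
    ultimately show "homotopic_with (\<lambda>_. True) (subtopology ?Z (open_cell c)) X id (\<lambda>_. b)"
      using \<Phi> by simp
  qed (use disjoint_cells in auto)
next
  case (Suc k)
  let ?S = "bump_support i (Suc k)" and ?r = "push (i + Suc k) 1"
  have 0: "push (i + Suc k) 0 x = x" if "x \<in> ?S" for x
  proof -
    have "x \<in> topspace X" using that by (simp add: bump_support_def skeleton_def)
    then show ?thesis by (rule locate_cases) (simp add: push_def Let_def)
  qed
  have homr: "homotopic_with (\<lambda>_. True) (subtopology X ?S) X id ?r"
    by (rule homotopic_withI[OF push_homotopy]) (use 0 in \<open>auto simp del: add_Suc_right\<close>)
  have r: "?r x \<in> bump_support i k" if x: "x \<in> ?S" for x
  proof -
    have "x \<in> topspace X" using x by (simp add: bump_support_def skeleton_def)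
    then obtain m \<Phi> v where c: "(m, \<Phi>) \<in> \<C>" "v \<in> open_disc m" "x = \<Phi> v" "cell_dim x = m"
      by (rule locate_cases)
    have v: "v \<in> topspace (closed_disc m)" using c(2) by (simp add: open_disc_def)
    show ?thesis
    proof (cases "m = i + Suc k")
      case True
      then show ?thesis
        using push_char[OF c(1) v, of 1] bump_support_Suc_norm[OF c(1) True v] c(3) x
        by (simp add: bump_support_def)
    next
      case False
      then show ?thesis
        using x c(4) by (auto simp: push_def bump_support_def skeleton_def)
    qed
  qed
  have "continuous_map (subtopology X ?S) (subtopology X (bump_support i k)) ?r"
    using homotopic_with_imp_continuous_maps[OF homr] r
    by (auto intro!: continuous_map_into_subtopology)
  from homotopic_with_compose_continuous_map_right[OF Suc.IH this]
  have "homotopic_with (\<lambda>_. True) (subtopology X ?S) X ?r (\<lambda>_. b)"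
    by (simp add: o_def)
  with homr show ?case by (rule homotopic_with_trans)
qed

theorem topological_complexity_le_dim:
  assumes conn: "connected_space X" and ne: "topspace X \<noteq> {}" and dim: "cw_dimension \<C> \<le> enat d"
  shows "topological_complexity X \<le> enat (2 * d)"
proof -
  obtain b where b: "b \<in> topspace X" using ne by blast
  have le: "m \<le> d" if "(m, \<Phi>) \<in> \<C>" for m \<Phi>
  proof -
    have "enat m \<le> cw_dimension \<C>"
      unfolding cw_dimension_def using SUP_upper[OF that, of "\<lambda>c. enat (fst c)"] by simp
    from order_trans[OF this dim] show ?thesis by simp
  qed
  have skel: "skeleton d = topspace X"
    using le by (auto simp: skeleton_def elim: locate_cases)
  show ?thesis
  proof (rule topological_complexity_le[where f = "\<lambda>i. bump i (d - i)" and b = b])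
    fix i assume i: "i \<le> d"
    show "continuous_map X euclideanreal (bump i (d - i))"
      using continuous_map_whole_skeleton[of d euclideanreal "bump i (d - i)"]
        continuous_map_bump_char[of _ _ i "d - i"] i skel by simp
    show "homotopic_with (\<lambda>_. True) (subtopology X {x \<in> topspace X. 0 < bump i (d - i) x}) X id (\<lambda>_. b)"
      using bump_support_contract[OF conn b, of i "d - i"] i skel by (simp add: bump_support_def)
  next
    fix x assume "x \<in> topspace X"
    then obtain m \<Phi> v where c: "(m, \<Phi>) \<in> \<C>" "v \<in> open_disc m" "x = \<Phi> v" "locate x = ((m, \<Phi>), v)"
      "cell_dim x = m" by (rule locate_cases)
    \<comment> \<open>A point of an open \<open>m\<close>-cell is caught by the bump of index
      \<open>m\<close>, whose value there is still the initial one,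
      \<open>1 - disc_norm m v\<close>.\<close>
    have "bump m (0 + (d - m)) x = bump m 0 x" by (rule bump_mono) (simp add: c(5))
    then have "bump m (d - m) x > 0" using c by (simp add: open_disc_eq)
    then show "\<exists>i\<le>d. 0 < bump i (d - i) x" using le[OF c(1)] by blast
  qed
qed

end

section \<open>Linear functionals and linear maps on free abelian groups\<close>

definition frag_eval :: "('v \<Rightarrow> 'f::comm_ring_1) \<Rightarrow> ('v \<Rightarrow>\<^sub>0 int) \<Rightarrow> 'f"
  where "frag_eval \<psi> c = (\<Sum>v\<in>Poly_Mapping.keys c. of_int (Poly_Mapping.lookup c v) * \<psi> v)"

lemma frag_eval_superset:
  assumes "finite S" "Poly_Mapping.keys c \<subseteq> S"
  shows "frag_eval \<psi> c = (\<Sum>v\<in>S. of_int (Poly_Mapping.lookup c v) * \<psi> v)"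
  unfolding frag_eval_def
  by (rule sum.mono_neutral_left) (use assms in \<open>auto simp: in_keys_iff\<close>)

lemma frag_eval_0 [simp]: "frag_eval \<psi> 0 = 0"
  by (simp add: frag_eval_def)

lemma frag_eval_of [simp]: "frag_eval \<psi> (frag_of v) = \<psi> v"
  by (simp add: frag_eval_def)

lemma frag_eval_add: "frag_eval \<psi> (a + b) = frag_eval \<psi> a + frag_eval \<psi> b"
proof -
  let ?S = "Poly_Mapping.keys a \<union> Poly_Mapping.keys b"
  have "Poly_Mapping.keys (a + b) \<subseteq> ?S" by (rule keys_add)
  then show ?thesis
    by (simp add: frag_eval_superset[of ?S] lookup_add sum.distrib distrib_right)
qed

lemma frag_eval_diff: "frag_eval \<psi> (a - b) = frag_eval \<psi> a - frag_eval \<psi> b"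
  using frag_eval_add[of \<psi> "a - b" b] by simp

lemma frag_eval_cmul: "frag_eval \<psi> (frag_cmul k c) = of_int k * frag_eval \<psi> c"
proof -
  have "Poly_Mapping.keys (frag_cmul k c) \<subseteq> Poly_Mapping.keys c" by (rule keys_cmul)
  then show ?thesis
    by (subst frag_eval_superset[of "Poly_Mapping.keys c"]) (simp_all add: frag_eval_def sum_distrib_left mult.assoc)
qed

lemma frag_eval_sum: "frag_eval \<psi> (\<Sum>i\<in>I. c i) = (\<Sum>i\<in>I. frag_eval \<psi> (c i))"
  by (induction I rule: infinite_finite_induct) (simp_all add: frag_eval_add)

lemma frag_eval_cong:
  "(\<And>v. v \<in> Poly_Mapping.keys c \<Longrightarrow> \<psi> v = \<psi>' v) \<Longrightarrow> frag_eval \<psi> c = frag_eval \<psi>' c"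
  by (simp add: frag_eval_def)

lemma frag_eval_zero: "frag_eval (\<lambda>_. 0) c = 0"
  by (simp add: frag_eval_def)

lemma frag_eval_scale: "frag_eval (\<lambda>v. x * \<psi> v) c = x * frag_eval \<psi> c"
  by (simp add: frag_eval_def sum_distrib_left mult.left_commute)

lemma frag_eval_minus_fun: "frag_eval (\<lambda>v. \<psi> v - \<psi>' v) c = frag_eval \<psi> c - frag_eval \<psi>' c"
  by (simp add: frag_eval_def sum_subtractf right_diff_distrib)

text \<open>Linearity is phrased by differences since \<open>frag_induction\<close> generates chains
  by differences.\<close>

lemma frag_linear_eq:
  assumes "\<And>a b. f (a - b) = f a - f b" "\<And>a b. g (a - b) = g a - g b"
    and "\<And>x. x \<in> Poly_Mapping.keys c \<Longrightarrow> f (frag_of x) = g (frag_of x)"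
  shows "f (c :: 'v \<Rightarrow>\<^sub>0 int) = (g c :: 'b::ab_group_add)"
proof -
  have 0: "f 0 = 0" "g 0 = 0" using assms(1)[of 0 0] assms(2)[of 0 0] by simp_all
  have "Poly_Mapping.keys c \<subseteq> Poly_Mapping.keys c" by simp
  then show ?thesis
    by (induction c rule: frag_induction) (simp_all add: 0 assms)
qed

lemma frag_eval_extend: "frag_eval \<psi> (frag_extend g c) = frag_eval (\<lambda>v. frag_eval \<psi> (g v)) c"
  by (rule frag_linear_eq[where c = c]) (simp_all add: frag_eval_diff frag_extend_diff)

lemma frag_extend_fun_diff: "frag_extend (\<lambda>x. f x - g x) c = frag_extend f c - frag_extend g c"
  by (rule frag_linear_eq[where c = c]) (simp_all add: frag_extend_diff)

lemma frag_extend_fun_add: "frag_extend (\<lambda>x. f x + g x) c = frag_extend f c + frag_extend g c"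
  by (rule frag_linear_eq[where c = c]) (simp_all add: frag_extend_diff)

lemma frag_cmul_diff: "frag_cmul k (a - b) = frag_cmul k a - frag_cmul k b"
  by (rule poly_mapping_eqI) (simp add: lookup_minus right_diff_distrib)

lemma frag_extend_fun_cmul: "frag_extend (\<lambda>x. frag_cmul k (f x)) c = frag_cmul k (frag_extend f c)"
  by (rule frag_linear_eq[where c = c]) (simp_all add: frag_extend_diff frag_cmul_diff)

lemma frag_extend_swap:
  "frag_extend (\<lambda>x. frag_extend (f x) d) c = frag_extend (\<lambda>y. frag_extend (\<lambda>x. f x y) c) d"
  by (rule frag_linear_eq[where c = c])
    (simp_all add: frag_extend_diff frag_extend_fun_diff frag_expansion[symmetric])

lemma frag_extend_extend:
  "frag_extend f (frag_extend g c) = frag_extend (\<lambda>x. frag_extend f (g x)) c"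
  by (rule frag_linear_eq[where c = c]) (simp_all add: frag_extend_diff)

lemma frag_extend_zero_fun: "frag_extend (\<lambda>_. 0) c = 0"
  by (rule frag_extend_eq_0) simp

section \<open>Ordered chains and a cross product\<close>

text \<open>Lists of vertices span the augmented ordered chain complex of the vertex set; the empty list
  is the generator in degree \<open>-1\<close>, so that coning is a contraction without exceptional case.\<close>

definition cone :: "'v \<Rightarrow> ('v list \<Rightarrow>\<^sub>0 int) \<Rightarrow> ('v list \<Rightarrow>\<^sub>0 int)"
  where "cone v = frag_extend (\<lambda>L. frag_of (v # L))"

primrec list_boundary :: "'v list \<Rightarrow> ('v list \<Rightarrow>\<^sub>0 int)"
  where
    "list_boundary [] = 0"
  | "list_boundary (v # L) = frag_of L - cone v (list_boundary L)"

abbreviation ordered_boundary :: "('v list \<Rightarrow>\<^sub>0 int) \<Rightarrow> ('v list \<Rightarrow>\<^sub>0 int)"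
  where "ordered_boundary \<equiv> frag_extend list_boundary"

lemma cone_diff: "cone v (a - b) = cone v a - cone v b"
  by (simp add: cone_def frag_extend_diff)

lemma cone_of [simp]: "cone v (frag_of L) = frag_of (v # L)"
  by (simp add: cone_def)

lemma cone_0 [simp]: "cone v 0 = 0"
  by (simp add: cone_def)

lemma boundary_cone: "ordered_boundary (cone v c) = c - cone v (ordered_boundary c)"
  by (rule frag_linear_eq[where c = c]) (simp_all add: frag_extend_diff cone_diff)

lemma boundary_list_boundary: "ordered_boundary (list_boundary L) = 0"
  by (induction L) (simp_all add: frag_extend_diff boundary_cone)

lemma keys_cone: "M \<in> Poly_Mapping.keys (cone v c) \<Longrightarrow> \<exists>L \<in> Poly_Mapping.keys c. M = v # L"
  using keys_frag_extend[of "\<lambda>L. frag_of (v # L)" c] by (auto simp: cone_def)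

lemma keys_list_boundary:
  "M \<in> Poly_Mapping.keys (list_boundary L) \<Longrightarrow> Suc (length M) = length L \<and> set M \<subseteq> set L"
proof (induction L arbitrary: M)
  case (Cons v L)
  then have "M \<in> Poly_Mapping.keys (frag_of L) \<union> Poly_Mapping.keys (cone v (list_boundary L))"
    using keys_diff[of "frag_of L" "cone v (list_boundary L)"] by auto
  then consider "M = L" | N where "N \<in> Poly_Mapping.keys (list_boundary L)" "M = v # N"
    using keys_cone by fastforce
  then show ?case by cases (use Cons.IH in force)+
qed simp

text \<open>Unrolling the cone recursion gives the alternating sum over faces, the form that can be
  compared with \<open>coboundary\<close>.\<close>

lemma list_boundary_sum:
  "list_boundary L = (\<Sum>k<length L. frag_cmul ((-1) ^ k) (frag_of (take k L @ drop (Suc k) L)))"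
proof (induction L)
  case (Cons v L)
  have "cone v (\<Sum>k<length L. frag_cmul ((-1) ^ k) (frag_of (take k L @ drop (Suc k) L))) =
      (\<Sum>k<length L. frag_cmul ((-1) ^ k) (frag_of (v # take k L @ drop (Suc k) L)))"
    unfolding cone_def by (simp add: frag_extend_sum frag_extend_cmul o_def)
  then show ?case
    by (simp add: Cons sum.lessThan_Suc_shift sum_negf[symmetric] del: sum.lessThan_Suc)
qed simp

text \<open>The chain map property forces \<open>cross n I J\<close>, for \<open>length I + length J = n + 2\<close>, to bound a given
  cycle, which is done by coning it off from the first vertex.\<close>

primrec cross :: "nat \<Rightarrow> 'v list \<Rightarrow> 'w list \<Rightarrow> (('v \<times> 'w) list \<Rightarrow>\<^sub>0 int)"
  where
    "cross 0 I J = (if length I = 1 \<and> length J = 1 then frag_of [(hd I, hd J)] else 0)"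
  | "cross (Suc n) I J = (if I = [] \<or> J = [] then 0 else
       cone (hd I, hd J) (frag_extend (\<lambda>I'. cross n I' J) (list_boundary I) +
         frag_cmul ((-1) ^ (length I - 1)) (frag_extend (cross n I) (list_boundary J))))"

text \<open>In the augmented complex the boundary of one vertex is the empty list. Products with it
  are \<open>0\<close>, so that no augmentation terms survive in
  \<open>boundary_cross\<close>.\<close>

lemma cross_Nil [simp]: "cross n [] J = 0" "cross n I [] = 0"
  by (cases n; simp)+

lemma cross_Nil_fun [simp]: "cross n [] = (\<lambda>_. 0)"
  by (rule ext) simp

lemma keys_cross_length: "L \<in> Poly_Mapping.keys (cross n I J) \<Longrightarrow> length L = Suc n"
proof (induction n arbitrary: I J L)
  case (Suc n)
  let ?a = "frag_extend (\<lambda>I'. cross n I' J) (list_boundary I)"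
  let ?b = "frag_extend (cross n I) (list_boundary J)"
  obtain M where M: "M \<in> Poly_Mapping.keys (?a + frag_cmul ((-1) ^ (length I - 1)) ?b)" "L = (hd I, hd J) # M"
    using Suc.prems by (auto split: if_splits dest: keys_cone)
  then have "M \<in> Poly_Mapping.keys ?a \<union> Poly_Mapping.keys ?b"
    using keys_add[of ?a "frag_cmul ((-1) ^ (length I - 1)) ?b"] by auto
  then have "length M = Suc n"
    using Suc.IH keys_frag_extend[of "\<lambda>I'. cross n I' J" "list_boundary I"]
      keys_frag_extend[of "cross n I" "list_boundary J"] by blast
  then show ?case using M by simp
qed (auto split: if_splits)

lemma keys_cross_set:
  "L \<in> Poly_Mapping.keys (cross n I J) \<Longrightarrow> set L \<subseteq> set I \<times> set J"
proof (induction n arbitrary: I J L)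
  case 0
  then show ?case by (auto split: if_splits simp: length_Suc_conv)
next
  case (Suc n)
  let ?a = "frag_extend (\<lambda>I'. cross n I' J) (list_boundary I)"
  let ?b = "frag_extend (cross n I) (list_boundary J)"
  have ne: "I \<noteq> []" "J \<noteq> []" using Suc.prems by (auto split: if_splits)
  obtain M where M: "M \<in> Poly_Mapping.keys (?a + frag_cmul ((-1) ^ (length I - 1)) ?b)" "L = (hd I, hd J) # M"
    using Suc.prems by (auto split: if_splits dest: keys_cone)
  then have "M \<in> Poly_Mapping.keys ?a \<union> Poly_Mapping.keys ?b"
    using keys_add[of ?a "frag_cmul ((-1) ^ (length I - 1)) ?b"] by auto
  then have "set M \<subseteq> set I \<times> set J"
  proof
    assume "M \<in> Poly_Mapping.keys ?a"
    then obtain I' where "I' \<in> Poly_Mapping.keys (list_boundary I)" "M \<in> Poly_Mapping.keys (cross n I' J)"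
      using keys_frag_extend[of "\<lambda>I'. cross n I' J" "list_boundary I"] by blast
    then show ?thesis using Suc.IH[of M I' J] keys_list_boundary[of I' I] by blast
  next
    assume "M \<in> Poly_Mapping.keys ?b"
    then obtain J' where "J' \<in> Poly_Mapping.keys (list_boundary J)" "M \<in> Poly_Mapping.keys (cross n I J')"
      using keys_frag_extend[of "cross n I" "list_boundary J"] by blast
    then show ?thesis using Suc.IH[of M I J'] keys_list_boundary[of J' J] by blast
  qed
  then show ?case using M(2) ne by (simp add: hd_in_set)
qed

text \<open>The apex of every cone is the pair of first vertices. Consequently a further cone over a
  product that still contains both first vertices starts with a repeated vertex.\<close>

lemma keys_cross_hd:
  "L \<in> Poly_Mapping.keys (cross n (i # I) (j # J)) \<Longrightarrow> \<exists>M. L = (i, j) # M"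
proof (cases n)
  case (Suc m)
  assume "L \<in> Poly_Mapping.keys (cross n (i # I) (j # J))"
  then show ?thesis unfolding Suc by (auto simp del: list_boundary.simps dest: keys_cone)
qed (auto split: if_splits)

text \<open>By \<open>boundary_cone\<close> it is enough that the chain being coned off is a cycle.
  In its boundary the double boundaries vanish, and the two mixed terms agree up to exchanging the
  order of summation and carry opposite signs.\<close>

theorem boundary_cross:
  assumes "length I + length J = n + 3" "I \<noteq> []" "J \<noteq> []"
  shows "ordered_boundary (cross (Suc n) I J) =
    frag_extend (\<lambda>I'. cross n I' J) (list_boundary I) +
    frag_cmul ((-1) ^ (length I - 1)) (frag_extend (cross n I) (list_boundary J))"
  using assms
proof (induction n arbitrary: I J)
  case 0
  then consider a b c where "I = [a, b]" "J = [c]" | a b c where "I = [a]" "J = [b, c]"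
    by (cases I; cases J; cases "tl I"; cases "tl J") auto
  then show ?case by cases (simp_all add: frag_extend_diff cone_diff)
next
  case (Suc n)
  define s :: int where "s = (-1) ^ (length I - 1)"
  have ss: "s * s = 1" by (simp add: s_def flip: power_mult_distrib)
  let ?A = "frag_extend (\<lambda>I'. cross (Suc n) I' J) (list_boundary I)"
  let ?B = "frag_extend (cross (Suc n) I) (list_boundary J)"
  have A: "ordered_boundary (cross (Suc n) I' J) = frag_extend (\<lambda>I''. cross n I'' J) (list_boundary I') -
      frag_cmul s (frag_extend (cross n I') (list_boundary J))"
    if "I' \<in> Poly_Mapping.keys (list_boundary I)" for I'
  proof (cases "I' = []")
    case True
    then show ?thesis by (simp add: frag_extend_zero_fun del: cross.simps)
  next
    case False
    have l: "length I = Suc (length I')" using keys_list_boundary[OF that] by simp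
    \<comment> \<open>A face of \<open>I\<close> has one vertex less, so its sign is opposite to
      that of \<open>I\<close>; this causes the cancellation.\<close>
    then have "s = - ((-1) ^ (length I' - 1))" using False by (cases I') (simp_all add: s_def)
    then show ?thesis using Suc.IH[of I' J] Suc.prems l False by (simp del: cross.simps)
  qed
  have B: "ordered_boundary (cross (Suc n) I J') = frag_extend (\<lambda>I'. cross n I' J') (list_boundary I) +
      frag_cmul s (frag_extend (cross n I) (list_boundary J'))"
    if "J' \<in> Poly_Mapping.keys (list_boundary J)" for J'
  proof (cases "J' = []")
    case True
    then show ?thesis by (simp add: frag_extend_zero_fun del: cross.simps)
  next
    case False
    have l: "length J = Suc (length J')" using keys_list_boundary[OF that] by simp
    then show ?thesis using Suc.IH[of I J'] Suc.prems False by (simp add: s_def del: cross.simps)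
  qed
  have "ordered_boundary ?A = frag_extend (\<lambda>I'. frag_extend (\<lambda>I''. cross n I'' J) (list_boundary I') -
      frag_cmul s (frag_extend (cross n I') (list_boundary J))) (list_boundary I)"
    unfolding frag_extend_extend by (rule frag_extend_eq) (rule A)
  also have "\<dots> = frag_extend (\<lambda>I''. cross n I'' J) (ordered_boundary (list_boundary I)) -
      frag_cmul s (frag_extend (\<lambda>I'. frag_extend (cross n I') (list_boundary J)) (list_boundary I))"
    by (simp only: frag_extend_fun_diff frag_extend_fun_cmul frag_extend_extend)
  finally have dA: "ordered_boundary ?A =
      - frag_cmul s (frag_extend (\<lambda>I'. frag_extend (cross n I') (list_boundary J)) (list_boundary I))"
    by (simp add: boundary_list_boundary)
  have "ordered_boundary ?B = frag_extend (\<lambda>J'. frag_extend (\<lambda>I'. cross n I' J') (list_boundary I) +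
      frag_cmul s (frag_extend (cross n I) (list_boundary J'))) (list_boundary J)"
    unfolding frag_extend_extend by (rule frag_extend_eq) (rule B)
  also have "\<dots> = frag_extend (\<lambda>J'. frag_extend (\<lambda>I'. cross n I' J') (list_boundary I)) (list_boundary J) +
      frag_cmul s (frag_extend (cross n I) (ordered_boundary (list_boundary J)))"
    by (simp only: frag_extend_fun_add frag_extend_fun_cmul frag_extend_extend)
  finally have dB: "ordered_boundary ?B =
      frag_extend (\<lambda>I'. frag_extend (cross n I') (list_boundary J)) (list_boundary I)"
    by (simp add: boundary_list_boundary 
        frag_extend_swap[of "cross n" "list_boundary J" "list_boundary I"])
  have "ordered_boundary (?A + frag_cmul s ?B) = 0"
    by (simp only: frag_extend_add frag_extend_cmul dA dB) (simp del: minus_frag_cmul)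
  moreover have "cross (Suc (Suc n)) I J = cone (hd I, hd J) (?A + frag_cmul s ?B)"
    using Suc.prems by (simp add: s_def del: cross.simps(2)[of n])
  ultimately show ?case
    by (simp add: boundary_cone s_def del: cross.simps)
qed

text \<open>Modulo degenerate lists the cross product obeys the recursion of the sum over shuffles.\<close>

lemma cross_nondegenerate:
  assumes deg: "\<And>v M. \<psi> (v # v # M) = 0"
  shows "frag_eval \<psi> (cross (Suc n) (i # I) (j # J)) =
    frag_eval (\<lambda>M. \<psi> ((i, j) # M)) (cross n I (j # J)) +
    (-1) ^ length I * frag_eval (\<lambda>M. \<psi> ((i, j) # M)) (cross n (i # I) J)"
proof -
  let ?\<psi> = "\<lambda>M. \<psi> ((i, j) # M)"
  have 0: "frag_eval ?\<psi> (cross n (i # I') (j # J')) = 0" for I' J'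
  proof -
    have "frag_eval ?\<psi> (cross n (i # I') (j # J')) = frag_eval (\<lambda>_. 0) (cross n (i # I') (j # J'))"
      by (rule frag_eval_cong) (auto dest!: keys_cross_hd simp: deg)
    then show ?thesis by (simp add: frag_eval_zero)
  qed
  have "frag_eval ?\<psi> (frag_extend (\<lambda>I'. cross n I' (j # J)) (list_boundary (i # I))) =
      frag_eval ?\<psi> (cross n I (j # J))"
    by (simp add: frag_extend_diff frag_eval_diff cone_def frag_extend_extend frag_eval_extend 0 frag_eval_zero)
  moreover have "frag_eval ?\<psi> (frag_extend (cross n (i # I)) (list_boundary (j # J))) =
      frag_eval ?\<psi> (cross n (i # I) J)"
    by (simp add: frag_extend_diff frag_eval_diff cone_def frag_extend_extend frag_eval_extend 0 frag_eval_zero)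
  ultimately show ?thesis
    by (simp add: cone_def frag_eval_extend frag_eval_add frag_eval_cmul del: list_boundary.simps)
qed

definition relabel :: "('v \<Rightarrow> 'w) \<Rightarrow> ('v list \<Rightarrow>\<^sub>0 int) \<Rightarrow> ('w list \<Rightarrow>\<^sub>0 int)"
  where "relabel f = frag_extend (\<lambda>L. frag_of (map f L))"

lemma frag_eval_relabel: "frag_eval \<psi> (relabel f c) = frag_eval (\<lambda>L. \<psi> (map f L)) c"
  by (simp add: relabel_def frag_eval_extend)

lemma relabel_cone: "relabel f (cone v c) = cone (f v) (relabel f c)"
  by (simp add: relabel_def cone_def frag_extend_extend)

lemma list_boundary_map: "list_boundary (map f L) = relabel f (list_boundary L)"
  by (induction L) (simp_all add: relabel_cone[unfolded relabel_def] relabel_def frag_extend_diff)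

text \<open>Naturality: the construction involves only first vertices and list boundaries, and both
  commute with relabelling.\<close>

lemma cross_map: "cross n (map f I) (map g J) = relabel (map_prod f g) (cross n I J)"
proof (induction n arbitrary: I J)
  case 0
  then show ?case by (cases I; cases J) (simp_all add: relabel_def)
next
  case (Suc n)
  show ?case
  proof (cases "I = [] \<or> J = []")
    case False
    have "frag_extend (\<lambda>I'. cross n I' (map g J)) (list_boundary (map f I)) =
        relabel (map_prod f g) (frag_extend (\<lambda>I'. cross n I' J) (list_boundary I))"
      by (simp add: list_boundary_map relabel_def frag_extend_extend Suc.IH[unfolded relabel_def])
    moreover have "frag_extend (cross n (map f I)) (list_boundary (map g J)) =
        relabel (map_prod f g) (frag_extend (cross n I) (list_boundary J))"
      by (simp add: list_boundary_map relabel_def frag_extend_extend Suc.IH[unfolded relabel_def])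
    ultimately show ?thesis
      using False by (simp add: relabel_cone hd_map)
        (simp add: relabel_def frag_extend_add frag_extend_cmul)
  qed (auto simp: relabel_def)
qed

section \<open>Evaluation of powers\<close>

text \<open>The iterated front and back faces of an \<open>N\<close>-fold cup product of
  two-dimensional cochains: consecutive triples, each beginning at the last vertex of the one
  before.\<close>

fun list_power :: "('v \<Rightarrow> 'v \<Rightarrow> 'v \<Rightarrow> 'f::comm_ring_1) \<Rightarrow> nat \<Rightarrow> 'v list \<Rightarrow> 'f"
  where
    "list_power w 0 L = 1"
  | "list_power w (Suc N) (a # b # c # L) = w a b c * list_power w N (c # L)"
  | "list_power w (Suc N) L = 0"

text \<open>Repetitions within the first triple are enough, since the evaluation below expands the
  cross product by two steps at a time.\<close>

lemma list_power_degenerate: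
  assumes "\<And>a b. w a a b = 0" "\<And>a b. w a b b = 0"
  shows "list_power w (Suc N) (v # v # M) = 0" "list_power w (Suc N) (u # v # v # M) = 0"
  using assms by (cases M; simp)+

text \<open>A shuffle is a lattice path, whose steps are taken in pairs. A pair with one step in
  each coordinate contributes \<open>0\<close>, as both \<open>w1\<close> and \<open>w2\<close> then
  see a repeated vertex. The other pairs contribute \<open>- w1\<close> or \<open>w2\<close>, and
  their shuffle signs cancel since steps move two at a time. Choosing the pairs that belong to the
  first coordinate gives the binomial coefficient; a coordinate with an odd number of steps admits
  no such pairing.\<close>

lemma frag_eval_power_cross:
  fixes w1 :: "'v \<Rightarrow> 'v \<Rightarrow> 'v \<Rightarrow> 'f::comm_ring_1" and w2 :: "'w \<Rightarrow> 'w \<Rightarrow> 'w \<Rightarrow> 'f"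
  assumes w1: "\<And>a b. w1 a a b = 0" "\<And>a b. w1 a b b = 0"
    and w2: "\<And>a b. w2 a a b = 0" "\<And>a b. w2 a b b = 0"
    and len: "length I + length J = 2 * N + 2" "I \<noteq> []" "J \<noteq> []"
  shows "frag_eval (list_power (\<lambda>x y z. w2 (snd x) (snd y) (snd z) - w1 (fst x) (fst y) (fst z)) N)
      (cross (2 * N) I J) =
    (if odd (length I) then (-1) ^ (length I div 2) * of_nat (N choose (length I div 2)) *
       list_power w1 (length I div 2) I * list_power w2 (length J div 2) J else 0)"
  using len
proof (induction N arbitrary: I J)
  case 0
  then have "length I = 1" "length J = 1" by (cases I; cases J; simp)+
  then show ?case by simp
next
  case (Suc N)
  let ?w = "\<lambda>x y z. w2 (snd x) (snd y) (snd z) - w1 (fst x) (fst y) (fst z)"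
  obtain i I' j J' where IJ: "I = i # I'" "J = j # J'" using Suc.prems by (cases I; cases J) auto
  let ?\<psi> = "list_power ?w (Suc N)" and ?\<psi>1 = "\<lambda>M. list_power ?w (Suc N) ((i, j) # M)"
  have deg: "?\<psi> (v # v # M) = 0" "?\<psi>1 (v # v # M) = 0" for v M
    by (rule list_power_degenerate; simp add: w1 w2)+
  define first where "first = (case I' of i1 # i2 # I3 \<Rightarrow>
      - w1 i i1 i2 * frag_eval (list_power ?w N) (cross (2 * N) (i2 # I3) J) | _ \<Rightarrow> 0)"
  define second where "second = (case J' of j1 # j2 # J3 \<Rightarrow>
      w2 j j1 j2 * frag_eval (list_power ?w N) (cross (2 * N) I (j2 # J3)) | _ \<Rightarrow> 0)"
  have hdw: "frag_eval (\<lambda>M. ?\<psi>1 (v # M)) (cross (2 * N) (a # A) (b # B)) =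
      ?w (i, j) v (a, b) * frag_eval (list_power ?w N) (cross (2 * N) (a # A) (b # B))" for v a b A B
    unfolding frag_eval_scale[symmetric] by (rule frag_eval_cong) (auto dest!: keys_cross_hd)
  have 1: "frag_eval ?\<psi>1 (cross (Suc (2 * N)) I' J) = first"
  proof (cases I')
    case (Cons i1 I2)
    \<comment> \<open>The mixed pair: its value contains the factor
      \<open>w2 j j j1 - w1 i i1 i1\<close>, which is \<open>0\<close>.\<close>
    have "frag_eval (\<lambda>M. ?\<psi>1 ((i1, j) # M)) (cross (2 * N) (i1 # I2) J') = 0"
      by (cases J') (simp_all add: hdw w1 w2 del: list_power.simps)
    moreover have "frag_eval (\<lambda>M. ?\<psi>1 ((i1, j) # M)) (cross (2 * N) I2 J) = first"
      by (cases I2) (simp_all add: hdw w1 w2 first_def Cons IJ del: list_power.simps)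
    ultimately show ?thesis
      unfolding Cons IJ(2) cross_nondegenerate[of ?\<psi>1, OF deg(2)] by (simp add: IJ)
  qed (simp add: first_def del: cross.simps)
  have 2: "frag_eval ?\<psi>1 (cross (Suc (2 * N)) I J') = (-1) ^ length I' * second"
  proof (cases J')
    case (Cons j1 J2)
    have "frag_eval (\<lambda>M. ?\<psi>1 ((i, j1) # M)) (cross (2 * N) I' (j1 # J2)) = 0"
      by (cases I') (simp_all add: hdw w1 w2 del: list_power.simps)
    moreover have "frag_eval (\<lambda>M. ?\<psi>1 ((i, j1) # M)) (cross (2 * N) I J2) = second"
      by (cases J2) (simp_all add: hdw w1 w2 second_def Cons IJ del: list_power.simps)
    ultimately show ?thesis
      unfolding Cons IJ(1) cross_nondegenerate[of ?\<psi>1, OF deg(2)] by (simp add: IJ)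
  qed (simp add: second_def del: cross.simps)
  have "frag_eval ?\<psi> (cross (Suc (Suc (2 * N))) I J) = first + (-1) ^ length I' * ((-1) ^ length I' * second)"
    using 1 2 unfolding IJ cross_nondegenerate[of ?\<psi>, OF deg(1)] by (simp only: IJ)
  then have val: "frag_eval ?\<psi> (cross (2 * Suc N) I J) = first + second"
    by (simp add: mult.assoc[symmetric] power_mult_distrib[symmetric] del: cross.simps)
  show ?case
  proof (cases "odd (length I)")
    case True
    then obtain a where a: "length I = 2 * a + 1" by (auto elim: oddE)
    then obtain b where b: "length J = 2 * b + 1" "a + b = Suc N" using Suc.prems by (intro that[of "Suc N - a"]) auto
    have f: "first = (if a = 0 then 0 else
        (-1) ^ a * of_nat (N choose (a - 1)) * list_power w1 a I * list_power w2 b J)"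
    proof (cases a)
      case (Suc a')
      then obtain i1 i2 I3 where I': "I' = i1 # i2 # I3" "length I3 = 2 * a'"
        using a IJ by (auto simp: length_Suc_conv)
      then show ?thesis
        using Suc.IH[of "i2 # I3" J] b Suc IJ by (simp add: first_def algebra_simps)
    qed (use a IJ in \<open>simp add: first_def\<close>)
    have s: "second = (if b = 0 then 0 else
        (-1) ^ a * of_nat (N choose a) * list_power w1 a I * list_power w2 b J)"
    proof (cases b)
      case (Suc b')
      then obtain j1 j2 J3 where J': "J' = j1 # j2 # J3" "length J3 = 2 * b'"
        using b IJ by (auto simp: length_Suc_conv)
      then show ?thesis
        using Suc.IH[of I "j2 # J3"] a b Suc IJ by (simp add: second_def algebra_simps)
    qed (use b IJ in \<open>simp add: second_def\<close>)
    \<comment> \<open>Pascal's rule: the first pair of steps lies in the first or in the second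
      coordinate. The cases \<open>a = 0\<close> and \<open>b = 0\<close> allow only one of
      these.\<close>
    have "(of_nat (Suc N choose a) :: 'f) = (if a = 0 then 0 else of_nat (N choose (a - 1))) +
        (if b = 0 then 0 else of_nat (N choose a))"
      using b(2) by (cases a; cases b) (simp_all add: binomial_eq_0)
    then show ?thesis
      unfolding val f s using a b by (simp add: algebra_simps)
  next
    case False
    have "first = 0"
      using Suc.IH[of "drop 2 I" J] Suc.prems False IJ
      by (auto simp: first_def split: list.splits)
    moreover have "second = 0"
      using Suc.IH[of I "drop 2 J"] Suc.prems False IJ
      by (auto simp: second_def split: list.splits)
    ultimately show ?thesis using val False by simp
  qed
qed

section \<open>Affine subsimplices of singular simplices\<close>

text \<open>Pushforward of barycentric coordinates along the map from positions to entries of the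
  list, that is, the affine map sending vertex \<open>j\<close> to vertex \<open>L ! j\<close>.
  Repeated entries add their coordinates and give degenerate simplices.\<close>

primrec vertex_sum :: "'v list \<Rightarrow> (nat \<Rightarrow> real) \<Rightarrow> 'v \<Rightarrow> real"
  where
    "vertex_sum [] x = (\<lambda>_. 0)"
  | "vertex_sum (v # L) x = (\<lambda>i. (if v = i then x 0 else 0) + vertex_sum L (\<lambda>j. x (Suc j)) i)"

lemma vertex_sum_eq: "vertex_sum L x i = (\<Sum>j<length L. if L ! j = i then x j else 0)"
  by (induction L arbitrary: x) (simp_all add: sum.lessThan_Suc_shift del: sum.lessThan_Suc)

lemma vertex_sum_in_standard_simplex:
  assumes L: "L \<noteq> []" "set L \<subseteq> {..p}" and x: "x \<in> standard_simplex (length L - 1)"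
  shows "vertex_sum L x \<in> standard_simplex p"
proof -
  have ne: "Suc (length L - 1) = length L" using L(1) by (cases L) auto
  have x0: "0 \<le> x j" for j using x by (simp add: standard_simplex_def)
  have x1: "(\<Sum>j<length L. x j) = 1"
  proof -
    have "{..<length L} = {..length L - 1}" using ne lessThan_Suc_atMost by metis
    then show ?thesis using x by (simp add: standard_simplex_def)
  qed
  have le: "vertex_sum L x i \<le> 1" for i
    unfolding vertex_sum_eq x1[symmetric] by (rule sum_mono) (auto simp: x0)
  have "vertex_sum L x i = 0" if "i > p" for i
    unfolding vertex_sum_eq
  proof (rule sum.neutral, rule ballI)
    fix j assume "j \<in> {..<length L}"
    then have "L ! j \<in> {..p}" using L(2) nth_mem by blast
    then show "(if L ! j = i then x j else 0) = 0" using that by auto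
  qed
  moreover have "(\<Sum>i\<le>p. vertex_sum L x i) = (\<Sum>j<length L. \<Sum>i\<le>p. if L ! j = i then x j else 0)"
    unfolding vertex_sum_eq by (rule sum.swap)
  moreover have "\<dots> = (\<Sum>j<length L. x j)"
    by (rule sum.cong) (use L(2) in \<open>auto simp: sum.delta' subset_iff\<close>)
  ultimately show ?thesis
    using le x1 by (simp add: standard_simplex_def vertex_sum_eq sum_nonneg x0)
qed

lemma continuous_map_vertex_sum: "continuous_map (powertop_real UNIV) (powertop_real UNIV) (vertex_sum L)"
proof -
  have "continuous_map (powertop_real UNIV) euclideanreal (\<lambda>x. if L ! j = i then x j else 0)" for i j
    by (cases "L ! j = i") (auto intro: continuous_map_product_projection)
  then show ?thesis
    unfolding continuous_map_componentwise_UNIV vertex_sum_eq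
    by (intro allI continuous_map_sum) auto
qed

text \<open>A face map inserts the coordinate \<open>0\<close> at position \<open>k\<close>, so the
  entry of the list at that position has no effect and can be removed.\<close>

lemma vertex_sum_face:
  "k < length L \<Longrightarrow> vertex_sum L (simplical_face k x) = vertex_sum (take k L @ drop (Suc k) L) x"
proof (induction L arbitrary: k x)
  case (Cons v L)
  show ?case
  proof (cases k)
    case 0
    then show ?thesis by (simp add: simplical_face_def)
  next
    case (Suc k')
    have tail: "(\<lambda>j. simplical_face (Suc k') x (Suc j)) = simplical_face k' (\<lambda>j. x (Suc j))"
      by (auto simp: simplical_face_def fun_eq_iff)
    have head: "simplical_face (Suc k') x 0 = x 0" by (simp add: simplical_face_def)
    have IH: "vertex_sum L (simplical_face k' (\<lambda>j. x (Suc j))) =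
        vertex_sum (take k' L @ drop (Suc k') L) (\<lambda>j. x (Suc j))"
      using Cons Suc by simp
    show ?thesis
      unfolding Suc vertex_sum.simps tail head IH by simp
  qed
qed simp

lemma vertex_sum_add: "vertex_sum L (\<lambda>j. x j + y j) i = vertex_sum L x i + vertex_sum L y i"
  unfolding vertex_sum_eq sum.distrib[symmetric] by (rule sum.cong) auto

lemma vertex_sum_single:
  assumes "m < length L"
  shows "vertex_sum L (\<lambda>j. if m = j then c else 0) i = (if L ! m = i then c else 0)"
proof -
  have "vertex_sum L (\<lambda>j. if m = j then c else 0) i = (\<Sum>j<length L. if m = j then (if L ! j = i then c else 0) else 0)"
    unfolding vertex_sum_eq by (rule sum.cong) auto
  then show ?thesis using assms by (simp add: sum.delta)
qed

lemma vertex_sum_vertex_sum: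
  "set M \<subseteq> {..<length L} \<Longrightarrow> vertex_sum L (vertex_sum M x) = vertex_sum (map ((!) L) M) x"
proof (induction M arbitrary: x)
  case Nil
  then show ?case by (simp add: vertex_sum_eq fun_eq_iff)
next
  case (Cons m M)
  then show ?case by (simp add: vertex_sum_add vertex_sum_single fun_eq_iff)
qed

lemma vertex_sum_upt:
  assumes "\<And>j. j \<ge> n \<Longrightarrow> x j = 0"
  shows "vertex_sum [0..<n] x = x"
proof
  fix i
  have "vertex_sum [0..<n] x i = (\<Sum>j<n. if j = i then x j else 0)"
    unfolding vertex_sum_eq by (rule sum.cong) auto
  then show "vertex_sum [0..<n] x i = x i" using assms by (simp add: sum.delta')
qed

lemma vertex_sum_shift:
  "vertex_sum L (\<lambda>i. if i < p then 0 else x (i - p)) = vertex_sum (drop p L) x"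
proof (induction p arbitrary: L)
  case 0
  then show ?case by simp
next
  case (Suc p)
  show ?case
  proof (cases L)
    case (Cons v M)
    have "(\<lambda>j. if Suc j < Suc p then 0 else x (Suc j - Suc p)) = (\<lambda>i. if i < p then 0 else x (i - p))"
      by auto
    then show ?thesis using Suc[of M] Cons by simp
  qed simp
qed

definition subsimplex :: "((nat \<Rightarrow> real) \<Rightarrow> 'a) \<Rightarrow> nat list \<Rightarrow> (nat \<Rightarrow> real) \<Rightarrow> 'a"
  where "subsimplex \<sigma> L = restrict (\<lambda>x. \<sigma> (vertex_sum L x)) (standard_simplex (length L - 1))"

lemma singular_simplex_subsimplex:
  assumes \<sigma>: "singular_simplex p X \<sigma>" and L: "L \<noteq> []" "set L \<subseteq> {..p}"
  shows "singular_simplex (length L - 1) X (subsimplex \<sigma> L)"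
proof -
  have "continuous_map (subtopology (powertop_real UNIV) (standard_simplex (length L - 1)))
      (subtopology (powertop_real UNIV) (standard_simplex p)) (vertex_sum L)"
  proof (rule continuous_map_into_subtopology)
    show "vertex_sum L \<in> topspace (subtopology (powertop_real UNIV) (standard_simplex (length L - 1))) \<rightarrow> standard_simplex p"
      using vertex_sum_in_standard_simplex[OF L] by simp
  qed (intro continuous_map_from_subtopology continuous_map_vertex_sum)
  from continuous_map_compose[OF this, of X \<sigma>] \<sigma>
  have "continuous_map (subtopology (powertop_real UNIV) (standard_simplex (length L - 1))) X (\<sigma> \<circ> vertex_sum L)"
    by (simp add: singular_simplex_def)
  then show ?thesis
    by (auto simp: singular_simplex_def subsimplex_def o_def intro: continuous_map_eq)
qed

lemma subsimplex_face:
  assumes "k \<le> Suc n"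
  shows "singular_face (Suc n) k \<sigma> = subsimplex \<sigma> (take k [0..<Suc (Suc n)] @ drop (Suc k) [0..<Suc (Suc n)])"
proof -
  have "vertex_sum (take k [0..<Suc (Suc n)] @ drop (Suc k) [0..<Suc (Suc n)]) x = simplical_face k x"
    if "x \<in> standard_simplex n" for x
  proof -
    have "simplical_face k x \<in> standard_simplex (Suc n)"
      using that assms simplical_face_in_standard_simplex[of "Suc n" k x] by simp
    then have "vertex_sum [0..<Suc (Suc n)] (simplical_face k x) = simplical_face k x"
      by (intro vertex_sum_upt) (auto simp: standard_simplex_def)
    then show ?thesis using assms by (subst vertex_sum_face[symmetric]) (simp_all del: upt_Suc)
  qed
  then have "restrict (\<sigma> \<circ> simplical_face k) (standard_simplex n) = restrict (\<lambda>x. \<sigma> (vertex_sum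
      (take k [0..<Suc (Suc n)] @ drop (Suc k) [0..<Suc (Suc n)]) x)) (standard_simplex n)"
    by (intro restrict_ext) (simp only: o_apply)
  moreover have "length (take k [0..<Suc (Suc n)] @ drop (Suc k) [0..<Suc (Suc n)]) - 1 = n"
    using assms by (simp del: upt_Suc)
  ultimately show ?thesis
    by (simp only: singular_face_def subsimplex_def diff_Suc_1 diff_Suc_Suc diff_zero)
qed

lemma subsimplex_front: "front_face p \<sigma> = subsimplex \<sigma> [0..<Suc p]"
proof -
  have "vertex_sum [0..<Suc p] x = x" if "x \<in> standard_simplex p" for x
    by (rule vertex_sum_upt) (use that in \<open>auto simp: standard_simplex_def\<close>)
  then have "restrict \<sigma> (standard_simplex p) = restrict (\<lambda>x. \<sigma> (vertex_sum [0..<Suc p] x)) (standard_simplex p)"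
    by (intro restrict_ext) (simp only:)
  then show ?thesis by (simp add: front_face_def subsimplex_def del: upt_Suc)
qed

lemma subsimplex_back: "back_face p q \<sigma> = subsimplex \<sigma> [p..<Suc (p + q)]"
proof -
  have "vertex_sum [p..<Suc (p + q)] x = (\<lambda>i. if i < p then 0 else x (i - p))" if "x \<in> standard_simplex q" for x
  proof -
    have "vertex_sum [0..<Suc (p + q)] (\<lambda>i. if i < p then 0 else x (i - p)) = (\<lambda>i. if i < p then 0 else x (i - p))"
      by (rule vertex_sum_upt) (use that in \<open>auto simp: standard_simplex_def\<close>)
    then show ?thesis unfolding vertex_sum_shift by (simp del: upt_Suc)
  qed
  then have "restrict (\<lambda>x. \<sigma> (\<lambda>i. if i < p then 0 else x (i - p))) (standard_simplex q) =
      restrict (\<lambda>x. \<sigma> (vertex_sum [p..<Suc (p + q)] x)) (standard_simplex q)"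
    by (intro restrict_ext) (simp only:)
  then show ?thesis by (simp add: back_face_def subsimplex_def del: upt_Suc)
qed

lemma subsimplex_id:
  assumes "singular_simplex p X \<sigma>"
  shows "subsimplex \<sigma> [0..<Suc p] = \<sigma>"
  using assms by (simp flip: subsimplex_front add: front_face_def singular_simplex_def extensional_restrict del: upt_Suc)

text \<open>Common ground for the affine subsimplices of one singular simplex and the simplices of a
  product of two. In such a family coboundary, cup product and degeneracy become operations on lists
  of vertices.\<close>

definition simplex_family :: "'a topology \<Rightarrow> 'v set \<Rightarrow> ('v list \<Rightarrow> (nat \<Rightarrow> real) \<Rightarrow> 'a) \<Rightarrow> bool"
  where "simplex_family X V r \<longleftrightarrow>
    (\<forall>L. L \<noteq> [] \<and> set L \<subseteq> V \<longrightarrow> singular_simplex (length L - 1) X (r L) \<and>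
      (\<forall>M. M \<noteq> [] \<and> set M \<subseteq> {..<length L} \<longrightarrow> subsimplex (r L) M = r (map ((!) L) M)))"

lemma subsimplex_subsimplex:
  assumes "M \<noteq> []" "set M \<subseteq> {..<length L}"
  shows "subsimplex (subsimplex \<sigma> L) M = subsimplex \<sigma> (map ((!) L) M)"
proof -
  have "L \<noteq> []" using assms by (cases M) auto
  have "vertex_sum M x \<in> standard_simplex (length L - 1)" if "x \<in> standard_simplex (length M - 1)" for x
    by (rule vertex_sum_in_standard_simplex[OF assms(1) _ that]) (use assms(2) in fastforce)
  then have "restrict (\<lambda>x. restrict (\<lambda>x. \<sigma> (vertex_sum L x)) (standard_simplex (length L - 1)) (vertex_sum M x))
      (standard_simplex (length M - 1)) =
    restrict (\<lambda>x. \<sigma> (vertex_sum (map ((!) L) M) x)) (standard_simplex (length M - 1))"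
    by (intro restrict_ext) (simp only: restrict_apply if_True vertex_sum_vertex_sum[OF assms(2)])
  then show ?thesis
    by (simp only: subsimplex_def length_map)
qed

lemma simplex_family_subsimplex:
  "singular_simplex p X \<sigma> \<Longrightarrow> simplex_family X {..p} (subsimplex \<sigma>)"
  by (auto simp: simplex_family_def singular_simplex_subsimplex subsimplex_subsimplex simp del: One_nat_def)

text \<open>The list spans an affine simplex in a product of two standard simplices; this is its
  composition with the product map of \<open>\<sigma>\<close> and \<open>\<tau>\<close>.\<close>

definition pair_simplex :: "((nat \<Rightarrow> real) \<Rightarrow> 'a) \<Rightarrow> ((nat \<Rightarrow> real) \<Rightarrow> 'b) \<Rightarrow> (nat \<times> nat) list \<Rightarrow>
    (nat \<Rightarrow> real) \<Rightarrow> 'a \<times> 'b"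
  where "pair_simplex \<sigma> \<tau> L = restrict (\<lambda>x. (subsimplex \<sigma> (map fst L) x, subsimplex \<tau> (map snd L) x))
    (standard_simplex (length L - 1))"

lemma simplex_family_pair:
  assumes \<sigma>: "singular_simplex p X \<sigma>" and \<tau>: "singular_simplex q Y \<tau>"
  shows "simplex_family (prod_topology X Y) ({..p} \<times> {..q}) (pair_simplex \<sigma> \<tau>)"
  unfolding simplex_family_def
proof (intro allI impI conjI)
  fix L :: "(nat \<times> nat) list" assume L: "L \<noteq> [] \<and> set L \<subseteq> {..p} \<times> {..q}"
  then have L1: "map fst L \<noteq> []" "set (map fst L) \<subseteq> {..p}" and L2: "map snd L \<noteq> []" "set (map snd L) \<subseteq> {..q}"
    by auto
  have "continuous_map (subtopology (powertop_real UNIV) (standard_simplex (length L - 1))) (prod_topology X Y)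
      (\<lambda>x. (subsimplex \<sigma> (map fst L) x, subsimplex \<tau> (map snd L) x))"
    using singular_simplex_subsimplex[OF \<sigma> L1] singular_simplex_subsimplex[OF \<tau> L2]
    by (auto simp: singular_simplex_def intro!: continuous_map_pairedI)
  then show "singular_simplex (length L - 1) (prod_topology X Y) (pair_simplex \<sigma> \<tau> L)"
    by (auto simp: singular_simplex_def pair_simplex_def intro: continuous_map_eq)
  fix M assume M: "M \<noteq> [] \<and> set M \<subseteq> {..<length L}"
  have "vertex_sum M x \<in> standard_simplex (length L - 1)" if "x \<in> standard_simplex (length M - 1)" for x
    by (rule vertex_sum_in_standard_simplex[OF _ _ that]) (use M in fastforce)+
  moreover have "map fst (map ((!) L) M) = map ((!) (map fst L)) M" "map snd (map ((!) L) M) = map ((!) (map snd L)) M"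
    using M by auto
  moreover have "subsimplex (subsimplex \<sigma> (map fst L)) M = subsimplex \<sigma> (map ((!) (map fst L)) M)"
    "subsimplex (subsimplex \<tau> (map snd L)) M = subsimplex \<tau> (map ((!) (map snd L)) M)"
    using M by (auto intro!: subsimplex_subsimplex)
  then have "subsimplex \<sigma> (map fst L) (vertex_sum M x) = subsimplex \<sigma> (map ((!) (map fst L)) M) x"
    "subsimplex \<tau> (map snd L) (vertex_sum M x) = subsimplex \<tau> (map ((!) (map snd L)) M) x"
    if "x \<in> standard_simplex (length M - 1)" for x
    using that unfolding subsimplex_def[of "subsimplex _ _"] by (metis restrict_apply')+
  ultimately have "restrict (\<lambda>x. restrict (\<lambda>x. (subsimplex \<sigma> (map fst L) x, subsimplex \<tau> (map snd L) x))
        (standard_simplex (length L - 1)) (vertex_sum M x)) (standard_simplex (length M - 1)) =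
      restrict (\<lambda>x. (subsimplex \<sigma> (map fst (map ((!) L) M)) x, subsimplex \<tau> (map snd (map ((!) L) M)) x))
        (standard_simplex (length M - 1))"
    by (intro restrict_ext) (simp only: restrict_apply if_True)
  then show "subsimplex (pair_simplex \<sigma> \<tau> L) M = pair_simplex \<sigma> \<tau> (map ((!) L) M)"
    by (simp only: pair_simplex_def subsimplex_def[of "restrict _ _" M] length_map)
qed

lemma simplex_familyD:
  assumes "simplex_family X V r" "L \<noteq> []" "set L \<subseteq> V"
  shows "singular_simplex (length L - 1) X (r L)"
    and "M \<noteq> [] \<Longrightarrow> set M \<subseteq> {..<length L} \<Longrightarrow> subsimplex (r L) M = r (map ((!) L) M)"
  using assms unfolding simplex_family_def by blast+

text \<open>Singular faces of a member of the family are the members for the lists with one entry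
  deleted.\<close>

lemma coboundary_family:
  assumes r: "simplex_family X V r" and L: "length L = Suc (Suc p)" "set L \<subseteq> V"
  shows "coboundary p X \<phi> (r L) = frag_eval (\<lambda>M. \<phi> (r M)) (list_boundary L)"
proof -
  have ne: "L \<noteq> []" using L by auto
  have face: "singular_face (Suc p) k (r L) = r (take k L @ drop (Suc k) L)" if "k \<le> Suc p" for k
  proof -
    let ?M = "take k [0..<Suc (Suc p)] @ drop (Suc k) [0..<Suc (Suc p)]"
    have "singular_face (Suc p) k (r L) = subsimplex (r L) ?M"
      by (rule subsimplex_face[OF that])
    also have "\<dots> = r (map ((!) L) ?M)"
      by (rule simplex_familyD(2)[OF r ne L(2)])
        (use that L in \<open>auto simp del: upt_Suc dest: in_set_takeD in_set_dropD\<close>)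
    also have "map ((!) L) ?M = take k (map ((!) L) [0..<length L]) @ drop (Suc k) (map ((!) L) [0..<length L])"
      unfolding L(1) by (simp add: take_map drop_map del: upt_Suc)
    finally show ?thesis by (simp add: map_nth)
  qed
  have "singular_simplex (Suc p) X (r L)"
    using simplex_familyD(1)[OF r ne L(2)] L(1) by simp
  then have "coboundary p X \<phi> (r L) = (\<Sum>k\<le>Suc p. (-1) ^ k * \<phi> (r (take k L @ drop (Suc k) L)))"
    by (simp add: coboundary_def face del: sum.atMost_Suc)
  also have "\<dots> = frag_eval (\<lambda>M. \<phi> (r M)) (list_boundary L)"
    unfolding list_boundary_sum frag_eval_sum L(1) lessThan_Suc_atMost
    by (simp add: frag_eval_cmul del: sum.atMost_Suc)
  finally show ?thesis .
qed

lemma coboundary_family_chain: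
  assumes r: "simplex_family X V r"
    and c: "\<And>L. L \<in> Poly_Mapping.keys c \<Longrightarrow> length L = Suc (Suc p) \<and> set L \<subseteq> V"
  shows "frag_eval (\<lambda>L. coboundary p X \<phi> (r L)) c = frag_eval (\<lambda>M. \<phi> (r M)) (ordered_boundary c)"
  unfolding frag_eval_extend by (rule frag_eval_cong) (use coboundary_family[OF r] c in blast)

lemma cochain_cup_family:
  assumes r: "simplex_family X V r" and L: "length L = Suc (p + q)" "set L \<subseteq> V"
  shows "cochain_cup p q X \<phi> \<psi> (r L) = \<phi> (r (take (Suc p) L)) * \<psi> (r (drop p L))"
proof -
  have ne: "L \<noteq> []" using L by auto
  have m: "map ((!) L) [0..<length L] = L" by (rule map_nth)
  have "front_face p (r L) = r (map ((!) L) [0..<Suc p])"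
    unfolding subsimplex_front by (rule simplex_familyD(2)[OF r ne L(2)]) (use L in auto)
  also have "map ((!) L) [0..<Suc p] = take (Suc p) (map ((!) L) [0..<length L])"
    using L(1) by (simp add: take_map del: upt_Suc)
  finally have f: "front_face p (r L) = r (take (Suc p) L)" unfolding m .
  have "back_face p q (r L) = r (map ((!) L) [p..<Suc (p + q)])"
    unfolding subsimplex_back by (rule simplex_familyD(2)[OF r ne L(2)]) (use L in auto)
  also have "map ((!) L) [p..<Suc (p + q)] = drop p (map ((!) L) [0..<length L])"
    using L(1) by (simp add: drop_map del: upt_Suc)
  finally have b: "back_face p q (r L) = r (drop p L)" unfolding m .
  have "singular_simplex (p + q) X (r L)"
    using simplex_familyD(1)[OF r ne L(2)] L(1) by simp
  then show ?thesis by (simp add: cochain_cup_def f b)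
qed

primrec cochain_power :: "'a topology \<Rightarrow> ('a, 'f::comm_ring_1) cochain \<Rightarrow> nat \<Rightarrow> ('a, 'f) cochain"
  where
    "cochain_power X u 0 = unit_cochain X"
  | "cochain_power X u (Suc n) = cochain_cup (2 * n) 2 X (cochain_power X u n) u"

text \<open>\<open>list_power\<close> splits off the first triple, which suits the cross product,
  whereas the cup power multiplies by its last factor; this lemma reconciles the two.\<close>

lemma list_power_snoc:
  "length L = 2 * N + 3 \<Longrightarrow> list_power w (Suc N) L =
    list_power w N (take (Suc (2 * N)) L) * w (L ! (2 * N)) (L ! Suc (2 * N)) (L ! Suc (Suc (2 * N)))"
proof (induction N arbitrary: L)
  case 0
  then obtain a b c where "L = [a, b, c]" by (auto simp: length_Suc_conv eval_nat_numeral)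
  then show ?case by simp
next
  case (Suc N)
  then obtain a b c M where L: "L = a # b # c # M" "length (c # M) = 2 * N + 3"
    by (auto simp: length_Suc_conv eval_nat_numeral)
  have "list_power w (Suc (Suc N)) L = w a b c * list_power w (Suc N) (c # M)" by (simp add: L)
  then show ?case using Suc.IH[OF L(2)] by (simp add: L mult.assoc)
qed

lemma cochain_power_family:
  assumes r: "simplex_family X V r" and w: "\<And>a b c. {a, b, c} \<subseteq> V \<Longrightarrow> u (r [a, b, c]) = w a b c"
  shows "length L = Suc (2 * N) \<Longrightarrow> set L \<subseteq> V \<Longrightarrow> cochain_power X u N (r L) = list_power w N L"
proof (induction N arbitrary: L)
  case 0
  then have "L \<noteq> []" by auto
  from simplex_familyD(1)[OF r this] 0 show ?case by (simp add: unit_cochain_def)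
next
  case (Suc N)
  have d: "drop (2 * N) L = [L ! (2 * N), L ! Suc (2 * N), L ! Suc (Suc (2 * N))]"
    using Suc.prems(1) by (simp add: Cons_nth_drop_Suc[symmetric])
  have "cochain_power X u (Suc N) (r L) = cochain_power X u N (r (take (Suc (2 * N)) L)) * u (r (drop (2 * N) L))"
    using Suc.prems by (simp add: cochain_cup_family[OF r])
  also have "u (r (drop (2 * N) L)) = w (L ! (2 * N)) (L ! Suc (2 * N)) (L ! Suc (Suc (2 * N)))"
    unfolding d using Suc.prems by (intro w) (auto simp: subset_iff)
  also have "cochain_power X u N (r (take (Suc (2 * N)) L)) = list_power w N (take (Suc (2 * N)) L)"
    using Suc.prems by (intro Suc.IH) (auto dest: in_set_takeD)
  finally show ?case using list_power_snoc[of L N w] Suc.prems(1) by simp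
qed

section \<open>Normalized cochains\<close>

text \<open>Vanishing on the two degenerate triangles over each edge. In a family this becomes
  vanishing on \<open>[a, a, b]\<close> and \<open>[a, b, b]\<close>, exactly what the shuffle count
  asks of \<open>w1\<close> and \<open>w2\<close>.\<close>

definition normalized :: "'a topology \<Rightarrow> ('a, 'f::comm_ring_1) cochain \<Rightarrow> bool"
  where "normalized X u \<longleftrightarrow> (\<forall>\<rho>. singular_simplex 1 X \<rho> \<longrightarrow>
    u (subsimplex \<rho> [0, 0, 1]) = 0 \<and> u (subsimplex \<rho> [0, 1, 1]) = 0)"

lemma normalized_family:
  assumes r: "simplex_family X V r" and u: "normalized X u" and "{a, b} \<subseteq> V"
  shows "u (r [a, a, b]) = 0" "u (r [a, b, b]) = 0"
proof -
  have "singular_simplex 1 X (r [a, b])"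
    using simplex_familyD(1)[OF r, of "[a, b]"] assms(3) by simp
  moreover have "subsimplex (r [a, b]) [0, 0, 1] = r [a, a, b]" "subsimplex (r [a, b]) [0, 1, 1] = r [a, b, b]"
    using simplex_familyD(2)[OF r, of "[a, b]"] assms(3) by simp_all
  ultimately show "u (r [a, a, b]) = 0" "u (r [a, b, b]) = 0"
    using u unfolding normalized_def by metis+
qed

lemma normalized_pullback:
  assumes f: "continuous_map Y X f" and u: "normalized X u"
  shows "normalized Y (cochain_pullback 2 Y f u)"
  unfolding normalized_def
proof (intro allI impI)
  fix \<rho> assume \<rho>: "singular_simplex 1 Y \<rho>"
  have sub: "singular_simplex 2 Y (subsimplex \<rho> L)" "simplex_map 2 f (subsimplex \<rho> L) = subsimplex (simplex_map 1 f \<rho>) L"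
    if L: "length L = 3" "set L \<subseteq> {..1}" for L
  proof -
    have ne: "L \<noteq> []" using L(1) by auto
    show "singular_simplex 2 Y (subsimplex \<rho> L)"
      using singular_simplex_subsimplex[OF \<rho> ne L(2)] L(1) by simp
    show "simplex_map 2 f (subsimplex \<rho> L) = subsimplex (simplex_map 1 f \<rho>) L"
    proof -
      have *: "length L - 1 = 2" using L(1) by simp
      have "restrict (f \<circ> restrict (\<lambda>x. \<rho> (vertex_sum L x)) (standard_simplex 2)) (standard_simplex 2) =
          restrict (\<lambda>x. restrict (f \<circ> \<rho>) (standard_simplex 1) (vertex_sum L x)) (standard_simplex 2)"
        using vertex_sum_in_standard_simplex[OF ne L(2)] *
        by (intro restrict_ext) (simp only: restrict_apply o_apply if_True)
      then show ?thesis by (simp only: simplex_map_def subsimplex_def *)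
    qed
  qed
  have "singular_simplex 1 X (simplex_map 1 f \<rho>)"
    by (rule singular_simplex_simplex_map[OF \<rho> f])
  then show "cochain_pullback 2 Y f u (subsimplex \<rho> [0, 0, 1]) = 0 \<and>
      cochain_pullback 2 Y f u (subsimplex \<rho> [0, 1, 1]) = 0"
    using u by (simp add: cochain_pullback_def sub normalized_def)
qed

text \<open>The cocycle condition on \<open>[0, 0, 0, 1]\<close> and \<open>[0, 1, 1, 1]\<close> shows that a 2-cocycle is determined
  on degenerate simplices by its values on constant ones; the coboundary of \<open>\<rho> \<mapsto> u (\<rho>[0, 0, 0])\<close>
  is \<open>\<sigma> \<mapsto> u (\<sigma>[1, 1, 1])\<close>.\<close>

lemma normalized_representative:
  fixes u :: "('a, 'f::comm_ring_1) cochain"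
  assumes u: "singular_cocycle 2 X u"
  obtains \<beta> where "singular_coboundary 2 X \<beta>" "normalized X (\<lambda>\<sigma>. \<beta> \<sigma> + u \<sigma>)"
proof -
  define h where "h \<rho> = (if singular_simplex 1 X \<rho> then - u (subsimplex \<rho> [0, 0, 0]) else 0)" for \<rho>
  have cob: "coboundary 1 X h (subsimplex \<rho> [a, b, c]) = - u (subsimplex \<rho> [b, b, b])"
    if \<rho>: "singular_simplex p X \<rho>" and abc: "a \<le> p" "b \<le> p" "c \<le> p" for p \<rho> a b c
  proof -
    have fam: "simplex_family X {..p} (subsimplex \<rho>)" by (rule simplex_family_subsimplex[OF \<rho>])
    have "h (subsimplex \<rho> [x, y]) = - u (subsimplex \<rho> [x, x, x])" if "x \<le> p" "y \<le> p" for x y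
      using simplex_familyD[OF fam, of "[x, y]"] that
      by (simp add: h_def)
    then show ?thesis
      using coboundary_family[OF fam, of "[a, b, c]" 1 h] abc
      by (simp add: frag_eval_diff cone_diff)
  qed
  have cyc: "u (subsimplex \<rho> [b, c, d]) - u (subsimplex \<rho> [a, c, d]) + u (subsimplex \<rho> [a, b, d]) - u (subsimplex \<rho> [a, b, c]) = 0"
    if \<rho>: "singular_simplex p X \<rho>" and abc: "a \<le> p" "b \<le> p" "c \<le> p" "d \<le> p" for p \<rho> a b c d
  proof -
    have fam: "simplex_family X {..p} (subsimplex \<rho>)" by (rule simplex_family_subsimplex[OF \<rho>])
    have "coboundary 2 X u (subsimplex \<rho> [a, b, c, d]) = 0"
      using u by (simp add: singular_cocycle_def)
    then show ?thesis
      using coboundary_family[OF fam, of "[a, b, c, d]" 2 u] abc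
      by (simp add: frag_eval_diff cone_diff)
  qed
  show thesis
  proof (rule that)
    show "singular_coboundary 2 X (coboundary 1 X h)"
      unfolding numeral_2_eq_2 singular_coboundary_Suc
      by (intro exI[of _ h]) (simp add: singular_cochain_def h_def)
    show "normalized X (\<lambda>\<sigma>. coboundary 1 X h \<sigma> + u \<sigma>)"
      unfolding normalized_def
    proof (intro allI impI conjI)
      fix \<rho> assume \<rho>: "singular_simplex 1 X \<rho>"
      show "coboundary 1 X h (subsimplex \<rho> [0, 0, 1]) + u (subsimplex \<rho> [0, 0, 1]) = 0"
        using cob[OF \<rho>, of 0 0 1] cyc[OF \<rho>, of 0 0 0 1] by simp
      show "coboundary 1 X h (subsimplex \<rho> [0, 1, 1]) + u (subsimplex \<rho> [0, 1, 1]) = 0"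
        using cob[OF \<rho>, of 0 1 1] cyc[OF \<rho>, of 0 1 1 1] by simp
    qed
  qed
qed

section \<open>Evaluating cochains on the cross product of two singular simplices\<close>

definition cross_eval :: "('a \<times> 'b, 'f::comm_ring_1) cochain \<Rightarrow> nat \<Rightarrow> nat \<Rightarrow>
    ((nat \<Rightarrow> real) \<Rightarrow> 'a) \<Rightarrow> ((nat \<Rightarrow> real) \<Rightarrow> 'b) \<Rightarrow> 'f"
  where "cross_eval \<phi> p q \<sigma> \<tau> =
    frag_eval (\<lambda>L. \<phi> (pair_simplex \<sigma> \<tau> L)) (cross (p + q) [0..<Suc p] [0..<Suc q])"

lemma keys_cross:
  assumes "L \<in> Poly_Mapping.keys (cross n I J)"
  shows "L \<noteq> []" "length L = Suc n" "set L \<subseteq> set I \<times> set J"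
  using keys_cross_length[OF assms] keys_cross_set[OF assms] by auto

lemma pair_simplex_reindex:
  assumes "L \<noteq> []" "set L \<subseteq> {..<length K} \<times> {..<length M}"
  shows "pair_simplex (subsimplex \<sigma> K) (subsimplex \<tau> M) L = pair_simplex \<sigma> \<tau> (map (map_prod ((!) K) ((!) M)) L)"
proof -
  have "subsimplex (subsimplex \<sigma> K) (map fst L) = subsimplex \<sigma> (map ((!) K) (map fst L))"
    "subsimplex (subsimplex \<tau> M) (map snd L) = subsimplex \<tau> (map ((!) M) (map snd L))"
    by (rule subsimplex_subsimplex; use assms in auto)+
  then show ?thesis by (simp add: pair_simplex_def o_def)
qed

lemma cross_eval_subsimplex:
  assumes "length K = Suc p" "length M = Suc q"
  shows "cross_eval \<phi> p q (subsimplex \<sigma> K) (subsimplex \<tau> M) =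
    frag_eval (\<lambda>L. \<phi> (pair_simplex \<sigma> \<tau> L)) (cross (p + q) K M)"
proof -
  have "cross (p + q) K M = cross (p + q) (map ((!) K) [0..<Suc p]) (map ((!) M) [0..<Suc q])"
    using map_nth[of K] map_nth[of M] assms by (simp del: upt_Suc)
  then have "frag_eval (\<lambda>L. \<phi> (pair_simplex \<sigma> \<tau> L)) (cross (p + q) K M) =
      frag_eval (\<lambda>L. \<phi> (pair_simplex \<sigma> \<tau> (map (map_prod ((!) K) ((!) M)) L))) (cross (p + q) [0..<Suc p] [0..<Suc q])"
    by (simp add: cross_map frag_eval_relabel del: upt_Suc)
  also have "\<dots> = cross_eval \<phi> p q (subsimplex \<sigma> K) (subsimplex \<tau> M)"
    unfolding cross_eval_def
  proof (rule frag_eval_cong)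
    fix L assume "L \<in> Poly_Mapping.keys (cross (p + q) [0..<Suc p] [0..<Suc q])"
    from keys_cross[OF this] show "\<phi> (pair_simplex \<sigma> \<tau> (map (map_prod ((!) K) ((!) M)) L)) =
        \<phi> (pair_simplex (subsimplex \<sigma> K) (subsimplex \<tau> M) L)"
      using assms by (subst pair_simplex_reindex) (auto simp: atLeast0LessThan simp del: upt_Suc)
  qed
  finally show ?thesis by simp
qed

text \<open>The dual of \<open>boundary_cross\<close>. By naturality a face of one of the vertex
  lists stands for the cross product with the corresponding face of \<open>\<sigma>\<close> or
  \<open>\<tau>\<close>.\<close>

lemma cross_eval_coboundary:
  assumes \<sigma>: "singular_simplex (Suc p) X \<sigma>" and \<tau>: "singular_simplex (Suc q) Y \<tau>"
  shows "cross_eval (coboundary (Suc (p + q)) (prod_topology X Y) \<phi>) (Suc p) (Suc q) \<sigma> \<tau> =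
    coboundary p X (\<lambda>\<sigma>'. cross_eval \<phi> p (Suc q) \<sigma>' \<tau>) \<sigma> +
    (-1) ^ Suc p * coboundary q Y (\<lambda>\<tau>'. cross_eval \<phi> (Suc p) q \<sigma> \<tau>') \<tau>"
proof -
  let ?I = "[0..<Suc (Suc p)]" and ?J = "[0..<Suc (Suc q)]"
  let ?f = "frag_eval (\<lambda>L. \<phi> (pair_simplex \<sigma> \<tau> L))"
  have \<sigma>I: "subsimplex \<sigma> ?I = \<sigma>" and \<tau>J: "subsimplex \<tau> ?J = \<tau>"
    using subsimplex_id[OF \<sigma>] subsimplex_id[OF \<tau>] by simp_all
  have "cross_eval (coboundary (Suc (p + q)) (prod_topology X Y) \<phi>) (Suc p) (Suc q) \<sigma> \<tau> =
      ?f (ordered_boundary (cross (Suc (Suc (p + q))) ?I ?J))"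
    unfolding cross_eval_def
    using coboundary_family_chain[OF simplex_family_pair[OF \<sigma> \<tau>],
        of "cross (Suc (Suc (p + q))) ?I ?J" "Suc (p + q)" \<phi>] keys_cross[of _ "Suc (Suc (p + q))" ?I ?J]
    by (force simp: atLeast0LessThan lessThan_Suc_atMost simp del: upt_Suc cross.simps)
  also have "ordered_boundary (cross (Suc (Suc (p + q))) ?I ?J) =
      frag_extend (\<lambda>I'. cross (Suc (p + q)) I' ?J) (list_boundary ?I) +
      frag_cmul ((-1) ^ Suc p) (frag_extend (cross (Suc (p + q)) ?I) (list_boundary ?J))"
    by (subst boundary_cross) (simp_all del: upt_Suc cross.simps)
  also have "?f \<dots> = frag_eval (\<lambda>I'. ?f (cross (Suc (p + q)) I' ?J)) (list_boundary ?I) +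
      (-1) ^ Suc p * frag_eval (\<lambda>J'. ?f (cross (Suc (p + q)) ?I J')) (list_boundary ?J)"
    by (simp add: frag_eval_add frag_eval_cmul frag_eval_extend del: upt_Suc cross.simps)
  also have "frag_eval (\<lambda>I'. ?f (cross (Suc (p + q)) I' ?J)) (list_boundary ?I) =
      frag_eval (\<lambda>I'. cross_eval \<phi> p (Suc q) (subsimplex \<sigma> I') \<tau>) (list_boundary ?I)"
  proof (rule frag_eval_cong)
    fix I' assume "I' \<in> Poly_Mapping.keys (list_boundary ?I)"
    then have "length I' = Suc p" using keys_list_boundary by fastforce
    from cross_eval_subsimplex[OF this, of ?J "Suc q" \<phi> \<sigma> \<tau>]
    show "?f (cross (Suc (p + q)) I' ?J) = cross_eval \<phi> p (Suc q) (subsimplex \<sigma> I') \<tau>"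
      by (simp add: \<tau>J del: upt_Suc cross.simps)
  qed
  also have "\<dots> = coboundary p X (\<lambda>\<sigma>'. cross_eval \<phi> p (Suc q) \<sigma>' \<tau>) (subsimplex \<sigma> ?I)"
    by (rule coboundary_family[symmetric, OF simplex_family_subsimplex[OF \<sigma>]]) auto
  also have "frag_eval (\<lambda>J'. ?f (cross (Suc (p + q)) ?I J')) (list_boundary ?J) =
      frag_eval (\<lambda>J'. cross_eval \<phi> (Suc p) q \<sigma> (subsimplex \<tau> J')) (list_boundary ?J)"
  proof (rule frag_eval_cong)
    fix J' assume "J' \<in> Poly_Mapping.keys (list_boundary ?J)"
    then have "length J' = Suc q" using keys_list_boundary by fastforce
    from cross_eval_subsimplex[OF _ this, of ?I "Suc p" \<phi> \<sigma> \<tau>]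
    show "?f (cross (Suc (p + q)) ?I J') = cross_eval \<phi> (Suc p) q \<sigma> (subsimplex \<tau> J')"
      by (simp add: \<sigma>I del: upt_Suc cross.simps)
  qed
  also have "\<dots> = coboundary q Y (\<lambda>\<tau>'. cross_eval \<phi> (Suc p) q \<sigma> \<tau>') (subsimplex \<tau> ?J)"
    by (rule coboundary_family[symmetric, OF simplex_family_subsimplex[OF \<tau>]]) auto
  finally show ?thesis unfolding \<sigma>I \<tau>J .
qed

text \<open>The zero-divisor \<open>1 \<times> u - u \<times> 1\<close>, which restricts to zero on
  the diagonal.\<close>

definition difference_cochain :: "'a topology \<Rightarrow> ('a, 'f::comm_ring_1) cochain \<Rightarrow> ('a \<times> 'a, 'f) cochain"
  where "difference_cochain X u = (\<lambda>\<rho>. cochain_pullback 2 (prod_topology X X) snd u \<rho> -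
    cochain_pullback 2 (prod_topology X X) fst u \<rho>)"

lemma simplex_map_pair:
  assumes "singular_simplex p X \<sigma>" "singular_simplex q Y \<tau>" "L \<noteq> []" "set L \<subseteq> {..p} \<times> {..q}"
  shows "simplex_map (length L - 1) fst (pair_simplex \<sigma> \<tau> L) = subsimplex \<sigma> (map fst L)"
    and "simplex_map (length L - 1) snd (pair_simplex \<sigma> \<tau> L) = subsimplex \<tau> (map snd L)"
  by (auto simp: simplex_map_def pair_simplex_def subsimplex_def fun_eq_iff restrict_def)

text \<open>Both simplices have dimension \<open>2 n\<close>, so \<open>n\<close> of the
  \<open>2 n\<close> pairs of steps belong to each coordinate. This is the source of the central
  binomial coefficient.\<close>

lemma cross_eval_difference_power:
  fixes u :: "('a, 'f::comm_ring_1) cochain"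
  assumes u: "normalized X u" and \<sigma>: "singular_simplex (2 * n) X \<sigma>" and \<tau>: "singular_simplex (2 * n) X \<tau>"
  shows "cross_eval (cochain_power (prod_topology X X) (difference_cochain X u) (2 * n)) (2 * n) (2 * n) \<sigma> \<tau> =
    (-1) ^ n * of_nat (2 * n choose n) * cochain_power X u n \<sigma> * cochain_power X u n \<tau>"
proof -
  \<comment> \<open>Setting \<open>w\<close> to \<open>0\<close> outside the vertex set makes it
    vanish on repeated vertices for all arguments, as the shuffle count requires.\<close>
  define w where "w \<rho> a b c = (if {a, b, c} \<subseteq> {..2 * n} then u (subsimplex \<rho> [a, b, c]) else 0)" for \<rho> a b c
  have w0: "w \<rho> a a b = 0" "w \<rho> a b b = 0" if "singular_simplex (2 * n) X \<rho>" for \<rho> a b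
    using normalized_family[OF simplex_family_subsimplex[OF that] u, of a b] by (auto simp: w_def)
  let ?r = "pair_simplex \<sigma> \<tau>" and ?V = "{..2 * n} \<times> {..2 * n}" and ?XX = "prod_topology X X"
  let ?w = "\<lambda>x y z. w \<tau> (snd x) (snd y) (snd z) - w \<sigma> (fst x) (fst y) (fst z)"
  have fam: "simplex_family ?XX ?V ?r" by (rule simplex_family_pair[OF \<sigma> \<tau>])
  have w: "difference_cochain X u (?r [x, y, z]) = ?w x y z" if "{x, y, z} \<subseteq> ?V" for x y z
  proof -
    have "singular_simplex 2 ?XX (?r [x, y, z])"
      using simplex_familyD(1)[OF fam, of "[x, y, z]"] that by (simp add: numeral_2_eq_2)
    moreover have "simplex_map 2 fst (?r [x, y, z]) = subsimplex \<sigma> [fst x, fst y, fst z]"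
      "simplex_map 2 snd (?r [x, y, z]) = subsimplex \<tau> [snd x, snd y, snd z]"
      using simplex_map_pair[OF \<sigma> \<tau>, of "[x, y, z]"] that by (auto simp: numeral_2_eq_2)
    moreover have "{fst x, fst y, fst z} \<subseteq> {..2 * n}" "{snd x, snd y, snd z} \<subseteq> {..2 * n}"
      using that by auto
    ultimately show ?thesis by (simp add: difference_cochain_def cochain_pullback_def w_def)
  qed
  have pow: "cochain_power X u n \<rho> = list_power (w \<rho>) n [0..<Suc (2 * n)]" if "singular_simplex (2 * n) X \<rho>" for \<rho>
  proof -
    have "cochain_power X u n (subsimplex \<rho> [0..<Suc (2 * n)]) = list_power (w \<rho>) n [0..<Suc (2 * n)]"
      by (rule cochain_power_family[OF simplex_family_subsimplex[OF that]]) (auto simp: w_def)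
    then show ?thesis by (simp only: subsimplex_id[OF that])
  qed
  have "cross_eval (cochain_power ?XX (difference_cochain X u) (2 * n)) (2 * n) (2 * n) \<sigma> \<tau> =
      frag_eval (list_power ?w (2 * n)) (cross (2 * (2 * n)) [0..<Suc (2 * n)] [0..<Suc (2 * n)])"
    unfolding cross_eval_def mult_2[symmetric]
  proof (rule frag_eval_cong)
    fix L assume L: "L \<in> Poly_Mapping.keys (cross (2 * (2 * n)) [0..<Suc (2 * n)] [0..<Suc (2 * n)])"
    show "cochain_power ?XX (difference_cochain X u) (2 * n) (?r L) = list_power ?w (2 * n) L"
      by (rule cochain_power_family[where w = ?w, OF fam w])
        (use keys_cross[OF L] in \<open>auto simp: atLeast0LessThan lessThan_Suc_atMost simp del: upt_Suc\<close>)
  qed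
  also have "\<dots> = (-1) ^ n * of_nat (2 * n choose n) * list_power (w \<sigma>) n [0..<Suc (2 * n)] *
      list_power (w \<tau>) n [0..<Suc (2 * n)]"
    by (subst frag_eval_power_cross) (simp_all add: w0 \<sigma> \<tau> del: upt_Suc cross.simps)
  finally show ?thesis by (simp only: pow[OF \<sigma>] pow[OF \<tau>])
qed

section \<open>Homotopies\<close>

abbreviation unit_interval :: "real topology" where "unit_interval \<equiv> top_of_set {0..1}"

text \<open>The fundamental 1-simplex of the interval. Its face \<open>0\<close> is the end point
  \<open>1\<close> and its face \<open>1\<close> the end point \<open>0\<close>, hence the
  expression \<open>1 - real k\<close> below.\<close>

definition unit_path :: "(nat \<Rightarrow> real) \<Rightarrow> real"
  where "unit_path = restrict (\<lambda>x. x 1) (standard_simplex 1)"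

lemma singular_simplex_unit_path: "singular_simplex 1 unit_interval unit_path"
proof -
  have "continuous_map (subtopology (powertop_real UNIV) (standard_simplex 1)) unit_interval (\<lambda>x. x 1)"
    by (auto simp: continuous_map_in_subtopology standard_simplex_def
        intro!: continuous_map_from_subtopology continuous_map_product_projection)
  then show ?thesis by (auto simp: singular_simplex_def unit_path_def intro: continuous_map_eq)
qed

lemma singular_simplex_unit_path_face:
  "k \<le> 1 \<Longrightarrow> singular_simplex 0 unit_interval (singular_face 1 k unit_path)"
  using singular_simplex_singular_face[OF singular_simplex_unit_path, of k] by simp

lemma unit_path_face:
  assumes "k \<le> 1" "x \<in> standard_simplex 0"
  shows "singular_face 1 k unit_path x = 1 - real k"
proof -
  have "simplical_face k x \<in> standard_simplex 1"
    using simplical_face_in_standard_simplex[of 1 k x] assms by simp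
  then show ?thesis
    using assms by (cases "k = 0") (auto simp: singular_face_def unit_path_def simplical_face_def standard_simplex_0)
qed

text \<open>The prism operator, by integration over the cross product of the interval with
  \<open>\<sigma>\<close>. The domain of the homotopy does not occur in it, so one and the same
  cochain can be used on a subspace and on its intersection with another.\<close>

definition prism :: "(real \<times> 'b \<Rightarrow> 'a) \<Rightarrow> ('a, 'f::comm_ring_1) cochain \<Rightarrow> ('b, 'f) cochain"
  where "prism H u \<sigma> = cross_eval (\<lambda>\<rho>. u (simplex_map 2 H \<rho>)) 1 1 unit_path \<sigma>"

lemma cross_eval_cong:
  assumes \<sigma>: "singular_simplex p X \<sigma>" and \<tau>: "singular_simplex q Y \<tau>"
    and eq: "\<And>\<rho>. singular_simplex (p + q) (prod_topology X Y) \<rho> \<Longrightarrow> \<phi> \<rho> = \<psi> \<rho>"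
  shows "cross_eval \<phi> p q \<sigma> \<tau> = cross_eval \<psi> p q \<sigma> \<tau>"
  unfolding cross_eval_def
proof (rule frag_eval_cong)
  fix L assume "L \<in> Poly_Mapping.keys (cross (p + q) [0..<Suc p] [0..<Suc q])"
  note L = keys_cross[OF this]
  have "singular_simplex (length L - 1) (prod_topology X Y) (pair_simplex \<sigma> \<tau> L)"
    by (rule simplex_familyD(1)[OF simplex_family_pair[OF \<sigma> \<tau>] L(1)])
      (use L(3) in \<open>auto simp: atLeast0LessThan lessThan_Suc_atMost simp del: upt_Suc\<close>)
  then show "\<phi> (pair_simplex \<sigma> \<tau> L) = \<psi> (pair_simplex \<sigma> \<tau> L)"
    using L(2) eq by simp
qed

text \<open>Coning produces degenerate simplices even for a point times a triangle. Normalization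
  removes them and leaves the triangle itself.\<close>

lemma cross_eval_point:
  assumes \<kappa>: "singular_simplex 0 X \<kappa>" and \<sigma>: "singular_simplex 2 Y \<sigma>"
    and v: "normalized (prod_topology X Y) v"
  shows "cross_eval v 0 2 \<kappa> \<sigma> = v (pair_simplex \<kappa> \<sigma> [(0, 0), (0, 1), (0, 2)])"
proof -
  let ?r = "pair_simplex \<kappa> \<sigma>"
  have V: "{..0::nat} = {0}" "{..2::nat} = {0, 1, 2}" by auto
  have fam: "simplex_family (prod_topology X Y) ({..0} \<times> {..2}) ?r" by (rule simplex_family_pair[OF \<kappa> \<sigma>])
  have "{..2::nat} = set [0, 1, 2]" by auto
  have z: "v (?r [a, a, b]) = 0" "v (?r [a, b, b]) = 0" if "{a, b} \<subseteq> {0} \<times> {0, 1, 2}" for a b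
    using normalized_family[OF fam v, of a b] that unfolding V by simp_all
  have "cross 2 [0::nat] [0, 1, 2::nat] = cross (Suc (Suc 0)) [0] [0, 1, 2]" by (simp add: numeral_2_eq_2)
  then show ?thesis
    by (simp add: cross_eval_def numeral_2_eq_2 upt_rec frag_extend_diff frag_extend_add frag_extend_cmul cone_diff cone_def
        frag_eval_diff frag_eval_add frag_eval_cmul) (simp add: z flip: numeral_2_eq_2 One_nat_def)
qed

text \<open>The Leibniz rule for the cocycle \<open>v\<close> on the interval times
  \<open>\<sigma>\<close>: its values on the two ends account for its value on the interval times
  the boundary of \<open>\<sigma>\<close>.\<close>

lemma coboundary_prism:
  assumes H: "continuous_map (prod_topology unit_interval Z) X H"
    and u: "singular_cocycle 2 X u" "normalized X u" and \<sigma>: "singular_simplex 2 Z \<sigma>"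
  shows "coboundary 1 Z (prism H u) \<sigma> =
    u (simplex_map 2 (\<lambda>z. H (1, z)) \<sigma>) - u (simplex_map 2 (\<lambda>z. H (0, z)) \<sigma>)"
proof -
  let ?Y = "prod_topology unit_interval Z"
  define v where "v = cochain_pullback 2 ?Y H u"
  have v: "singular_cocycle 2 ?Y v" "normalized ?Y v"
    using singular_cocycle_pullback[OF H u(1)] normalized_pullback[OF H u(2)] by (simp_all add: v_def)
  note \<iota> = singular_simplex_unit_path
  have \<sigma>': "singular_simplex (Suc 1) Z \<sigma>" using \<sigma> by (simp add: numeral_2_eq_2)
  have face: "singular_simplex 1 Z (singular_face (Suc 1) k \<sigma>)" if "k \<in> {..Suc 1}" for k
    using singular_simplex_singular_face[OF \<sigma>', of k] that by simp
  have prism: "prism H u \<tau> = cross_eval v 1 1 unit_path \<tau>" if "singular_simplex 1 Z \<tau>" for \<tau>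
    unfolding prism_def by (rule cross_eval_cong[OF \<iota> that]) (simp add: v_def cochain_pullback_def numeral_2_eq_2)
  have "coboundary 2 ?Y v = (\<lambda>_. 0)" using v(1) by (simp add: singular_cocycle_def)
  then have "0 = cross_eval (coboundary (Suc (0 + 1)) ?Y v) (Suc 0) (Suc 1) unit_path \<sigma>"
    by (simp add: cross_eval_def frag_eval_zero numeral_2_eq_2)
  also have "\<dots> = coboundary 0 unit_interval (\<lambda>\<kappa>. cross_eval v 0 2 \<kappa> \<sigma>) unit_path -
      coboundary 1 Z (\<lambda>\<tau>. cross_eval v 1 1 unit_path \<tau>) \<sigma>"
    using cross_eval_coboundary[OF \<iota>[unfolded One_nat_def] \<sigma>', of v]
    by (simp add: numeral_2_eq_2)
  also have "coboundary 1 Z (\<lambda>\<tau>. cross_eval v 1 1 unit_path \<tau>) \<sigma> = coboundary 1 Z (prism H u) \<sigma>"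
    unfolding coboundary_def by (intro if_cong refl sum.cong) (simp only: prism[OF face])
  also have "coboundary 0 unit_interval (\<lambda>\<kappa>. cross_eval v 0 2 \<kappa> \<sigma>) unit_path =
      cross_eval v 0 2 (singular_face 1 0 unit_path) \<sigma> - cross_eval v 0 2 (singular_face 1 1 unit_path) \<sigma>"
    using \<iota> by (simp add: coboundary_def)
  also have "cross_eval v 0 2 (singular_face 1 k unit_path) \<sigma> = u (simplex_map 2 (\<lambda>z. H (1 - real k, z)) \<sigma>)"
    if k: "k \<le> 1" for k
  proof -
    let ?\<kappa> = "singular_face 1 k unit_path"
    note \<kappa> = singular_simplex_unit_path_face[OF k] and \<kappa>e = unit_path_face[OF k]
    let ?L = "[(0, 0), (0, 1), (0, 2)] :: (nat \<times> nat) list"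
    have sing: "singular_simplex 2 ?Y (pair_simplex ?\<kappa> \<sigma> ?L)"
      using simplex_familyD(1)[OF simplex_family_pair[OF \<kappa> \<sigma>], of ?L] by (simp add: numeral_2_eq_2)
    have s: "subsimplex \<sigma> [0, 1, 2] = \<sigma>"
      using subsimplex_id[OF \<sigma>] by (simp add: upt_rec numeral_2_eq_2)
    have L: "map fst ?L = [0, 0, 0]" "map snd ?L = [0, 1, 2]" "length ?L - 1 = 2" by simp_all
    have "pair_simplex ?\<kappa> \<sigma> ?L x = (1 - real k, \<sigma> x)" if x: "x \<in> standard_simplex 2" for x
    proof -
      have "vertex_sum [0, 0, 0] x \<in> standard_simplex 0"
        by (rule vertex_sum_in_standard_simplex) (use x in \<open>simp_all add: numeral_2_eq_2\<close>)
      moreover have "length [0 :: nat, 0, 0] - 1 = 2" by simp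
      ultimately show ?thesis
        using x by (simp only: pair_simplex_def L s subsimplex_def[of ?\<kappa>] restrict_apply if_True \<kappa>e)
    qed
    then have "simplex_map 2 H (pair_simplex ?\<kappa> \<sigma> ?L) = simplex_map 2 (\<lambda>z. H (1 - real k, z)) \<sigma>"
      unfolding simplex_map_def by (intro restrict_ext) (simp only: o_apply)
    then show ?thesis
      unfolding cross_eval_point[OF \<kappa> \<sigma> v(2)] using sing by (simp add: v_def cochain_pullback_def)
  qed
  from this[of 0] this[of 1] calculation show ?thesis by simp
qed

section \<open>One-dimensional cocycles vanishing on loops\<close>

text \<open>The affine passage of \<open>p\<close> from parameter \<open>a\<close> to
  \<open>b\<close>. No order of \<open>a\<close> and \<open>b\<close> is imposed, so reversed and
  constant paths are included.\<close>

definition path_simplex :: "(real \<Rightarrow> 'a) \<Rightarrow> real \<Rightarrow> real \<Rightarrow> (nat \<Rightarrow> real) \<Rightarrow> 'a"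
  where "path_simplex p a b = restrict (\<lambda>x. p (a * x 0 + b * x 1)) (standard_simplex 1)"

text \<open>The three path simplices are the faces of the triangle that evaluates \<open>p\<close>
  at a convex combination of \<open>a\<close>, \<open>b\<close> and \<open>d\<close>. Additivity for
  parameters in any order covers concatenation as well as reversal.\<close>

lemma cocycle_path_simplex:
  fixes c :: "('a, 'f::comm_ring_1) cochain"
  assumes c: "\<And>\<rho>. singular_simplex 2 X \<rho> \<Longrightarrow> coboundary 1 X c \<rho> = 0"
    and p: "continuous_map (top_of_set {l..h}) X p" and abd: "{a, b, d} \<subseteq> {l..h}"
  shows "c (path_simplex p a d) = c (path_simplex p a b) + c (path_simplex p b d)"
proof -
  let ?q = "\<lambda>x :: nat \<Rightarrow> real. a * x 0 + b * x 1 + d * x 2"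
  let ?\<Delta> = "subtopology (powertop_real UNIV) (standard_simplex 2)"
  have q: "?q x \<in> {l..h}" if "x \<in> standard_simplex 2" for x
  proof -
    have x: "0 \<le> x i" for i using that by (simp add: standard_simplex_def)
    have s: "x 0 + x 1 + x 2 = 1" using that by (simp add: standard_simplex_def numeral_2_eq_2)
    have "l * (x 0 + x 1 + x 2) \<le> ?q x" "?q x \<le> h * (x 0 + x 1 + x 2)"
      using abd x by (auto simp: distrib_left intro!: add_mono mult_right_mono)
    then show ?thesis unfolding s by simp
  qed
  have "continuous_map ?\<Delta> (top_of_set {l..h}) ?q"
    unfolding continuous_map_in_subtopology using q
    by (auto intro!: continuous_map_add continuous_map_real_mult_left continuous_map_from_subtopology
        continuous_map_product_projection)
  from continuous_map_compose[OF this p]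
  have \<rho>: "singular_simplex 2 X (restrict (\<lambda>x. p (?q x)) (standard_simplex 2))" (is "singular_simplex 2 X ?\<rho>")
    by (auto simp: singular_simplex_def o_def intro: continuous_map_eq)
  have face: "singular_face 2 k ?\<rho> = restrict (\<lambda>x. p (?q (simplical_face k x))) (standard_simplex 1)" if "k \<le> 2" for k
    unfolding singular_face_def using simplical_face_in_standard_simplex[of 2 k] that
    by (simp add: o_def cong: restrict_cong)
  have "singular_face 2 0 ?\<rho> = path_simplex p b d" "singular_face 2 1 ?\<rho> = path_simplex p a d"
    "singular_face 2 2 ?\<rho> = path_simplex p a b"
    unfolding path_simplex_def
    by (subst face, simp, intro restrict_ext, simp add: simplical_face_def)+
  then have "c (path_simplex p b d) - c (path_simplex p a d) + c (path_simplex p a b) = 0"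
    using c[OF \<rho>] \<rho> by (simp add: coboundary_def numeral_2_eq_2)
  then have "c (path_simplex p a b) + c (path_simplex p b d) - c (path_simplex p a d) = 0"
    by (simp add: algebra_simps)
  then show ?thesis by (simp only: right_minus_eq)
qed

lemma singular_simplex_path_simplex:
  assumes "continuous_map (top_of_set {l..h}) X p" "{a, b} \<subseteq> {l..h}"
  shows "singular_simplex 1 X (path_simplex p a b)"
proof -
  let ?q = "\<lambda>x :: nat \<Rightarrow> real. a * x 0 + b * x 1"
  have q: "?q x \<in> {l..h}" if "x \<in> standard_simplex 1" for x
  proof -
    have x: "0 \<le> x i" for i using that by (simp add: standard_simplex_def)
    have s: "x 0 + x 1 = 1" using that by (simp add: standard_simplex_def)
    have "l * (x 0 + x 1) \<le> ?q x" "?q x \<le> h * (x 0 + x 1)"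
      using assms(2) x by (auto simp: distrib_left intro!: add_mono mult_right_mono)
    then show ?thesis unfolding s by simp
  qed
  have "continuous_map (subtopology (powertop_real UNIV) (standard_simplex 1)) (top_of_set {l..h}) ?q"
    unfolding continuous_map_in_subtopology using q
    by (auto intro!: continuous_map_add continuous_map_real_mult_left continuous_map_from_subtopology
        continuous_map_product_projection)
  from continuous_map_compose[OF this assms(1)] show ?thesis
    by (auto simp: singular_simplex_def path_simplex_def o_def intro: continuous_map_eq)
qed

lemma standard_simplex_1: "x \<in> standard_simplex 1 \<longleftrightarrow> (\<exists>t\<in>{0..1}. x = (\<lambda>j. if j = 0 then 1 - t else if j = 1 then t else 0))"
proof
  assume x: "x \<in> standard_simplex 1"
  then have "x 0 = 1 - x 1" "\<And>j. j > 1 \<Longrightarrow> x j = 0" by (auto simp: standard_simplex_def)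
  then have "x j = (if j = 0 then 1 - x 1 else if j = 1 then x 1 else 0)" for j
    by (cases "j = 0"; cases "j = 1") auto
  moreover have "x 1 \<in> {0..1}" using x by (simp add: standard_simplex_def)
  ultimately show "\<exists>t\<in>{0..1}. x = (\<lambda>j. if j = 0 then 1 - t else if j = 1 then t else 0)" by blast
next
  assume "\<exists>t\<in>{0..1}. x = (\<lambda>j. if j = 0 then 1 - t else if j = 1 then t else 0)"
  then show "x \<in> standard_simplex 1" by (auto simp: standard_simplex_def)
qed

definition simplex_path :: "((nat \<Rightarrow> real) \<Rightarrow> 'a) \<Rightarrow> real \<Rightarrow> 'a"
  where "simplex_path \<sigma> t = \<sigma> (\<lambda>j. if j = 0 then 1 - t else if j = 1 then t else 0)"

lemma continuous_map_simplex_path: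
  assumes "singular_simplex 1 X \<sigma>"
  shows "continuous_map unit_interval X (simplex_path \<sigma>)"
proof -
  have "continuous_map unit_interval (subtopology (powertop_real UNIV) (standard_simplex 1))
      (\<lambda>t j. if j = 0 then 1 - t else if j = 1 then t else 0)"
  proof (rule continuous_map_into_subtopology)
    have "continuous_map unit_interval euclideanreal (\<lambda>t. if j = 0 then 1 - t else if j = 1 then t else 0)" for j :: nat
      by (cases "j = 0"; cases "j = 1") (auto intro!: continuous_intros)
    then show "continuous_map unit_interval (powertop_real UNIV) (\<lambda>t (j :: nat). if j = 0 then 1 - t else if j = 1 then t else 0)"
      unfolding continuous_map_componentwise_UNIV by blast
    show "(\<lambda>t j. if j = 0 then 1 - t else if j = 1 then t else 0) \<in> topspace unit_interval \<rightarrow> standard_simplex 1"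
    proof
      fix t :: real assume "t \<in> topspace unit_interval"
      then have "t \<in> {0..1}" by simp
      then show "(\<lambda>j. if j = 0 then 1 - t else if j = 1 then t else 0) \<in> standard_simplex 1"
        unfolding standard_simplex_1 by blast
    qed
  qed
  from continuous_map_compose[OF this, of X \<sigma>] assms show ?thesis
    by (simp add: singular_simplex_def simplex_path_def[abs_def] o_def)
qed

lemma simplex_path_eq: "x \<in> standard_simplex 1 \<Longrightarrow> simplex_path \<sigma> (x 1) = \<sigma> x"
  unfolding standard_simplex_1 by (auto simp: simplex_path_def)

lemma path_simplex_simplex_path:
  assumes "singular_simplex 1 X \<sigma>"
  shows "path_simplex (simplex_path \<sigma>) 0 1 = \<sigma>"
proof -
  have "path_simplex (simplex_path \<sigma>) 0 1 = restrict \<sigma> (standard_simplex 1)"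
    unfolding path_simplex_def by (rule restrict_ext) (simp add: simplex_path_eq[simplified])
  then show ?thesis using assms by (simp add: singular_simplex_def extensional_restrict)
qed

text \<open>Additivity for the concatenated path with the parameters \<open>0\<close>,
  \<open>1/2\<close> and \<open>1\<close>; its two halves are the given paths up to affine
  reparametrization.\<close>

lemma cocycle_path_join:
  fixes c :: "('a, 'f::comm_ring_1) cochain"
  assumes c: "\<And>\<rho>. singular_simplex 2 X \<rho> \<Longrightarrow> coboundary 1 X c \<rho> = 0"
    and p: "continuous_map unit_interval X p" and q: "continuous_map unit_interval X q" and "p 1 = q 0"
  obtains r where "continuous_map unit_interval X r" "r 0 = p 0" "r 1 = q 1"
    "c (path_simplex r 0 1) = c (path_simplex p 0 1) + c (path_simplex q 0 1)"
proof -
  define r where "r t = (if t \<le> 1/2 then p (2 * t) else q (2 * t - 1))" for t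
  have r: "continuous_map unit_interval X r"
    unfolding r_def
  proof (rule continuous_map_cases_le)
    have "continuous_map (subtopology unit_interval {x \<in> topspace unit_interval. x \<le> 1/2}) unit_interval (\<lambda>t. 2 * t)"
      by (auto simp: subtopology_subtopology intro!: continuous_intros)
    from continuous_map_compose[OF this p]
    show "continuous_map (subtopology unit_interval {x \<in> topspace unit_interval. x \<le> 1/2}) X (\<lambda>t. p (2 * t))"
      by (simp add: o_def)
    have "continuous_map (subtopology unit_interval {x \<in> topspace unit_interval. 1/2 \<le> x}) unit_interval (\<lambda>t. 2 * t - 1)"
      by (auto simp: subtopology_subtopology intro!: continuous_intros)
    from continuous_map_compose[OF this q]
    show "continuous_map (subtopology unit_interval {x \<in> topspace unit_interval. 1/2 \<le> x}) X (\<lambda>t. q (2 * t - 1))"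
      by (simp add: o_def)
    show "p (2 * x) = q (2 * x - 1)" if "x = 1/2" for x unfolding that using assms(4) by simp
  qed (auto intro!: continuous_intros)
  have eq: "path_simplex r 0 (1/2) = path_simplex p 0 1" "path_simplex r (1/2) 1 = path_simplex q 0 1"
  proof -
    have half: "r ((1/2) * s) = p s" "r ((1/2) * (1 - s) + s) = q s" if "s \<in> {0..1}" for s
      using that assms(4) by (auto simp: r_def field_simps)
    show "path_simplex r 0 (1/2) = path_simplex p 0 1"
      unfolding path_simplex_def by (rule restrict_ext) (use half in \<open>auto simp: standard_simplex_1[simplified]\<close>)
    show "path_simplex r (1/2) 1 = path_simplex q 0 1"
      unfolding path_simplex_def by (rule restrict_ext) (use half in \<open>auto simp: standard_simplex_1[simplified]\<close>)
  qed
  have "c (path_simplex r 0 1) = c (path_simplex r 0 (1/2)) + c (path_simplex r (1/2) 1)"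
    by (rule cocycle_path_simplex[OF c r]) auto
  then show thesis
    using r assms(4) by (intro that[of r]) (simp_all only: eq, simp_all add: r_def)
qed

text \<open>The usual construction of a potential: integrate \<open>c\<close> along a path from a
  base point of the path component. Vanishing on loops makes the result independent of the
  path.\<close>

theorem cocycle_vanishing_on_loops:
  fixes c :: "('a, 'f::comm_ring_1) cochain"
  assumes c: "\<And>\<rho>. singular_simplex 2 X \<rho> \<Longrightarrow> coboundary 1 X c \<rho> = 0"
    and loop: "\<And>\<sigma>. singular_simplex 1 X \<sigma> \<Longrightarrow> simplex_path \<sigma> 0 = simplex_path \<sigma> 1 \<Longrightarrow> c \<sigma> = 0"
  obtains g where "\<And>\<sigma>. singular_simplex 1 X \<sigma> \<Longrightarrow> c \<sigma> = g (simplex_path \<sigma> 1) - g (simplex_path \<sigma> 0)"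
proof -
  define P where "P x y p \<longleftrightarrow> continuous_map unit_interval X p \<and> p 0 = x \<and> p 1 = y" for x y and p :: "real \<Rightarrow> 'a"
  \<comment> \<open>The choice depends only on the set of points joined to \<open>x\<close>, hence
    is the same throughout a path component.\<close>
  define b where "b x = (SOME y. path_component_of X y x)" for x
  define g where "g x = c (path_simplex (SOME p. P (b x) x p) 0 1)" for x
  have pc: "path_component_of X x y \<longleftrightarrow> (\<exists>p. P x y p)" for x y
    by (auto simp: path_component_of_def pathin_def P_def)
  have ends: "simplex_path (path_simplex p 0 1) 0 = p 0" "simplex_path (path_simplex p 0 1) 1 = p 1" for p :: "real \<Rightarrow> 'a"
  proof -
    have "(\<lambda>j. if j = 0 then 1 - t else if j = 1 then t else 0) \<in> standard_simplex 1" if "t \<in> {0..1}" for t :: real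
      unfolding standard_simplex_1 using that by blast
    from this[of 0] this[of 1] show "simplex_path (path_simplex p 0 1) 0 = p 0" "simplex_path (path_simplex p 0 1) 1 = p 1"
      by (simp_all add: simplex_path_def path_simplex_def cong: if_cong)
  qed
  have uniq: "c (path_simplex p 0 1) = c (path_simplex q 0 1)" if p: "P x y p" and q: "P x y q" for x y p q
  proof -
    have q': "continuous_map unit_interval X (\<lambda>t. q (1 - t))"
    proof -
      have "continuous_map unit_interval unit_interval (\<lambda>t. 1 - t)" by (auto intro!: continuous_intros)
      from continuous_map_compose[OF this, of X q] q show ?thesis by (simp add: P_def o_def)
    qed
    have rev: "path_simplex (\<lambda>t. q (1 - t)) 0 1 = path_simplex q 1 0"
      unfolding path_simplex_def by (rule restrict_ext) (auto simp: standard_simplex_1[simplified])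
    have cq: "continuous_map (top_of_set {0..1}) X q" using q by (simp add: P_def)
    obtain r where r: "continuous_map unit_interval X r" "r 0 = p 0" "r 1 = q 0"
      "c (path_simplex r 0 1) = c (path_simplex p 0 1) + c (path_simplex (\<lambda>t. q (1 - t)) 0 1)"
      using cocycle_path_join[where c = c and p = p and q = "\<lambda>t. q (1 - t)", OF c _ q'] p q
      by (auto simp: P_def)
    have "singular_simplex 1 X (path_simplex r 0 1)"
      by (rule singular_simplex_path_simplex[OF r(1)]) simp
    then have "c (path_simplex r 0 1) = 0"
      by (rule loop) (use r(2,3) p q in \<open>simp add: ends P_def\<close>)
    \<comment> \<open>Additivity over the parameters \<open>0, 1, 0\<close> and
      \<open>0, 0, 0\<close>: the constant path has value \<open>0\<close>, so reversing
      \<open>q\<close> changes the sign.\<close>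
    moreover have "c (path_simplex q 0 0) = c (path_simplex q 0 1) + c (path_simplex q 1 0)"
      by (rule cocycle_path_simplex[OF c cq]) auto
    moreover have "c (path_simplex q 0 0) = c (path_simplex q 0 0) + c (path_simplex q 0 0)"
      by (rule cocycle_path_simplex[OF c cq]) auto
    ultimately show ?thesis using r(4) unfolding rev by (simp add: eq_neg_iff_add_eq_0 add.commute)
       (metis add.commute add_left_cancel)
  qed
  show thesis
  proof (rule that)
    fix \<sigma> assume \<sigma>: "singular_simplex 1 X \<sigma>"
    let ?x = "simplex_path \<sigma> 0" and ?y = "simplex_path \<sigma> 1"
    have s: "P ?x ?y (simplex_path \<sigma>)" using continuous_map_simplex_path[OF \<sigma>] by (simp add: P_def)
    then have xy: "path_component_of X ?x ?y" using pc by blast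
    have "path_component_of X y ?x \<longleftrightarrow> path_component_of X y ?y" for y
      using xy path_component_of_trans path_component_of_sym by metis
    then have bb: "b ?x = b ?y" by (simp add: b_def)
    have "path_component_of X ?x ?x"
      using xy path_component_of_trans path_component_of_sym by metis
    then have "path_component_of X (b ?x) ?x" unfolding b_def by (rule someI)
    then have px: "P (b ?x) ?x (SOME p. P (b ?x) ?x p)" unfolding pc by (rule someI_ex)
    have "path_component_of X (b ?y) ?y"
      using path_component_of_trans[OF \<open>path_component_of X (b ?x) ?x\<close> xy] bb by simp
    then have py: "P (b ?y) ?y (SOME p. P (b ?y) ?y p)" unfolding pc by (rule someI_ex)
    have "\<exists>r. continuous_map unit_interval X r \<and> r 0 = b ?x \<and> r 1 = ?y \<and>
        c (path_simplex r 0 1) = g ?x + c (path_simplex (simplex_path \<sigma>) 0 1)"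
    proof (rule cocycle_path_join[where c = c and p = "SOME p. P (b ?x) ?x p" and q = "simplex_path \<sigma>", OF c])
      show "continuous_map unit_interval X (SOME p. P (b ?x) ?x p)" "continuous_map unit_interval X (simplex_path \<sigma>)"
        "(SOME p. P (b ?x) ?x p) 1 = simplex_path \<sigma> 0"
        using px s unfolding P_def by blast+
      have "(SOME p. P (b ?x) ?x p) 0 = b ?x" using px unfolding P_def by blast
      then show "\<exists>r. continuous_map unit_interval X r \<and> r 0 = b ?x \<and> r 1 = ?y \<and>
        c (path_simplex r 0 1) = g ?x + c (path_simplex (simplex_path \<sigma>) 0 1)" if "continuous_map unit_interval X r" "r 0 = (SOME p. P (b ?x) ?x p) 0" "r 1 = ?y"
        "c (path_simplex r 0 1) = c (path_simplex (SOME p. P (b ?x) ?x p) 0 1) + c (path_simplex (simplex_path \<sigma>) 0 1)" for r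
        using that by (intro exI[of _ r]) (simp add: g_def)
    qed
    then obtain r where "continuous_map unit_interval X r" "r 0 = b ?x" "r 1 = ?y"
      and r: "c (path_simplex r 0 1) = g ?x + c (path_simplex (simplex_path \<sigma>) 0 1)" by blast
    then have "P (b ?y) ?y r" by (simp add: P_def bb)
    from uniq[OF this py] r have "g ?y = g ?x + c \<sigma>"
      by (simp add: g_def[of ?y] path_simplex_simplex_path[OF \<sigma>])
    then show "c \<sigma> = g ?y - g ?x" by simp
  qed
qed

section \<open>Tori and the weight of atoroidal classes\<close>

definition circle_point :: "real \<Rightarrow> nat \<Rightarrow> real"
  where "circle_point \<theta> i = (if i = 0 then cos \<theta> else if i = 1 then sin \<theta> else 0)"

text \<open>Period \<open>2\<close> in the first coordinate and \<open>1\<close> in the second: the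
  torus is the rectangle \<open>{0..2} \<times> {0..1}\<close> with opposite sides glued, long
  enough for two homotopies of unit duration.\<close>

definition torus_point :: "real \<times> real \<Rightarrow> nat \<Rightarrow> nat \<Rightarrow> real"
  where "torus_point z = (\<lambda>k\<in>{..<2}. circle_point (if k = 0 then pi * fst z else 2 * pi * snd z))"

lemma topspace_circle: "topspace (nsphere 1) = {x. x 0 ^ 2 + x 1 ^ 2 = 1 \<and> (\<forall>i>1. x i = 0)}"
  by (simp add: nsphere)

lemma continuous_map_circle_point:
  assumes "continuous_map Z euclideanreal g"
  shows "continuous_map Z (nsphere 1) (\<lambda>z. circle_point (g z))"
proof -
  have c: "continuous_map Z euclideanreal (\<lambda>z. cos (g z))" "continuous_map Z euclideanreal (\<lambda>z. sin (g z))"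
    using continuous_map_compose[OF assms, of euclideanreal cos] continuous_map_compose[OF assms, of euclideanreal sin]
    by (simp_all add: o_def continuous_on_cos continuous_on_sin)
  have "continuous_map Z euclideanreal (\<lambda>z. circle_point (g z) i)" for i
    using c by (cases "i = 0"; cases "i = 1") (simp_all add: circle_point_def)
  then have "continuous_map Z (powertop_real UNIV) (\<lambda>z. circle_point (g z))"
    unfolding continuous_map_componentwise_UNIV by blast
  then show ?thesis
    unfolding nsphere by (rule continuous_map_into_subtopology) (auto simp: circle_point_def)
qed

lemma continuous_map_torus_point:
  assumes "continuous_map Z euclideanreal f" "continuous_map Z euclideanreal g"
  shows "continuous_map Z (torus 2) (\<lambda>z. torus_point (f z, g z))"
  unfolding torus_def continuous_map_componentwise
proof (intro conjI ballI)
  fix k :: nat assume k: "k \<in> {..<2}"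
  have "continuous_map Z (nsphere 1) (\<lambda>z. circle_point (if k = 0 then pi * f z else 2 * pi * g z))"
    by (rule continuous_map_circle_point) (use assms in \<open>cases "k = 0"; auto intro!: continuous_map_real_mult_left simp: mult.assoc\<close>)
  then show "continuous_map Z (nsphere 1) (\<lambda>z. torus_point (f z, g z) k)"
    unfolding torus_point_def by (simp only: restrict_apply k if_True fst_conv snd_conv)
qed (auto simp: torus_point_def)

lemma circle_point_eq:
  "circle_point \<theta> = circle_point \<eta> \<longleftrightarrow> (\<exists>n::int. \<theta> = \<eta> + 2 * pi * n)"
proof -
  have "circle_point \<theta> = circle_point \<eta> \<longleftrightarrow> sin \<theta> = sin \<eta> \<and> cos \<theta> = cos \<eta>"
    by (auto simp: circle_point_def fun_eq_iff split: if_splits)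
  then show ?thesis by (simp add: sin_cos_eq_iff)
qed

lemma torus_point_eq:
  assumes eq: "torus_point (t, s) = torus_point (t', s')"
    and t: "t \<in> {0..2}" "t' \<in> {0..2}" "s \<in> {0..1}" "s' \<in> {0..1}"
  shows "(t = t' \<or> {t, t'} = {0, 2}) \<and> (s = s' \<or> {s, s'} = {0, 1})"
proof -
  have "circle_point (pi * t) = circle_point (pi * t')" "circle_point (2 * pi * s) = circle_point (2 * pi * s')"
    using fun_cong[OF eq, of 0] fun_cong[OF eq, of 1] by (simp_all add: torus_point_def)
  then obtain m n :: int where "pi * t = pi * t' + 2 * pi * m" "2 * pi * s = 2 * pi * s' + 2 * pi * n"
    unfolding circle_point_eq by blast
  then have "pi * (t - t' - 2 * m) = 0" "pi * (s - s' - n) = 0" by (simp_all add: algebra_simps)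
  then have mn: "t - t' = 2 * m" "s - s' = n" by simp_all
  then have "-1 \<le> real_of_int m" "real_of_int m \<le> 1" "-1 \<le> real_of_int n" "real_of_int n \<le> 1"
    using t by simp_all
  then have "m = -1 \<or> m = 0 \<or> m = 1" "n = -1 \<or> n = 0 \<or> n = 1" by linarith+
  then have "t = t' \<or> t = 0 \<and> t' = 2 \<or> t = 2 \<and> t' = 0" "s = s' \<or> s = 0 \<and> s' = 1 \<or> s = 1 \<and> s' = 0"
    using mn t by (elim disjE; simp)+
  then show ?thesis by (simp add: doubleton_eq_iff)
qed

text \<open>A continuous surjection from a compact space to a Hausdorff space. Hence a map on the
  rectangle that respects the gluing of its sides descends to the torus.\<close>

lemma quotient_map_torus_point:
  "quotient_map (prod_topology (top_of_set {0..2}) (top_of_set {0..1})) (torus 2) torus_point"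
proof (rule continuous_closed_imp_quotient_map)
  let ?Z = "prod_topology (top_of_set {0..2::real}) (top_of_set {0..1::real})"
  have "continuous_map ?Z euclideanreal fst" "continuous_map ?Z euclideanreal snd"
    using continuous_map_fst[of "top_of_set {0..2::real}" "top_of_set {0..1::real}"]
      continuous_map_snd[of "top_of_set {0..2::real}" "top_of_set {0..1::real}"]
    by (simp_all add: continuous_map_in_subtopology)
  from continuous_map_torus_point[OF this]
  show cont: "continuous_map ?Z (torus 2) torus_point" by simp
  have "compact_space ?Z"
    unfolding compact_space_prod_topology by (intro disjI2 conjI compact_space_subtopology) simp_all
  moreover have "Hausdorff_space (torus 2)"
    by (simp add: torus_def Hausdorff_space_product_topology nsphere_def Hausdorff_space_subtopology Hausdorff_Euclidean_space)
  ultimately show "closed_map ?Z (torus 2) torus_point"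
    using cont by (intro continuous_imp_closed_map_gen Hausdorff_imp_kc_space)
  have "y \<in> torus_point ` topspace ?Z" if y: "y \<in> topspace (torus 2)" for y
  proof -
    have circ: "\<exists>\<theta>. 0 \<le> \<theta> \<and> \<theta> \<le> 2 * pi \<and> circle_point \<theta> = x" if "x \<in> topspace (nsphere 1)" for x
    proof -
      obtain \<theta> where \<theta>: "0 \<le> \<theta>" "\<theta> < 2 * pi" "x 0 = cos \<theta>" "x 1 = sin \<theta>"
        using sincos_total_2pi[of "x 0" "x 1"] \<open>x \<in> _\<close> unfolding topspace_circle by blast
      moreover have "x i = 0" if "i > 1" for i using \<open>x \<in> _\<close> that unfolding topspace_circle by blast
      then have "circle_point \<theta> i = x i" for i
        using \<theta>(3,4) by (cases "i = 0"; cases "i = 1") (auto simp: circle_point_def)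
      ultimately show ?thesis by (intro exI[of _ \<theta>]) auto
    qed
    have y': "y 0 \<in> topspace (nsphere 1)" "y 1 \<in> topspace (nsphere 1)" "y \<in> extensional {..<2}"
      using y by (auto simp: torus_def PiE_iff)
    obtain \<theta> \<eta> where \<theta>: "0 \<le> \<theta>" "\<theta> \<le> 2 * pi" "circle_point \<theta> = y 0"
      and \<eta>: "0 \<le> \<eta>" "\<eta> \<le> 2 * pi" "circle_point \<eta> = y 1" using circ y'(1,2) by metis
    have "torus_point (\<theta> / pi, \<eta> / (2 * pi)) k = y k" for k
    proof (cases "k < 2")
      case True
      then have "k = 0 \<or> k = 1" by auto
      then show ?thesis using \<theta>(3) \<eta>(3) by (auto simp: torus_point_def)
    next
      case False
      then show ?thesis using y'(3) by (simp add: torus_point_def extensional_def)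
    qed
    then have "y = torus_point (\<theta> / pi, \<eta> / (2 * pi))" by auto
    moreover have "(\<theta> / pi, \<eta> / (2 * pi)) \<in> topspace ?Z"
      using \<theta> \<eta> by (simp add: divide_simps)
    ultimately show ?thesis by blast
  qed
  then show "torus_point ` topspace ?Z = topspace (torus 2)"
    using continuous_map_image_subset_topspace[OF cont] by blast
qed

text \<open>Transfers evaluations on the interval times \<open>\<sigma>\<close> to the unit square,
  where both factors are the fundamental simplex.\<close>

lemma pair_simplex_unit_path:
  assumes \<sigma>: "singular_simplex 1 Z \<sigma>" and L: "L \<noteq> []" "set L \<subseteq> {..1} \<times> {..1}" "length L - 1 = n"
    and f: "\<And>t s. t \<in> {0..1} \<Longrightarrow> s \<in> {0..1} \<Longrightarrow> F (t, simplex_path \<sigma> s) = G (t, s)"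
  shows "simplex_map n F (pair_simplex unit_path \<sigma> L) = simplex_map n G (pair_simplex unit_path unit_path L)"
  unfolding simplex_map_def
proof (rule restrict_ext)
  fix x assume x: "x \<in> standard_simplex n"
  have v: "vertex_sum (map fst L) x \<in> standard_simplex 1" "vertex_sum (map snd L) x \<in> standard_simplex 1"
    by (rule vertex_sum_in_standard_simplex; use x L in \<open>auto\<close>)+
  have u: "subsimplex unit_path (map fst L) x = vertex_sum (map fst L) x 1"
    "subsimplex unit_path (map snd L) x = vertex_sum (map snd L) x 1"
    using x v L(3) by (simp_all add: subsimplex_def unit_path_def)
  have s: "subsimplex \<sigma> (map snd L) x = simplex_path \<sigma> (vertex_sum (map snd L) x 1)"
    using x L(3) simplex_path_eq[OF v(2), of \<sigma>] by (simp add: subsimplex_def)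
  have "vertex_sum (map fst L) x 1 \<in> {0..1}" "vertex_sum (map snd L) x 1 \<in> {0..1}"
    using v by (simp_all add: standard_simplex_def)
  then show "(F \<circ> pair_simplex unit_path \<sigma> L) x = (G \<circ> pair_simplex unit_path unit_path L) x"
    using x L(3) f by (simp add: pair_simplex_def u s)
qed

lemma prism_loop_eq:
  fixes u :: "('a, 'f::comm_ring_1) cochain"
  assumes H: "continuous_map (prod_topology unit_interval Z) X H"
    and K: "continuous_map (prod_topology unit_interval Z) X K"
    and ends: "\<And>z. z \<in> topspace Z \<Longrightarrow> H (0, z) = K (0, z)" "\<And>z. z \<in> topspace Z \<Longrightarrow> H (1, z) = K (1, z)"
    and u: "\<And>f. continuous_map (torus 2) X f \<Longrightarrow> singular_coboundary 2 (torus 2) (cochain_pullback 2 (torus 2) f u)"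
    and \<sigma>: "singular_simplex 1 Z \<sigma>" and loop: "simplex_path \<sigma> 0 = simplex_path \<sigma> 1"
  shows "prism H u \<sigma> = prism K u \<sigma>"
proof -
  let ?I = unit_interval
  let ?D = "prod_topology (top_of_set {0..2::real}) ?I" and ?II = "prod_topology ?I ?I"
  let ?p = "simplex_path \<sigma>"
  have p: "continuous_map ?I Z ?p" by (rule continuous_map_simplex_path[OF \<sigma>])
  have pZ: "?p s \<in> topspace Z" if "s \<in> {0..1}" for s
    using continuous_map_image_subset_topspace[OF p] that by auto
  text \<open>\<open>H\<close> followed by the reverse of \<open>K\<close> is a map of a torus, on which \<open>u\<close> becomes a coboundary; the
    parts of the torus given by \<open>H\<close> and by \<open>K\<close> have the same boundary.\<close>
  define G where "G z = (if fst z \<le> 1 then H (fst z, ?p (snd z)) else K (2 - fst z, ?p (snd z)))" for z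
  have G: "continuous_map ?D X G"
    unfolding G_def
  proof (rule continuous_map_cases_le)
    have fst: "continuous_map ?D euclideanreal fst"
      using continuous_map_fst[of "top_of_set {0..2::real}" ?I] by (simp add: continuous_map_in_subtopology)
    show "continuous_map ?D euclideanreal fst" by (rule fst)
    have snd: "continuous_map ?D Z (\<lambda>z. ?p (snd z))"
      using continuous_map_compose[OF continuous_map_snd[of "top_of_set {0..2::real}" ?I] p] by (simp only: o_def)
    have "continuous_map (subtopology ?D {z \<in> topspace ?D. fst z \<le> 1}) (prod_topology ?I Z) (\<lambda>z. (fst z, ?p (snd z)))"
      by (intro continuous_map_pairedI continuous_map_into_subtopology continuous_map_from_subtopology fst snd) auto
    from continuous_map_compose[OF this H]
    show "continuous_map (subtopology ?D {z \<in> topspace ?D. fst z \<le> 1}) X (\<lambda>z. H (fst z, ?p (snd z)))"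
      by (simp only: o_def)
    have "continuous_map (subtopology ?D {z \<in> topspace ?D. 1 \<le> fst z}) (prod_topology ?I Z) (\<lambda>z. (2 - fst z, ?p (snd z)))"
      by (intro continuous_map_pairedI continuous_map_into_subtopology continuous_map_diff
          continuous_map_from_subtopology fst snd) auto
    from continuous_map_compose[OF this K]
    show "continuous_map (subtopology ?D {z \<in> topspace ?D. 1 \<le> fst z}) X (\<lambda>z. K (2 - fst z, ?p (snd z)))"
      by (simp only: o_def)
    show "H (fst z, ?p (snd z)) = K (2 - fst z, ?p (snd z))" if "z \<in> topspace ?D" "fst z = 1" for z
      using that ends(2) pZ by auto
  qed simp
  have G_eq: "G z = G z'" if "z \<in> topspace ?D" "z' \<in> topspace ?D" "torus_point z = torus_point z'" for z z'
  proof -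
    obtain t s t' s' where z: "z = (t, s)" "z' = (t', s')" by (cases z, cases z')
    have ts: "t \<in> {0..2}" "t' \<in> {0..2}" "s \<in> {0..1}" "s' \<in> {0..1}" using that(1,2) z by auto
    have "t = t' \<or> {t, t'} = {0, 2}" "s = s' \<or> {s, s'} = {0, 1}"
      using torus_point_eq[OF that(3)[unfolded z] ts] by blast+
    moreover have "?p s = ?p s'" if "s = s' \<or> {s, s'} = {0, 1}"
      using that loop by (auto simp: doubleton_eq_iff)
    moreover have "G (t, s) = G (t', s)" if "t = t' \<or> {t, t'} = {0, 2}"
      using that ends(1)[OF pZ[OF ts(3)]] by (auto simp: doubleton_eq_iff G_def)
    ultimately show ?thesis unfolding z by (simp add: G_def)
  qed
  obtain f where f: "continuous_map (torus 2) X f" "\<And>z. z \<in> topspace ?D \<Longrightarrow> f (torus_point z) = G z"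
    using quotient_map_lift_exists[OF quotient_map_torus_point G] G_eq by metis
  obtain b where b: "cochain_pullback 2 (torus 2) f u = coboundary 1 (torus 2) b"
    using u[OF f(1)] by (auto simp: numeral_2_eq_2 singular_coboundary_Suc)
  have fst: "continuous_map ?II euclideanreal fst" and snd: "continuous_map ?II euclideanreal snd"
    using continuous_map_fst[of ?I ?I] continuous_map_snd[of ?I ?I] by (simp_all add: continuous_map_in_subtopology)
  \<comment> \<open>The unit square parametrizing the half of the torus given by \<open>H\<close>;
    its companion \<open>qK\<close> runs backwards through the other half.\<close>
  define qH where "qH z = torus_point (fst z, snd z)" for z :: "real \<times> real"
  define qK where "qK z = torus_point (2 - fst z, snd z)" for z :: "real \<times> real"
  have qH: "continuous_map ?II (torus 2) qH" and qK: "continuous_map ?II (torus 2) qK"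
    unfolding qH_def qK_def by (intro continuous_map_torus_point continuous_map_diff fst snd; simp)+
  note \<iota> = singular_simplex_unit_path
  define B where "B q = cochain_pullback 1 ?II q b" for q
  \<comment> \<open>On the square the pulled back \<open>u\<close> is the coboundary of
    \<open>B q\<close>, so the Leibniz rule reduces the value to the four edges: those over the ends
    of the time interval and those over the ends of the loop.\<close>
  have prism: "prism F u \<sigma> = coboundary 0 ?I (\<lambda>\<kappa>. cross_eval (B q) 0 1 \<kappa> unit_path) unit_path -
      coboundary 0 ?I (\<lambda>\<kappa>. cross_eval (B q) 1 0 unit_path \<kappa>) unit_path"
    if F: "\<And>t s. t \<in> {0..1} \<Longrightarrow> s \<in> {0..1} \<Longrightarrow> F (t, ?p s) = f (q (t, s))"
      and q: "continuous_map ?II (torus 2) q" for F q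
  proof -
    have "prism F u \<sigma> = cross_eval (\<lambda>\<rho>. u (simplex_map 2 f (simplex_map 2 q \<rho>))) 1 1 unit_path unit_path"
      unfolding prism_def cross_eval_def
    proof (rule frag_eval_cong)
      fix L assume "L \<in> Poly_Mapping.keys (cross (1 + 1) [0..<Suc 1] [0..<Suc 1])"
      note L = keys_cross[OF this]
      have "simplex_map 2 F (pair_simplex unit_path \<sigma> L) = simplex_map 2 (\<lambda>z. f (q z)) (pair_simplex unit_path unit_path L)"
        by (rule pair_simplex_unit_path[OF \<sigma> L(1)]) (use L F in \<open>auto simp: atLeast0LessThan lessThan_Suc_atMost\<close>)
      also have "\<dots> = simplex_map 2 f (simplex_map 2 q (pair_simplex unit_path unit_path L))"
        by (simp add: simplex_map_def fun_eq_iff restrict_def)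
      finally show "u (simplex_map 2 F (pair_simplex unit_path \<sigma> L)) =
        u (simplex_map 2 f (simplex_map 2 q (pair_simplex unit_path unit_path L)))" by simp
    qed
    also have "\<dots> = cross_eval (coboundary 1 ?II (B q)) 1 1 unit_path unit_path"
    proof (rule cross_eval_cong[OF \<iota> \<iota>])
      fix \<rho> assume "singular_simplex (1 + 1) ?II \<rho>"
      then have \<rho>: "singular_simplex 2 ?II \<rho>" by (simp add: numeral_2_eq_2)
      have "coboundary 1 ?II (B q) = cochain_pullback 2 ?II q (cochain_pullback 2 (torus 2) f u)"
        unfolding B_def b using coboundary_pullback[OF q, of 1 b] by (simp add: numeral_2_eq_2)
      then show "u (simplex_map 2 f (simplex_map 2 q \<rho>)) = coboundary 1 ?II (B q) \<rho>"
        using \<rho> singular_simplex_simplex_map[OF \<rho> q] by (simp add: cochain_pullback_def)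
    qed
    also have "\<dots> = coboundary 0 ?I (\<lambda>\<kappa>. cross_eval (B q) 0 1 \<kappa> unit_path) unit_path -
      coboundary 0 ?I (\<lambda>\<kappa>. cross_eval (B q) 1 0 unit_path \<kappa>) unit_path"
      using cross_eval_coboundary[OF \<iota>[unfolded One_nat_def] \<iota>[unfolded One_nat_def], of "B q"] by simp
    finally show ?thesis .
  qed
  note face = singular_simplex_unit_path_face and face_eq = unit_path_face
  have B_eval: "B q \<rho> = b (simplex_map 1 q \<rho>)" if "singular_simplex 1 ?II \<rho>" for q \<rho>
    using that by (simp add: B_def cochain_pullback_def)
  \<comment> \<open>The edges over the two ends of the loop have the same image in the torus and
    cancel.\<close>
  have zero: "coboundary 0 ?I (\<lambda>\<kappa>. cross_eval (B q) 1 0 unit_path \<kappa>) unit_path = 0"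
    if q: "\<And>t. q (t, 0) = q (t, 1)" for q
  proof -
    have "cross_eval (B q) 1 0 unit_path (singular_face 1 0 unit_path) =
        cross_eval (B q) 1 0 unit_path (singular_face 1 1 unit_path)"
      unfolding cross_eval_def
    proof (rule frag_eval_cong)
      fix L assume "L \<in> Poly_Mapping.keys (cross (1 + 0) [0..<Suc 1] [0..<Suc 0])"
      note L = keys_cross[OF this]
      have V: "set L \<subseteq> {..1} \<times> {..0}" using L(3) by (auto simp: atLeast0LessThan lessThan_Suc_atMost)
      have sing: "singular_simplex 1 ?II (pair_simplex unit_path (singular_face 1 k unit_path) L)" if "k \<le> 1" for k
        using simplex_familyD(1)[OF simplex_family_pair[OF \<iota> face[OF that]] L(1) V] L(2) by simp
      have pt: "subsimplex (singular_face 1 k unit_path) (map snd L) x = 1 - real k"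
        if "k \<le> 1" "x \<in> standard_simplex 1" for k x
      proof -
        have S: "set (map snd L) \<subseteq> {..0}" using V by auto
        have len: "length (map snd L) - 1 = 1" and ne: "map snd L \<noteq> []" using L(1,2) by simp_all
        have x: "x \<in> standard_simplex (length (map snd L) - 1)" by (simp only: len that(2))
        show ?thesis
          using face_eq[OF that(1) vertex_sum_in_standard_simplex[OF ne S x]] x
          by (simp only: subsimplex_def restrict_apply if_True)
      qed
      have "simplex_map 1 q (pair_simplex unit_path (singular_face 1 0 unit_path) L) =
          simplex_map 1 q (pair_simplex unit_path (singular_face 1 1 unit_path) L)"
        unfolding simplex_map_def
        by (rule restrict_ext) (use L(2) pt[of 0] pt[of 1] q in \<open>simp add: pair_simplex_def\<close>)
      then show "B q (pair_simplex unit_path (singular_face 1 0 unit_path) L) =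
          B q (pair_simplex unit_path (singular_face 1 1 unit_path) L)"
        using B_eval[OF sing] by simp
    qed
    then show ?thesis using \<iota> by (simp add: coboundary_def)
  qed
  have q01: "qH (t, 0) = qH (t, 1)" "qK (t, 0) = qK (t, 1)" for t
    by (auto simp: qH_def qK_def torus_point_def circle_point_def fun_eq_iff)
  \<comment> \<open>For \<open>k = 0\<close> both squares end at time \<open>1\<close>, the common
    edge. For \<open>k = 1\<close> the times are \<open>0\<close> and \<open>2\<close>, which the
    torus identifies.\<close>
  have qq: "qH (1 - real k, s) = qK (1 - real k, s)" if "k \<le> 1" for k s
  proof -
    have "k = 0 \<or> k = 1" using that by linarith
    then show ?thesis
      by (elim disjE) (simp_all add: qH_def qK_def torus_point_def circle_point_def fun_eq_iff mult.commute[of pi])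
  qed
  have same: "cross_eval (B qH) 0 1 (singular_face 1 k unit_path) unit_path =
      cross_eval (B qK) 0 1 (singular_face 1 k unit_path) unit_path" if k: "k \<le> 1" for k
    unfolding cross_eval_def
  proof (rule frag_eval_cong)
    fix L assume "L \<in> Poly_Mapping.keys (cross (0 + 1) [0..<Suc 0] [0..<Suc 1])"
    note L = keys_cross[OF this]
    have V: "set L \<subseteq> {..0} \<times> {..1}" using L(3) by (auto simp: atLeast0LessThan lessThan_Suc_atMost)
    have sing: "singular_simplex 1 ?II (pair_simplex (singular_face 1 k unit_path) unit_path L)"
      using simplex_familyD(1)[OF simplex_family_pair[OF face[OF k] \<iota>] L(1) V] L(2) by simp
    have pt: "subsimplex (singular_face 1 k unit_path) (map fst L) x = 1 - real k" if "x \<in> standard_simplex 1" for x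
    proof -
      have S: "set (map fst L) \<subseteq> {..0}" using V by auto
      have len: "length (map fst L) - 1 = 1" and ne: "map fst L \<noteq> []" using L(1,2) by simp_all
      have x: "x \<in> standard_simplex (length (map fst L) - 1)" by (simp only: len that)
      show ?thesis
        using face_eq[OF k vertex_sum_in_standard_simplex[OF ne S x]] x
        by (simp only: subsimplex_def restrict_apply if_True)
    qed
    have "simplex_map 1 qH (pair_simplex (singular_face 1 k unit_path) unit_path L) =
        simplex_map 1 qK (pair_simplex (singular_face 1 k unit_path) unit_path L)"
      unfolding simplex_map_def
      by (rule restrict_ext) (use L(2) pt qq[OF k] in \<open>simp add: pair_simplex_def\<close>)
    then show "B qH (pair_simplex (singular_face 1 k unit_path) unit_path L) =
        B qK (pair_simplex (singular_face 1 k unit_path) unit_path L)"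
      using B_eval[OF sing] by simp
  qed
  have "prism H u \<sigma> = coboundary 0 ?I (\<lambda>\<kappa>. cross_eval (B qH) 0 1 \<kappa> unit_path) unit_path -
      coboundary 0 ?I (\<lambda>\<kappa>. cross_eval (B qH) 1 0 unit_path \<kappa>) unit_path"
    by (rule prism[OF _ qH]) (auto simp: qH_def f(2) G_def)
  moreover have "prism K u \<sigma> = coboundary 0 ?I (\<lambda>\<kappa>. cross_eval (B qK) 0 1 \<kappa> unit_path) unit_path -
      coboundary 0 ?I (\<lambda>\<kappa>. cross_eval (B qK) 1 0 unit_path \<kappa>) unit_path"
  proof (rule prism[OF _ qK])
    fix t s :: real assume ts: "t \<in> {0..1}" "s \<in> {0..1}"
    then have "f (qK (t, s)) = G (2 - t, s)" by (simp add: qK_def f(2))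
    also have "\<dots> = K (t, ?p s)" using ts ends(2)[OF pZ[OF ts(2)]] by (cases "t = 1") (auto simp: G_def)
    finally show "K (t, ?p s) = f (qK (t, s))" by simp
  qed
  moreover have "coboundary 0 ?I (\<lambda>\<kappa>. cross_eval (B qH) 0 1 \<kappa> unit_path) unit_path =
      coboundary 0 ?I (\<lambda>\<kappa>. cross_eval (B qK) 0 1 \<kappa> unit_path) unit_path"
    using \<iota> same[of 0] same[of 1] by (simp add: coboundary_def)
  ultimately show ?thesis using zero[OF q01(1)] zero[OF q01(2)] by simp
qed

text \<open>A Mayer-Vietoris argument on cochains. Only simplices inside \<open>A\<close> or inside
  \<open>B\<close> are considered; a simplex that merely lies in the union is left to
  subdivision.\<close>

theorem difference_cochain_weight:
  fixes u :: "('a, 'f::comm_ring_1) cochain"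
  assumes A: "homotopic_with (\<lambda>_. True) (subtopology (prod_topology X X) A) X fst snd"
    and B: "homotopic_with (\<lambda>_. True) (subtopology (prod_topology X X) B) X fst snd"
    and u: "singular_cocycle 2 X u" "normalized X u"
    and ator: "\<And>f. continuous_map (torus 2) X f \<Longrightarrow> singular_coboundary 2 (torus 2) (cochain_pullback 2 (torus 2) f u)"
  obtains h where "\<And>\<rho>. singular_simplex 2 (subtopology (prod_topology X X) A) \<rho> \<or>
      singular_simplex 2 (subtopology (prod_topology X X) B) \<rho> \<Longrightarrow>
    difference_cochain X u \<rho> = coboundary 1 (prod_topology X X) h \<rho>"
proof -
  let ?XX = "prod_topology X X"
  let ?A = "subtopology ?XX A" and ?B = "subtopology ?XX B" and ?Z = "subtopology ?XX (A \<inter> B)"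
  obtain H where H: "continuous_map (prod_topology unit_interval ?A) X H" "\<And>z. H (0, z) = fst z" "\<And>z. H (1, z) = snd z"
    by (rule homotopic_withE[OF A]) (rule that)
  obtain K where K: "continuous_map (prod_topology unit_interval ?B) X K" "\<And>z. K (0, z) = fst z" "\<And>z. K (1, z) = snd z"
    by (rule homotopic_withE[OF B]) (rule that)
  have sub: "continuous_map (prod_topology unit_interval ?Z) X F"
    if "continuous_map (prod_topology unit_interval (subtopology ?XX S)) X F" "A \<inter> B \<subseteq> S" for F S
  proof -
    have "?Z = subtopology (subtopology ?XX S) (A \<inter> B)"
      using that(2) by (simp add: subtopology_subtopology inf.absorb2)
    then have "prod_topology unit_interval ?Z = subtopology (prod_topology unit_interval (subtopology ?XX S)) (UNIV \<times> (A \<inter> B))"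
      by (simp add: subtopology_Times)
    then show ?thesis using continuous_map_from_subtopology[OF that(1)] by metis
  qed
  have HZ: "continuous_map (prod_topology unit_interval ?Z) X H" and KZ: "continuous_map (prod_topology unit_interval ?Z) X K"
    by (rule sub[OF H(1)], blast) (rule sub[OF K(1)], blast)
  have diff: "coboundary 1 (subtopology ?XX S) (prism F u) \<rho> = difference_cochain X u \<rho>"
    if F: "continuous_map (prod_topology unit_interval (subtopology ?XX S)) X F" "\<And>z. F (0, z) = fst z" "\<And>z. F (1, z) = snd z"
      and \<rho>: "singular_simplex 2 (subtopology ?XX S) \<rho>" for F S \<rho>
  proof -
    have "singular_simplex 2 ?XX \<rho>" using \<rho> by (simp add: singular_simplex_subtopology)
    then show ?thesis
      unfolding coboundary_prism[OF F(1) u \<rho>] F(2,3) by (simp add: difference_cochain_def cochain_pullback_def)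
  qed
  obtain g where g: "\<And>\<sigma>. singular_simplex 1 ?Z \<sigma> \<Longrightarrow>
      prism H u \<sigma> - prism K u \<sigma> = g (simplex_path \<sigma> 1) - g (simplex_path \<sigma> 0)"
  proof (rule cocycle_vanishing_on_loops[of ?Z "\<lambda>\<sigma>. prism H u \<sigma> - prism K u \<sigma>"])
    fix \<rho> assume \<rho>: "singular_simplex 2 ?Z \<rho>"
    have "coboundary 1 ?Z (\<lambda>\<sigma>. prism H u \<sigma> - prism K u \<sigma>) \<rho> =
        coboundary 1 ?Z (prism H u) \<rho> - coboundary 1 ?Z (prism K u) \<rho>"
      by (simp only: coboundary_def right_diff_distrib sum_subtractf split: if_split) simp
    then show "coboundary 1 ?Z (\<lambda>\<sigma>. prism H u \<sigma> - prism K u \<sigma>) \<rho> = 0"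
      using diff[OF HZ H(2,3) \<rho>] diff[OF KZ K(2,3) \<rho>] by simp
  next
    fix \<sigma> assume "singular_simplex 1 ?Z \<sigma>" "simplex_path \<sigma> 0 = simplex_path \<sigma> 1"
    from prism_loop_eq[OF HZ KZ _ _ ator this] show "prism H u \<sigma> - prism K u \<sigma> = 0"
      by (simp add: H K)
  qed (rule that)
  \<comment> \<open>The potential \<open>g\<close> is a function on all points, so
    \<open>\<gamma>\<close> is defined beyond the intersection and its coboundary can be subtracted
    on all of \<open>A\<close> without changing the coboundary there.\<close>
  define \<gamma> where "\<gamma> \<kappa> = g (\<kappa> (\<lambda>j. if j = 0 then 1 else 0))" for \<kappa> :: "(nat \<Rightarrow> real) \<Rightarrow> 'a \<times> 'a"
  have \<gamma>: "coboundary 0 ?XX \<gamma> \<sigma> = g (simplex_path \<sigma> 1) - g (simplex_path \<sigma> 0)"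
    if "singular_simplex 1 ?XX \<sigma>" for \<sigma>
  proof -
    have "simplical_face 0 (\<lambda>j. if j = 0 then 1 else 0) = (\<lambda>j. if j = 0 then 1 - (1::real) else if j = 1 then 1 else 0)"
      "simplical_face 1 (\<lambda>j. if j = 0 then 1 else 0) = (\<lambda>j. if j = 0 then 1 - (0::real) else if j = 1 then 0 else 0)"
      by (auto simp: simplical_face_def fun_eq_iff)
    then show ?thesis
      using that by (simp add: coboundary_def \<gamma>_def singular_face_def simplex_path_def)
  qed
  \<comment> \<open>On 1-simplices in both sets the corrected primitive for \<open>A\<close> equals
    the one for \<open>B\<close>, so the case distinction gives a valid primitive on either
    side.\<close>
  define h where "h \<sigma> = (if singular_simplex 1 ?A \<sigma> then prism H u \<sigma> - coboundary 0 ?XX \<gamma> \<sigma> else prism K u \<sigma>)" for \<sigma>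
  have hB: "h \<sigma> = prism K u \<sigma>" if \<sigma>: "singular_simplex 1 ?B \<sigma>" for \<sigma>
  proof (cases "singular_simplex 1 ?A \<sigma>")
    case True
    then have "singular_simplex 1 ?Z \<sigma>" "singular_simplex 1 ?XX \<sigma>"
      using \<sigma> by (auto simp: singular_simplex_subtopology)
    then have "coboundary 0 ?XX \<gamma> \<sigma> = prism H u \<sigma> - prism K u \<sigma>" by (simp only: g \<gamma>)
    then show ?thesis using True by (simp add: h_def)
  qed (simp add: h_def)
  have cob: "coboundary 1 ?XX h \<rho> = coboundary 1 (subtopology ?XX S) h' \<rho>"
    if \<rho>: "singular_simplex 2 (subtopology ?XX S) \<rho>"
      and h': "\<And>\<sigma>. singular_simplex 1 (subtopology ?XX S) \<sigma> \<Longrightarrow> h \<sigma> = h' \<sigma>" for S \<rho> h'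
  proof -
    have \<rho>': "singular_simplex (Suc 1) (subtopology ?XX S) \<rho>" using \<rho> by (simp add: numeral_2_eq_2)
    then have "singular_simplex (Suc 1) ?XX \<rho>" by (simp add: singular_simplex_subtopology)
    moreover have "h (singular_face (Suc 1) k \<rho>) = h' (singular_face (Suc 1) k \<rho>)" if "k \<in> {..Suc 1}" for k
      using singular_simplex_singular_face[OF \<rho>', of k] that by (intro h') simp
    ultimately show ?thesis
      unfolding coboundary_def if_P[OF \<rho>'] by (simp only: if_True cong: sum.cong)
  qed
  show thesis
  proof (rule that, erule disjE)
    fix \<rho> assume \<rho>: "singular_simplex 2 ?B \<rho>"
    show "difference_cochain X u \<rho> = coboundary 1 ?XX h \<rho>"
      using cob[OF \<rho> hB] diff[OF K \<rho>] by simp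
  next
    fix \<rho> assume \<rho>: "singular_simplex 2 ?A \<rho>"
    have XX: "singular_simplex 2 ?XX \<rho>" using \<rho> by (simp add: singular_simplex_subtopology)
    have "coboundary 1 ?XX h \<rho> = coboundary 1 ?A (\<lambda>\<sigma>. prism H u \<sigma> - coboundary 0 ?XX \<gamma> \<sigma>) \<rho>"
      by (rule cob[OF \<rho>]) (simp add: h_def)
    also have "\<dots> = coboundary 1 ?A (prism H u) \<rho> - coboundary 1 ?XX (coboundary 0 ?XX \<gamma>) \<rho>"
    proof -
      have "singular_simplex (Suc 1) ?A \<rho>" "singular_simplex (Suc 1) ?XX \<rho>"
        using \<rho> XX by (simp_all add: numeral_2_eq_2)
      then show ?thesis by (simp only: coboundary_def[of 1] if_True right_diff_distrib sum_subtractf)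
    qed
    also have "\<dots> = difference_cochain X u \<rho>"
      using diff[OF H \<rho>] coboundary_coboundary[of 0 ?XX \<gamma>] by simp
    finally show "difference_cochain X u \<rho> = coboundary 1 ?XX h \<rho>" by simp
  qed
qed

section \<open>Cycles detecting cohomology classes\<close>

text \<open>Chains with coefficients in the field. In positive characteristic integral cycles may
  fail to detect a class, so the cycle must be allowed coefficients in the field.\<close>

definition pm_scale :: "'f::field \<Rightarrow> ('x \<Rightarrow>\<^sub>0 'f) \<Rightarrow> ('x \<Rightarrow>\<^sub>0 'f)"
  where "pm_scale c v = Poly_Mapping.map ((*) c) v"

lemma lookup_pm_scale [simp]: "Poly_Mapping.lookup (pm_scale c v) x = c * Poly_Mapping.lookup v x"
  by (simp add: pm_scale_def map.rep_eq when_def)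

interpretation pm: vector_space pm_scale
  by unfold_locales (rule poly_mapping_eqI, simp add: lookup_add algebra_simps)+

lemma vector_space_times: "vector_space ((*) :: 'f::field \<Rightarrow> 'f \<Rightarrow> 'f)"
  by unfold_locales (simp_all add: algebra_simps)

text \<open>Linear extension from generators. The scalar multiplication \<open>s\<close> of the
  target is a parameter so that both the boundary map and the evaluation of a cochain are
  instances.\<close>

definition pm_extend :: "('f::field \<Rightarrow> 'b \<Rightarrow> 'b::ab_group_add) \<Rightarrow> ('x \<Rightarrow> 'b) \<Rightarrow> ('x \<Rightarrow>\<^sub>0 'f) \<Rightarrow> 'b"
  where "pm_extend s D c = (\<Sum>x\<in>Poly_Mapping.keys c. s (Poly_Mapping.lookup c x) (D x))"

lemma pm_extend_superset:
  assumes "vector_space s" "finite S" "Poly_Mapping.keys c \<subseteq> S"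
  shows "pm_extend s D c = (\<Sum>x\<in>S. s (Poly_Mapping.lookup c x) (D x))"
proof -
  interpret vector_space s by fact
  show ?thesis
    unfolding pm_extend_def by (rule sum.mono_neutral_left) (use assms in \<open>auto simp: in_keys_iff\<close>)
qed

lemma linear_pm_extend:
  assumes "vector_space s"
  shows "Vector_Spaces.linear pm_scale s (pm_extend s D)"
proof -
  interpret s: vector_space s by fact
  show ?thesis
    unfolding Vector_Spaces.linear_iff
  proof (intro conjI allI)
    fix a b :: "'c \<Rightarrow>\<^sub>0 'a"
    let ?S = "Poly_Mapping.keys a \<union> Poly_Mapping.keys b"
    show "pm_extend s D (a + b) = pm_extend s D a + pm_extend s D b"
      using keys_add[of a b]
      by (simp add: pm_extend_superset[OF assms, of ?S] lookup_add sum.distrib s.scale_left_distrib)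
  next
    fix r and a :: "'c \<Rightarrow>\<^sub>0 'a"
    have "Poly_Mapping.keys (pm_scale r a) \<subseteq> Poly_Mapping.keys a" by (auto simp: in_keys_iff)
    then show "pm_extend s D (pm_scale r a) = s r (pm_extend s D a)"
      by (simp add: pm_extend_superset[OF assms, of "Poly_Mapping.keys a"] s.scale_sum_right)
  qed (fact pm.vector_space_axioms, fact assms)
qed

lemma pm_extend_single:
  assumes "vector_space s"
  shows "pm_extend s D (Poly_Mapping.single x 1) = D x"
proof -
  interpret vector_space s by fact
  show ?thesis by (simp add: pm_extend_def)
qed

lemma pm_expansion: "c = (\<Sum>x\<in>Poly_Mapping.keys c. pm_scale (Poly_Mapping.lookup c x) (Poly_Mapping.single x 1))"
  by (rule poly_mapping_eqI) (auto simp: lookup_sum lookup_single when_def sum.delta' in_keys_iff if_distrib cong: if_cong)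

lemma linear_eq_pm_extend:
  assumes "vector_space s" "Vector_Spaces.linear pm_scale s f"
  shows "f c = pm_extend s (\<lambda>x. f (Poly_Mapping.single x 1)) c"
proof -
  interpret s: vector_space s by fact
  interpret vector_space_pair pm_scale s ..
  have "f c = f (\<Sum>x\<in>Poly_Mapping.keys c. pm_scale (Poly_Mapping.lookup c x) (Poly_Mapping.single x 1))"
    using pm_expansion[of c] by simp
  also have "\<dots> = pm_extend s (\<lambda>x. f (Poly_Mapping.single x 1)) c"
    by (simp add: linear_sum[OF assms(2)] linear_scale[OF assms(2)] pm_extend_def)
  finally show ?thesis .
qed

lemma coboundary_of_restriction:
  "coboundary p X (\<lambda>\<sigma>. if singular_simplex p X \<sigma> then \<beta> \<sigma> else 0) = coboundary p X \<beta>"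
proof
  fix \<sigma>
  have "singular_simplex p X (singular_face (Suc p) k \<sigma>)" if "singular_simplex (Suc p) X \<sigma>" "k \<in> {..Suc p}" for k
    using singular_simplex_singular_face[OF that(1), of k] that(2) by simp
  then show "coboundary p X (\<lambda>\<sigma>. if singular_simplex p X \<sigma> then \<beta> \<sigma> else 0) \<sigma> = coboundary p X \<beta> \<sigma>"
    by (auto simp: coboundary_def simp del: sum.atMost_Suc intro!: sum.cong)
qed

lemma singular_coboundary_coboundary: "singular_coboundary (Suc p) X (coboundary p X \<beta>)"
  unfolding singular_coboundary_Suc
  by (intro exI[of _ "\<lambda>\<sigma>. if singular_simplex p X \<sigma> then \<beta> \<sigma> else 0"])
    (simp add: coboundary_of_restriction singular_cochain_def)

text \<open>Over a field, a cochain vanishing on all cycles extends from boundaries to all chains, so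
  that it is a coboundary.\<close>

theorem cycle_detecting_cochain:
  fixes \<phi> :: "('a, 'f::field) cochain"
  assumes \<phi>: "singular_cochain (Suc p) X \<phi>" and non: "\<not> singular_coboundary (Suc p) X \<phi>"
  obtains S l where "finite S" "\<And>\<sigma>. \<sigma> \<in> S \<Longrightarrow> singular_simplex (Suc p) X \<sigma>"
    "(\<Sum>\<sigma>\<in>S. l \<sigma> * \<phi> \<sigma>) \<noteq> 0" "\<And>\<beta>. (\<Sum>\<sigma>\<in>S. l \<sigma> * coboundary p X \<beta> \<sigma>) = 0"
proof -
  define D :: "((nat \<Rightarrow> real) \<Rightarrow> 'a) \<Rightarrow> (((nat \<Rightarrow> real) \<Rightarrow> 'a) \<Rightarrow>\<^sub>0 'f)" where
    "D \<sigma> = (if singular_simplex (Suc p) X \<sigma> then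
      (\<Sum>k\<le>Suc p. pm_scale ((-1) ^ k) (Poly_Mapping.single (singular_face (Suc p) k \<sigma>) 1)) else 0)" for \<sigma>
  let ?d = "pm_extend pm_scale D" and ?ev = "pm_extend ((*) :: 'f \<Rightarrow> 'f \<Rightarrow> 'f)"
  have ld: "Vector_Spaces.linear pm_scale pm_scale ?d" by (rule linear_pm_extend) unfold_locales
  have lev: "Vector_Spaces.linear pm_scale (*) (?ev \<psi>)" for \<psi> :: "_ \<Rightarrow> 'f"
    by (rule linear_pm_extend) unfold_locales
  interpret dd: vector_space_pair "pm_scale :: 'f \<Rightarrow> (((nat \<Rightarrow> real) \<Rightarrow> 'a) \<Rightarrow>\<^sub>0 'f) \<Rightarrow> _" 
    "pm_scale :: 'f \<Rightarrow> (((nat \<Rightarrow> real) \<Rightarrow> 'a) \<Rightarrow>\<^sub>0 'f) \<Rightarrow> _" ..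
  interpret dv: vector_space_pair "pm_scale :: 'f \<Rightarrow> (((nat \<Rightarrow> real) \<Rightarrow> 'a) \<Rightarrow>\<^sub>0 'f) \<Rightarrow> _" 
    "(*) :: 'f \<Rightarrow> 'f \<Rightarrow> 'f" ..
  have evD: "?ev \<beta> (D \<sigma>) = coboundary p X \<beta> \<sigma>" for \<beta> \<sigma>
  proof (cases "singular_simplex (Suc p) X \<sigma>")
    case True
    have "?ev \<beta> (Poly_Mapping.single x 1) = \<beta> x" for x
      by (rule pm_extend_single) unfold_locales
    then show ?thesis
      using True unfolding D_def coboundary_def if_P[OF True] dv.linear_sum[OF lev] dv.linear_scale[OF lev]
      by simp
  qed (simp add: D_def coboundary_def dv.linear_0[OF lev])
  have ev: "?ev \<beta> (?d c) = ?ev (coboundary p X \<beta>) c" for \<beta> c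
    unfolding pm_extend_def[of pm_scale] dv.linear_sum[OF lev] dv.linear_scale[OF lev] evD
    by (simp add: pm_extend_def)
  have "\<exists>c. ?d c = 0 \<and> ?ev \<phi> c \<noteq> 0"
  proof (rule ccontr)
    assume "\<not> ?thesis"
    then have ker: "?ev \<phi> c = 0" if "?d c = 0" for c using that by blast
    \<comment> \<open>A linear section of the boundary map over its image, which exists over a
      field. As \<open>g (?d c) - c\<close> is a cycle, \<open>\<phi>\<close> takes the same value
      on \<open>g (?d c)\<close> and on \<open>c\<close>; so \<open>\<phi>\<close> composed with
      \<open>g\<close> is the desired primitive.\<close>
    obtain g where g: "Vector_Spaces.linear pm_scale pm_scale g" "\<And>c. ?d (g (?d c)) = ?d c"
      using dd.linear_exists_right_inverse_on[OF ld, of UNIV] by auto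
    define \<beta> where "\<beta> \<kappa> = ?ev \<phi> (g (Poly_Mapping.single \<kappa> 1))" for \<kappa>
    have lg: "Vector_Spaces.linear pm_scale (*) (\<lambda>v. ?ev \<phi> (g v))"
      using Vector_Spaces.linear_compose[OF g(1) lev] by (simp add: o_def)
    have "?ev \<phi> (g v) = ?ev \<beta> v" for v
      unfolding \<beta>_def by (rule linear_eq_pm_extend[OF _ lg]) unfold_locales
    then have "?ev (coboundary p X \<beta>) c = ?ev \<phi> (g (?d c))" for c by (simp add: ev)
    moreover have "?ev \<phi> (g (?d c) - c) = 0" for c
      by (rule ker) (simp add: dd.linear_diff[OF ld] g(2))
    then have "?ev \<phi> (g (?d c)) = ?ev \<phi> c" for c by (simp add: dv.linear_diff[OF lev])
    ultimately have "?ev (coboundary p X \<beta>) (Poly_Mapping.single \<sigma> 1) = ?ev \<phi> (Poly_Mapping.single \<sigma> 1)" for \<sigma> by simp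
    then have "coboundary p X \<beta> = \<phi>"
      by (simp add: pm_extend_single[OF vector_space_times] fun_eq_iff)
    then show False using non singular_coboundary_coboundary by metis
  qed
  then obtain c where c: "?d c = 0" "?ev \<phi> c \<noteq> 0" by blast
  \<comment> \<open>The chain \<open>c\<close> may involve functions that are not singular
    simplices. Cochains vanish on them, so they can be discarded.\<close>
  let ?S = "{\<sigma> \<in> Poly_Mapping.keys c. singular_simplex (Suc p) X \<sigma>}"
  have restr: "?ev \<psi> c = (\<Sum>\<sigma>\<in>?S. Poly_Mapping.lookup c \<sigma> * \<psi> \<sigma>)" if "singular_cochain (Suc p) X \<psi>" for \<psi>
    unfolding pm_extend_def
    by (rule sum.mono_neutral_right) (use that in \<open>auto simp: singular_cochain_def\<close>)
  show thesis
  proof (rule that[of ?S "Poly_Mapping.lookup c"])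
    show "(\<Sum>\<sigma>\<in>?S. Poly_Mapping.lookup c \<sigma> * \<phi> \<sigma>) \<noteq> 0" using c(2) restr[OF \<phi>] by simp
    show "(\<Sum>\<sigma>\<in>?S. Poly_Mapping.lookup c \<sigma> * coboundary p X \<beta> \<sigma>) = 0" for \<beta>
      using restr[OF singular_cochain_coboundary] ev[of \<beta> c] c(1) dv.linear_0[OF lev] by simp
  qed auto
qed

section \<open>The lower bound\<close>

lemma singular_cocycle_diff:
  "singular_cocycle p X \<phi> \<Longrightarrow> singular_cocycle p X \<psi> \<Longrightarrow> singular_cocycle p X (\<lambda>\<sigma>. \<phi> \<sigma> - \<psi> \<sigma>)"
  using singular_cocycle_add[of p X \<phi> "\<lambda>\<sigma>. -1 * \<psi> \<sigma>"] singular_cocycle_cmul[of p X \<psi> "-1"] by simp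

lemma singular_cocycle_difference:
  assumes "singular_cocycle 2 X u"
  shows "singular_cocycle 2 (prod_topology X X) (difference_cochain X u)"
  unfolding difference_cochain_def
  by (intro singular_cocycle_diff singular_cocycle_pullback[OF _ assms] continuous_map_fst continuous_map_snd)

lemma singular_cocycle_cochain_power:
  assumes "singular_cocycle 2 X u"
  shows "singular_cocycle (2 * n) X (cochain_power X u n)"
proof (induction n)
  case (Suc n)
  then show ?case using singular_cocycle_cup[OF Suc assms] by (simp add: add.commute)
qed (simp add: singular_cocycle_unit)

text \<open>The \<open>i\<close>-th factor is replaced by a cohomologous cocycle that vanishes on \<open>U (2 * i)\<close> and
  \<open>U (2 * i + 1)\<close>.\<close>

lemma power_vanishing_on_cover:
  fixes v :: "('a, 'f::comm_ring_1) cochain"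
  assumes v: "singular_cocycle 2 Y v"
    and h: "\<And>i. i < m \<Longrightarrow> \<exists>h. \<forall>\<rho>. singular_simplex 2 (subtopology Y (U (2 * i))) \<rho> \<or>
      singular_simplex 2 (subtopology Y (U (2 * i + 1))) \<rho> \<longrightarrow> v \<rho> = coboundary 1 Y h \<rho>"
  shows "\<exists>w. singular_cocycle (2 * m) Y w \<and> singular_coboundary (2 * m) Y (\<lambda>\<rho>. cochain_power Y v m \<rho> - w \<rho>) \<and>
    (\<forall>j \<rho>. j < 2 * m \<longrightarrow> singular_simplex (2 * m) (subtopology Y (U j)) \<rho> \<longrightarrow> w \<rho> = 0)"
  using h
proof (induction m)
  case 0
  then show ?case
    using singular_cocycle_unit[of Y] by (intro exI[of _ "unit_cochain Y"]) (simp add: singular_coboundary_0)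
next
  case (Suc m)
  obtain w where w: "singular_cocycle (2 * m) Y w"
    "singular_coboundary (2 * m) Y (\<lambda>\<rho>. cochain_power Y v m \<rho> - w \<rho>)"
    "\<And>j \<rho>. j < 2 * m \<Longrightarrow> singular_simplex (2 * m) (subtopology Y (U j)) \<rho> \<Longrightarrow> w \<rho> = 0"
    using Suc by (meson less_Suc_eq)
  obtain h where h: "\<And>\<rho>. singular_simplex 2 (subtopology Y (U (2 * m))) \<rho> \<or>
      singular_simplex 2 (subtopology Y (U (2 * m + 1))) \<rho> \<Longrightarrow> v \<rho> = coboundary 1 Y h \<rho>"
    using Suc.prems[of m] by blast
  define v' where "v' = (\<lambda>\<rho>. v \<rho> - coboundary 1 Y h \<rho>)"
  have cob: "singular_coboundary 2 Y (coboundary 1 Y h)"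
    using singular_coboundary_coboundary[of 1 Y h] by (simp add: numeral_2_eq_2)
  have v': "singular_cocycle 2 Y v'"
    unfolding v'_def by (intro singular_cocycle_diff v singular_coboundary_imp_cocycle cob)
  let ?w = "cochain_cup (2 * m) 2 Y w v'"
  have eq: "2 * Suc m = 2 * m + 2" by simp
  show ?case
    unfolding eq
  proof (intro exI[of _ ?w] conjI allI impI)
    show "singular_cocycle (2 * m + 2) Y ?w" by (rule singular_cocycle_cup[OF w(1) v'])
    \<comment> \<open>The two factors are exchanged one after the other: the power up to
      \<open>m\<close> while \<open>v\<close> is kept, and \<open>v\<close> once the power has
      become \<open>w\<close>.\<close>
    have "(\<lambda>\<rho>. cochain_power Y v (Suc m) \<rho> - ?w \<rho>) =
      (\<lambda>\<rho>. cochain_cup (2 * m) 2 Y (\<lambda>\<rho>. cochain_power Y v m \<rho> - w \<rho>) v \<rho> +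
        cochain_cup (2 * m) 2 Y w (coboundary 1 Y h) \<rho>)"
      by (auto simp: cochain_cup_def v'_def algebra_simps)
    then show "singular_coboundary (2 * m + 2) Y (\<lambda>\<rho>. cochain_power Y v (Suc m) \<rho> - ?w \<rho>)"
      using singular_coboundary_add[OF singular_coboundary_cup_left[OF w(2) v] singular_coboundary_cup_right[OF w(1) cob]]
      by simp
    fix j \<rho> assume j: "j < 2 * m + 2" and \<rho>: "singular_simplex (2 * m + 2) (subtopology Y (U j)) \<rho>"
    have fr: "singular_simplex (2 * m) (subtopology Y (U j)) (front_face (2 * m) \<rho>)"
      by (rule front_face_simplex[OF \<rho>])
    have bk: "singular_simplex 2 (subtopology Y (U j)) (back_face (2 * m) 2 \<rho>)"
      by (rule back_face_simplex[OF \<rho>])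
    consider "j < 2 * m" | "j = 2 * m" | "j = 2 * m + 1" using j by linarith
    then have "w (front_face (2 * m) \<rho>) * v' (back_face (2 * m) 2 \<rho>) = 0"
    proof cases
      case 1
      then show ?thesis using w(3)[OF 1 fr] by simp
    next
      case 2
      then show ?thesis using h[of "back_face (2 * m) 2 \<rho>"] bk by (simp add: v'_def)
    next
      case 3
      then show ?thesis using h[of "back_face (2 * m) 2 \<rho>"] bk by (simp add: v'_def)
    qed
    then show "?w \<rho> = 0" by (simp add: cochain_cup_def)
  qed
qed

lemma cochain_eval_diff: "cochain_eval \<phi> (a - b) = cochain_eval \<phi> a - cochain_eval \<phi> b"
  using cochain_eval_add[of \<phi> "a - b" b] by simp

text \<open>\<open>E\<close> is finite so that one number of subdivisions makes all its chains small.\<close>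

lemma cocycle_vanishing_on_small:
  fixes w :: "('a, 'f::comm_ring_1) cochain"
  assumes w: "singular_cocycle (Suc p) Y w"
    and cover: "\<And>V. V \<in> \<V> \<Longrightarrow> openin Y V" "topspace Y \<subseteq> \<Union>\<V>"
    and small: "\<And>V \<rho>. V \<in> \<V> \<Longrightarrow> singular_simplex (Suc p) (subtopology Y V) \<rho> \<Longrightarrow> w \<rho> = 0"
    and E: "finite E" "\<And>c. c \<in> E \<Longrightarrow> singular_chain (Suc p) Y c"
  obtains \<beta> where "\<And>c. c \<in> E \<Longrightarrow> cochain_eval w c = cochain_eval (coboundary p Y \<beta>) c"
proof -
  have "\<exists>N. \<forall>m f. N \<le> m \<longrightarrow> f \<in> Poly_Mapping.keys ((singular_subdivision (Suc p) ^^ m) c) \<longrightarrow>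
      (\<exists>V\<in>\<V>. f \<in> standard_simplex (Suc p) \<rightarrow> V)" if "c \<in> E" for c
    by (rule sufficient_iterated_singular_subdivision_exists[OF cover E(2)[OF that]]) blast+
  then obtain N where N: "\<And>c m f. c \<in> E \<Longrightarrow> N c \<le> m \<Longrightarrow>
      f \<in> Poly_Mapping.keys ((singular_subdivision (Suc p) ^^ m) c) \<Longrightarrow> \<exists>V\<in>\<V>. f \<in> standard_simplex (Suc p) \<rightarrow> V"
    by metis
  define m where "m = Max (insert 0 (N ` E))"
  have m: "N c \<le> m" if "c \<in> E" for c using that E(1) by (simp add: m_def)
  obtain h :: "nat \<Rightarrow> 'a chain \<Rightarrow> 'a chain" where h: "\<And>p. h p 0 = 0" "\<And>p c1 c2. h p (c1 - c2) = h p c1 - h p c2"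
    "\<And>p X c. singular_chain p X c \<Longrightarrow> singular_chain (Suc p) X (h p c)"
    "\<And>p X c. singular_chain p X c \<Longrightarrow> chain_boundary (Suc p) (h p c) + h (p - Suc 0) (chain_boundary p c) =
       (singular_subdivision p ^^ m) c - c"
    using chain_homotopic_iterated_singular_subdivision[of m] by metis
  \<comment> \<open>The transpose of the subdivision homotopy applied to \<open>w\<close>. Since
    \<open>w\<close> vanishes on the subdivided chain and on boundaries, the homotopy formula gives
    \<open>w\<close> on \<open>c\<close> as minus \<open>w\<close> on \<open>h\<close> of the
    boundary of \<open>c\<close>.\<close>
  define \<beta> where "\<beta> \<rho> = - cochain_eval w (h p (frag_of \<rho>))" for \<rho>
  have \<beta>: "cochain_eval \<beta> c = - cochain_eval w (h p c)" for c
    by (rule frag_linear_eq[where c = c]) (simp_all add: cochain_eval_diff h(2) \<beta>_def)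
  show thesis
  proof (rule that)
    fix c assume c: "c \<in> E"
    let ?s = "(singular_subdivision (Suc p) ^^ m) c"
    have ch: "singular_chain (Suc p) Y c" by (rule E(2)[OF c])
    have hom: "chain_boundary (Suc (Suc p)) (h (Suc p) c) + h p (chain_boundary (Suc p) c) = ?s - c"
      using h(4)[OF ch] by simp
    have "singular_chain (Suc p) Y (?s - c)"
      unfolding hom[symmetric]
      by (intro singular_chain_add singular_chain_boundary_alt h(3) ch)
    from singular_chain_add[OF this ch] have sch: "singular_chain (Suc p) Y ?s" by simp
    have "w \<rho> = 0" if \<rho>: "\<rho> \<in> Poly_Mapping.keys ?s" for \<rho>
    proof -
      obtain V where V: "V \<in> \<V>" "\<rho> \<in> standard_simplex (Suc p) \<rightarrow> V" using N[OF c m[OF c] \<rho>] by blast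
      have "singular_simplex (Suc p) Y \<rho>" using sch that by (auto simp: singular_chain_def)
      then have "singular_simplex (Suc p) (subtopology Y V) \<rho>"
        using V(2) by (auto simp: singular_simplex_subtopology)
      then show ?thesis by (rule small[OF V(1)])
    qed
    then have "cochain_eval w ?s = 0" by (simp add: cochain_eval_def)
    moreover have "cochain_eval w (chain_boundary (Suc (Suc p)) (h (Suc p) c)) = 0"
      using cochain_eval_boundary[OF h(3)[OF ch], of w] w by (simp add: singular_cocycle_def cochain_eval_def)
    ultimately have "cochain_eval w c = - cochain_eval w (h p (chain_boundary (Suc p) c))"
      using arg_cong[OF hom, of "cochain_eval w"] by (simp add: cochain_eval_add cochain_eval_diff)
    also have "\<dots> = cochain_eval \<beta> (chain_boundary (Suc p) c)" by (simp add: \<beta>)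
    also have "\<dots> = cochain_eval (coboundary p Y \<beta>) c" by (rule cochain_eval_boundary[OF ch, symmetric])
    finally show "cochain_eval w c = cochain_eval (coboundary p Y \<beta>) c" .
  qed
qed

text \<open>No positive integer up to \<open>2 n\<close> is divisible by the characteristic, so
  \<open>fact (2 * n)\<close> is nonzero in the field, and the binomial coefficient divides
  it.\<close>

lemma of_nat_central_binomial_neq_0:
  assumes "CHAR('f::field) = 0 \<or> CHAR('f) > 2 * n"
  shows "(of_nat (2 * n choose n) :: 'f) \<noteq> 0"
proof -
  have "(of_nat (fact k) :: 'f) \<noteq> 0" if "k \<le> 2 * n" for k
    using that
  proof (induction k)
    case (Suc k)
    have "\<not> CHAR('f) dvd Suc k" using assms Suc.prems by (auto dest: dvd_imp_le)
    then have "(of_nat (Suc k) :: 'f) \<noteq> 0" by (simp only: of_nat_eq_0_iff_char_dvd not_False_eq_True)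
    moreover have "(of_nat (fact k) :: 'f) \<noteq> 0" using Suc by simp
    moreover have "(of_nat (fact (Suc k)) :: 'f) = of_nat (Suc k) * of_nat (fact k)"
      by (simp only: fact_Suc of_nat_mult of_nat_id)
    ultimately show ?case by simp
  qed simp
  then have "(of_nat (fact (2 * n)) :: 'f) \<noteq> 0" by blast
  moreover have "fact (2 * n) = fact n * fact n * (2 * n choose n)"
    using binomial_fact_lemma[of n "2 * n"] by simp
  ultimately show ?thesis by (metis mult_eq_0_iff of_nat_mult)
qed

theorem topological_complexity_ge:
  fixes u :: "('a, 'f::field) cochain"
  assumes char: "CHAR('f) = 0 \<or> CHAR('f) > 2 * n"
    and u: "singular_cocycle 2 X u" "normalized X u"
    and ator: "\<And>f. continuous_map (torus 2) X f \<Longrightarrow> singular_coboundary 2 (torus 2) (cochain_pullback 2 (torus 2) f u)"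
    and pow: "\<not> singular_coboundary (2 * n) X (cochain_power X u n)"
  shows "enat (4 * n) \<le> topological_complexity X"
  unfolding topological_complexity_def
proof (rule Inf_greatest, clarify)
  fix k :: nat and U :: "nat \<Rightarrow> ('a \<times> 'a) set"
  let ?XX = "prod_topology X X"
  assume pl: "\<forall>j\<le>k. openin ?XX (U j) \<and> (\<exists>s. local_motion_planner X (U j) s)"
    and cov: "(\<Union>j\<le>k. U j) = topspace ?XX"
  show "enat (4 * n) \<le> enat k"
  proof (rule ccontr)
    assume "\<not> enat (4 * n) \<le> enat k"
    then have k: "k < 4 * n" by simp
    then obtain p where p: "2 * n = Suc p" by (cases n) auto
    \<comment> \<open>The last set is repeated, so that \<open>4 n\<close> sets are available in
      \<open>2 n\<close> pairs, one for each factor of the power.\<close>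
    define U' where "U' j = U (min j k)" for j
    have U'op: "openin ?XX (U' j)" for j using pl by (simp add: U'_def)
    have U'hom: "homotopic_with (\<lambda>_. True) (subtopology ?XX (U' j)) X fst snd" for j
      using pl motion_planner_iff_homotopic[OF openin_subset[OF U'op]] by (simp add: U'_def)
    let ?v = "difference_cochain X u"
    have v: "singular_cocycle 2 ?XX ?v" by (rule singular_cocycle_difference[OF u(1)])
    have "\<exists>h. \<forall>\<rho>. singular_simplex 2 (subtopology ?XX (U' (2 * i))) \<rho> \<or>
      singular_simplex 2 (subtopology ?XX (U' (2 * i + 1))) \<rho> \<longrightarrow> ?v \<rho> = coboundary 1 ?XX h \<rho>" for i
      by (rule difference_cochain_weight[OF U'hom U'hom u ator, of "2 * i" "2 * i + 1"]) blast+
    from power_vanishing_on_cover[where U = U' and m = "2 * n", OF v this]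
    obtain w where w: "singular_cocycle (2 * (2 * n)) ?XX w"
      "singular_coboundary (2 * (2 * n)) ?XX (\<lambda>\<rho>. cochain_power ?XX ?v (2 * n) \<rho> - w \<rho>)"
      "\<And>j \<rho>. j < 2 * (2 * n) \<Longrightarrow> singular_simplex (2 * (2 * n)) (subtopology ?XX (U' j)) \<rho> \<Longrightarrow> w \<rho> = 0"
      by blast
    have d: "2 * (2 * n) = Suc (Suc (p + p))" using p by simp
    have "singular_cochain (Suc p) X (cochain_power X u n)"
      using singular_cocycle_cochain_power[OF u(1), of n] unfolding p by (simp add: singular_cocycle_def)
    then obtain S l where S: "finite S" "\<And>\<sigma>. \<sigma> \<in> S \<Longrightarrow> singular_simplex (Suc p) X \<sigma>"
      "(\<Sum>\<sigma>\<in>S. l \<sigma> * cochain_power X u n \<sigma>) \<noteq> 0" "\<And>\<beta>. (\<Sum>\<sigma>\<in>S. l \<sigma> * coboundary p X \<beta> \<sigma>) = 0"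
      by (rule cycle_detecting_cochain[OF _ pow[unfolded p]]) (rule that)
    \<comment> \<open>Evaluation on the product of the detecting cycle with itself, with the field
      coefficients \<open>l\<close> kept outside the cross product.\<close>
    define L where "L \<phi> = (\<Sum>\<sigma>\<in>S. \<Sum>\<tau>\<in>S. l \<sigma> * l \<tau> * cross_eval \<phi> (Suc p) (Suc p) \<sigma> \<tau>)" for \<phi> :: "('a \<times> 'a, 'f) cochain"
    \<comment> \<open>The Leibniz rule splits the value into two sums. In each of them the cycle is
      paired with a coboundary in one of the coordinates, which gives \<open>0\<close>.\<close>
    have L_cob: "L (coboundary (Suc (p + p)) ?XX \<beta>) = 0" for \<beta>
    proof -
      have "L (coboundary (Suc (p + p)) ?XX \<beta>) =
        (\<Sum>\<sigma>\<in>S. \<Sum>\<tau>\<in>S. l \<tau> * (l \<sigma> * coboundary p X (\<lambda>\<sigma>'. cross_eval \<beta> p (Suc p) \<sigma>' \<tau>) \<sigma>)) +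
        (\<Sum>\<sigma>\<in>S. \<Sum>\<tau>\<in>S. (-1) ^ Suc p * l \<sigma> * (l \<tau> * coboundary p X (\<lambda>\<tau>'. cross_eval \<beta> (Suc p) p \<sigma> \<tau>') \<tau>))"
        unfolding L_def sum.distrib[symmetric]
        by (intro sum.cong refl) (simp add: cross_eval_coboundary[OF S(2) S(2)] algebra_simps)
      also have "(\<Sum>\<sigma>\<in>S. \<Sum>\<tau>\<in>S. l \<tau> * (l \<sigma> * coboundary p X (\<lambda>\<sigma>'. cross_eval \<beta> p (Suc p) \<sigma>' \<tau>) \<sigma>)) = 0"
        by (subst sum.swap) (simp add: sum_distrib_left[symmetric] S(4))
      also have "(\<Sum>\<sigma>\<in>S. \<Sum>\<tau>\<in>S. (-1) ^ Suc p * l \<sigma> * (l \<tau> * coboundary p X (\<lambda>\<tau>'. cross_eval \<beta> (Suc p) p \<sigma> \<tau>') \<tau>)) = 0"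
        by (simp add: sum_distrib_left[symmetric] S(4) del: power_Suc)
      finally show ?thesis by simp
    qed
    \<comment> \<open>Subdivision applies to integral chains. The product cycle has coefficients in
      the field, so its finitely many integral pieces are subdivided instead.\<close>
    define E :: "((nat \<Rightarrow> real) \<Rightarrow> 'a) \<times> ((nat \<Rightarrow> real) \<Rightarrow> 'a) \<Rightarrow> ('a \<times> 'a) chain"
      where "E = (\<lambda>(\<sigma>, \<tau>). frag_extend (\<lambda>M. frag_of (pair_simplex \<sigma> \<tau> M))
      (cross (Suc p + Suc p) [0..<Suc (Suc p)] [0..<Suc (Suc p)]))"
    have E_eval: "cross_eval \<phi> (Suc p) (Suc p) \<sigma> \<tau> = cochain_eval \<phi> (E (\<sigma>, \<tau>))" for \<phi> :: "('a \<times> 'a, 'f) cochain" and \<sigma> \<tau>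
    proof -
      have "cochain_eval \<phi> c = frag_eval \<phi> c" for c by (simp add: cochain_eval_def frag_eval_def)
      then show ?thesis by (simp add: E_def frag_eval_extend cross_eval_def del: upt_Suc)
    qed
    have E_chain: "singular_chain (Suc (Suc (p + p))) ?XX (E (\<sigma>, \<tau>))" if "\<sigma> \<in> S" "\<tau> \<in> S" for \<sigma> \<tau>
      unfolding E_def prod.case
    proof (rule singular_chain_extend)
      fix M assume "M \<in> Poly_Mapping.keys (cross (Suc p + Suc p) [0..<Suc (Suc p)] [0..<Suc (Suc p)])"
      note M = keys_cross[OF this]
      have "singular_simplex (length M - 1) ?XX (pair_simplex \<sigma> \<tau> M)"
        by (rule simplex_familyD(1)[OF simplex_family_pair[OF S(2)[OF that(1)] S(2)[OF that(2)]] M(1)])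
          (use M(3) in \<open>auto simp: atLeast0LessThan lessThan_Suc_atMost simp del: upt_Suc\<close>)
      then show "singular_chain (Suc (Suc (p + p))) ?XX (frag_of (pair_simplex \<sigma> \<tau> M))"
        using M(2) by (simp add: singular_chain_of)
    qed
    obtain \<beta> where \<beta>: "\<And>c. c \<in> E ` (S \<times> S) \<Longrightarrow> cochain_eval w c = cochain_eval (coboundary (Suc (p + p)) ?XX \<beta>) c"
    proof (rule cocycle_vanishing_on_small[of "Suc (p + p)" ?XX w "U' ` {..<4 * n}" "E ` (S \<times> S)"])
      show "singular_cocycle (Suc (Suc (p + p))) ?XX w" using w(1) unfolding d .
      show "topspace ?XX \<subseteq> \<Union> (U' ` {..<4 * n})"
      proof
        fix z assume "z \<in> topspace ?XX"
        then obtain j where "j \<le> k" "z \<in> U j" using cov by blast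
        then show "z \<in> \<Union> (U' ` {..<4 * n})" using k by (auto simp: U'_def intro!: bexI[of _ j])
      qed
      fix V \<rho> assume V: "V \<in> U' ` {..<4 * n}" and \<rho>: "singular_simplex (Suc (Suc (p + p))) (subtopology ?XX V) \<rho>"
      then obtain j where "V = U' j" "j < 2 * (2 * n)" by auto
      then show "w \<rho> = 0" using w(3)[of j \<rho>] \<rho> unfolding d by blast
    qed (use U'op S(1) E_chain in auto)
    have "L w = L (coboundary (Suc (p + p)) ?XX \<beta>)"
      unfolding L_def by (intro sum.cong refl) (simp add: E_eval \<beta>)
    moreover obtain \<gamma> where \<gamma>: "(\<lambda>\<rho>. cochain_power ?XX ?v (2 * n) \<rho> - w \<rho>) = coboundary (Suc (p + p)) ?XX \<gamma>"
      using w(2) unfolding d singular_coboundary_Suc by blast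
    have "L (\<lambda>\<rho>. cochain_power ?XX ?v (2 * n) \<rho> - w \<rho>) = L (cochain_power ?XX ?v (2 * n)) - L w"
      by (simp add: L_def cross_eval_def frag_eval_minus_fun right_diff_distrib sum_subtractf)
    ultimately have "L (cochain_power ?XX ?v (2 * n)) = 0"
      by (simp add: L_cob \<gamma>)
    moreover have "L (cochain_power ?XX ?v (2 * n)) = (-1) ^ n * of_nat (2 * n choose n) *
        ((\<Sum>\<sigma>\<in>S. l \<sigma> * cochain_power X u n \<sigma>) * (\<Sum>\<tau>\<in>S. l \<tau> * cochain_power X u n \<tau>))"
    proof -
      have ev: "cross_eval (cochain_power ?XX ?v (2 * n)) (2 * n) (2 * n) \<sigma> \<tau> =
          (-1) ^ n * of_nat (2 * n choose n) * cochain_power X u n \<sigma> * cochain_power X u n \<tau>"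
        if "\<sigma> \<in> S" "\<tau> \<in> S" for \<sigma> \<tau>
        by (rule cross_eval_difference_power[OF u(2)]; simp only: p S(2) that)
      have "L (cochain_power ?XX ?v (2 * n)) = (\<Sum>\<sigma>\<in>S. \<Sum>\<tau>\<in>S. (-1) ^ n * of_nat (2 * n choose n) *
          ((l \<sigma> * cochain_power X u n \<sigma>) * (l \<tau> * cochain_power X u n \<tau>)))"
        unfolding L_def p[symmetric]
        by (intro sum.cong refl, simp only: ev, simp only: mult_ac)
      then show ?thesis by (subst sum_product) (simp only: sum_distrib_left)
    qed
    ultimately show False
      using S(3) of_nat_central_binomial_neq_0[OF char] by simp
  qed
qed

section \<open>From cochains to cohomology classes\<close>

lemma cup_power_class:
  assumes "singular_cocycle 2 X u"
  shows "cup_power 2 X (cohomology_class 2 X u) n = cohomology_class (2 * n) X (cochain_power X u n)"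
proof (induction n)
  case (Suc n)
  then show ?case
    using cohomology_cup_class[OF singular_cocycle_cochain_power[OF assms, of n] assms]
    by (simp add: add.commute)
qed simp

lemma cohomology_class_eq_one:
  "cohomology_class p X \<phi> = \<one>\<^bsub>cohomology_group p X\<^esub> \<longleftrightarrow> singular_coboundary p X \<phi>"
proof
  have "\<phi> \<in> cohomology_class p X \<phi>"
    by (auto simp: mem_cohomology_class intro!: exI[of _ "\<lambda>_. 0"] singular_coboundary_zero)
  moreover assume "cohomology_class p X \<phi> = \<one>\<^bsub>cohomology_group p X\<^esub>"
  ultimately show "singular_coboundary p X \<phi>" by (simp add: one_cohomology_group)
next
  assume \<phi>: "singular_coboundary p X \<phi>"
  have "cohomology_class p X \<phi> = cohomology_class p X (\<lambda>_. 0)"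
    using cohomology_class_shift[OF \<phi>, of "\<lambda>_. 0"] by simp
  also have "\<dots> = Collect (singular_coboundary p X)"
    by (intro equalityI subsetI) (simp_all add: mem_cohomology_class)
  finally show "cohomology_class p X \<phi> = \<one>\<^bsub>cohomology_group p X\<^esub>"
    by (simp only: one_cohomology_group)
qed

theorem theorem1p4:
  fixes X :: "'a topology" and \<C> :: "'a cells" and n :: nat
  assumes "cw_complex X \<C>" and "connected_space X" and "cw_dimension \<C> = enat (2 * n)"
    and "CHAR('f::field) = 0 \<or> CHAR('f) > 2 * n"
    and "\<exists>u :: ('a, 'f) cochain set. u \<in> carrier (cohomology_group 2 X) \<and> atoroidal 2 X u \<and>
           cup_power 2 X u n \<noteq> \<one>\<^bsub>cohomology_group (2 * n) X\<^esub>"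
  shows "topological_complexity X = 2 * cw_dimension \<C>"
proof -
  interpret cw X \<C> by unfold_locales fact
  obtain u :: "('a, 'f) cochain set" where u: "u \<in> carrier (cohomology_group 2 X)" "atoroidal 2 X u"
    "cup_power 2 X u n \<noteq> \<one>\<^bsub>cohomology_group (2 * n) X\<^esub>" using assms(5) by blast
  obtain \<phi>0 where \<phi>0: "singular_cocycle 2 X \<phi>0" "u = cohomology_class 2 X \<phi>0"
    using u(1) by (auto simp: carrier_cohomology_group)
  obtain \<beta> where \<beta>: "singular_coboundary 2 X \<beta>" "normalized X (\<lambda>\<sigma>. \<beta> \<sigma> + \<phi>0 \<sigma>)"
    by (rule normalized_representative[OF \<phi>0(1)])
  \<comment> \<open>A normalized cocycle in the class \<open>u\<close>, as the prism and shuffle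
    arguments require.\<close>
  define \<phi> where "\<phi> = (\<lambda>\<sigma>. \<beta> \<sigma> + \<phi>0 \<sigma>)"
  have \<phi>: "singular_cocycle 2 X \<phi>" "normalized X \<phi>"
    unfolding \<phi>_def by (intro singular_cocycle_add singular_coboundary_imp_cocycle \<beta> \<phi>0)+
  have u\<phi>: "u = cohomology_class 2 X \<phi>"
    unfolding \<phi>_def \<phi>0(2) by (rule cohomology_class_shift[OF \<beta>(1), symmetric])
  have ator: "singular_coboundary 2 (torus 2) (cochain_pullback 2 (torus 2) f \<phi>)"
    if f: "continuous_map (torus 2) X f" for f
    using u(2) f cohomology_pullback_class[OF f, of 2 \<phi>] cohomology_class_eq_one
    unfolding atoroidal_def u\<phi> by metis
  have pow: "\<not> singular_coboundary (2 * n) X (cochain_power X \<phi> n)"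
    using u(3) unfolding u\<phi> cup_power_class[OF \<phi>(1)] cohomology_class_eq_one .
  \<comment> \<open>On the empty space every cochain is zero, which contradicts the nonvanishing
    power. The upper bound needs a point to which the supports contract.\<close>
  have "topspace X \<noteq> {}"
  proof
    assume "topspace X = {}"
    then have "singular_cochain q X \<psi> \<Longrightarrow> \<psi> = (\<lambda>_. 0)" for q and \<psi> :: "('a, 'f) cochain"
      using singular_simplex_empty by (auto simp: singular_cochain_def fun_eq_iff)
    then have "cochain_power X \<phi> n = (\<lambda>_. 0)"
      using singular_cocycle_cochain_power[OF \<phi>(1)] by (auto simp: singular_cocycle_def)
    then show False using pow singular_coboundary_zero by metis
  qed
  then have "topological_complexity X \<le> enat (2 * (2 * n))"
    using topological_complexity_le_dim[of "2 * n"] assms(2,3) by simp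
  moreover have "enat (4 * n) \<le> topological_complexity X"
    by (rule topological_complexity_ge[OF assms(4) \<phi> ator pow])
  ultimately have "topological_complexity X = enat (4 * n)" by simp
  then show ?thesis by (simp add: assms(3) numeral_eq_enat)
qed

end
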